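(* For any spherical mixed $p$-spin model $H_N$ with mixture $\xi$ normalized by $\xi(1)=1$, any $0\le\beta\le\beta_c$, $|r|<1$, $\beta',\delta>0$, and $$f_{N,r}(\sigma)=\frac1N\log\int_{S(\sigma,r)}e^{\beta'H_N(\sigma')}d\sigma',$$ one has $$\limsup_{N\to\infty}\frac1N\log\mathbb E\,G_{N,\beta}\Big(\Big|f_{N,r}(\sigma)-\beta\beta'\frac{\xi(r)}{\xi(1)}-\tilde F(\beta',r)\Big|>\delta\Big)<0 .$$
   Context: $\mathbb S^{N-1}:=\{\sigma\in\mathbb R^N:\|\sigma\|=\sqrt N\}$ (radius $\sqrt N$) with uniform probability measure $\mu_N$. A mixture is $\xi(t)=\sum_{p\ge2}\gamma_p^2t^p$, $\gamma_p\ge0$, with $\xi(1+\epsilon)<\infty$ for some $\epsilon>0$. $H_N(\sigma)=\sum_{p\ge2}\gamma_pN^{-(p-1)/2}\sum_{i_1,\dots,i_p=1}^NJ_{i_1,\dots,i_p}\sigma_{i_1}\cdots\sigma_{i_p}$ with i.i.d. standard normal $J$'s, so $\mathbb E H_N(\sigma)H_N(\sigma')=N\xi(\langle\sigma,\sigma'\rangle/N)$. $Z_{N,\beta}=\int e^{\beta H_N}d\mu_N$, $F_{N,\beta}=\frac1N\log Z_{N,\beta}$, and $dG_{N,\beta}/d\mu_N=e^{\beta H_N}/Z_{N,\beta}$. The critical $\beta_c$ is the unique value such that $\lim_N\mathbb E F_{N,\beta}=\frac12\beta^2$ iff $\beta\le\beta_c$. $S(\sigma,r)=\{\sigma'\in\mathbb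 S^{N-1}:\langle\sigma',\sigma\rangle/N=r\}$ and $d\sigma'$ denotes its uniform probability measure. For $q\in[0,1)$, $\tilde\xi_q(t)=\xi(q+(1-q)t)-\xi(q)$ (which may have a linear term), and $\tilde F(\beta',r)$ is the limit as $N\to\infty$ of the expected free energy $\frac1N\mathbb E\log\int_{\mathbb S^{N-1}}e^{\beta'\tilde H_N}d\mu_N$, where $\tilde H_N$ is the centered Gaussian field on $\mathbb S^{N-1}$ with covariance $N\tilde\xi_{r^2}(\langle\sigma,\sigma'\rangle/N)$. *)

theory Defs
  imports "HOL-Probability.Probability"
begin

section \<open>Spheres and their uniform measures\<close>

text \<open>
  The dimension \<open>N\<close> tends to infinity, so vectors of \<open>\<real>\<^sup>N\<close> are functions on \<open>{..<N}\<close>, with the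
  product Borel structure; in particular coordinates are numbered from \<open>0\<close> to \<open>N - 1\<close>.
\<close>

abbreviation vec_space :: "nat \<Rightarrow> (nat \<Rightarrow> real) measure" where
  "vec_space N \<equiv> (\<Pi>\<^sub>M i\<in>{..<N}. borel)"

definition dot :: "nat \<Rightarrow> (nat \<Rightarrow> real) \<Rightarrow> (nat \<Rightarrow> real) \<Rightarrow> real" where
  "dot N x y = (\<Sum>i<N. x i * y i)"

definition vnorm :: "nat \<Rightarrow> (nat \<Rightarrow> real) \<Rightarrow> real" where
  "vnorm N x = sqrt (dot N x x)"

definition spin_sphere :: "nat \<Rightarrow> (nat \<Rightarrow> real) set" where
  "spin_sphere N = {\<sigma> \<in> space (vec_space N). vnorm N \<sigma> = sqrt (real N)}"

definition band :: "nat \<Rightarrow> (nat \<Rightarrow> real) \<Rightarrow> real \<Rightarrow> (nat \<Rightarrow> real) set" where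
  "band N \<sigma> r = {\<sigma>' \<in> spin_sphere N. dot N \<sigma>' \<sigma> / real N = r}"

definition std_gaussian :: "nat \<Rightarrow> (nat \<Rightarrow> real) measure" where
  "std_gaussian N = (\<Pi>\<^sub>M i\<in>{..<N}. density lborel std_normal_density)"

text \<open>
  If \<open>P\<close> is the orthogonal projection onto a subspace \<open>V\<close> of dimension at least \<open>1\<close>, and \<open>g\<close> is a
  standard Gaussian vector, then \<open>P g\<close> is a standard Gaussian vector of \<open>V\<close>.  It is almost surely
  non-zero and its law is invariant under all linear isometries of \<open>V\<close>, so \<open>P g / \<parallel>P g\<parallel>\<close> is
  distributed according to the normalised surface measure of the unit sphere of \<open>V\<close>.  Hence the
  following is the uniform probability measure on the sphere of centre \<open>c\<close> and radius \<open>\<rho>\<close> in the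
  affine subspace \<open>c + V\<close>.
\<close>

definition on_sphere ::
    "nat \<Rightarrow> ((nat \<Rightarrow> real) \<Rightarrow> nat \<Rightarrow> real) \<Rightarrow> (nat \<Rightarrow> real) \<Rightarrow> real \<Rightarrow> (nat \<Rightarrow> real) \<Rightarrow> nat \<Rightarrow> real" where
  "on_sphere N P c \<rho> g = (\<lambda>i\<in>{..<N}. c i + \<rho> * (P g i / vnorm N (P g)))"

definition uniform_sphere ::
    "nat \<Rightarrow> ((nat \<Rightarrow> real) \<Rightarrow> nat \<Rightarrow> real) \<Rightarrow> (nat \<Rightarrow> real) \<Rightarrow> real \<Rightarrow> (nat \<Rightarrow> real) measure" where
  "uniform_sphere N P c \<rho> = distr (std_gaussian N) (vec_space N) (on_sphere N P c \<rho>)"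

definition orth_proj :: "nat \<Rightarrow> (nat \<Rightarrow> real) \<Rightarrow> (nat \<Rightarrow> real) \<Rightarrow> nat \<Rightarrow> real" where
  "orth_proj N \<sigma> x = (\<lambda>i. x i - dot N x \<sigma> / dot N \<sigma> \<sigma> * \<sigma> i)"

definition sphere_measure :: "nat \<Rightarrow> (nat \<Rightarrow> real) measure" where
  "sphere_measure N = uniform_sphere N (\<lambda>x. x) (\<lambda>_. 0) (sqrt (real N))"

text \<open>
  For \<open>\<sigma>\<close> on the sphere, \<open>band N \<sigma> r\<close> is the sphere with centre \<open>r \<sigma>\<close> and radius
  \<open>sqrt (N (1 - r\<^sup>2))\<close> in the hyperplane through \<open>r \<sigma>\<close> orthogonal to \<open>\<sigma>\<close>.
\<close>

definition band_measure :: "nat \<Rightarrow> (nat \<Rightarrow> real) \<Rightarrow> real \<Rightarrow> (nat \<Rightarrow> real) measure" where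
  "band_measure N \<sigma> r =
     uniform_sphere N (orth_proj N \<sigma>) (\<lambda>i. r * \<sigma> i) (sqrt (real N * (1 - r\<^sup>2)))"

lemma sets_std_gaussian: "sets (std_gaussian N) = sets (vec_space N)"
  unfolding std_gaussian_def by (intro sets_PiM_cong) auto

lemma prob_space_std_gaussian: "prob_space (std_gaussian N)"
  unfolding std_gaussian_def
  by (intro prob_space_PiM prob_space_normal_density) simp

lemma measurable_dot [measurable]:
  assumes "\<And>i. i < N \<Longrightarrow> (\<lambda>x. f x i) \<in> borel_measurable K"
    and "\<And>i. i < N \<Longrightarrow> (\<lambda>x. g x i) \<in> borel_measurable K"
  shows "(\<lambda>x. dot N (f x) (g x)) \<in> borel_measurable K"
  unfolding dot_def using assms by (intro borel_measurable_sum borel_measurable_times) auto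

lemma measurable_on_sphere:
  assumes P: "\<And>i. i < N \<Longrightarrow> (\<lambda>x. P x i) \<in> borel_measurable (vec_space N)"
  shows "on_sphere N P c \<rho> \<in> measurable (std_gaussian N) (vec_space N)"
proof -
  have "on_sphere N P c \<rho> \<in> measurable (vec_space N) (vec_space N)"
    unfolding on_sphere_def vnorm_def
    by (rule measurable_restrict)
       (intro borel_measurable_add borel_measurable_times borel_measurable_divide
          borel_measurable_const borel_measurable_sqrt measurable_compose[OF _ borel_measurable_sqrt]
          measurable_dot P; simp)
  then show ?thesis
    by (subst measurable_cong_sets[OF sets_std_gaussian refl])
qed

lemma measurable_orth_proj:
  assumes "i < N"
  shows "(\<lambda>x. orth_proj N \<sigma> x i) \<in> borel_measurable (vec_space N)"
  unfolding orth_proj_def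
  by (intro borel_measurable_diff borel_measurable_times borel_measurable_divide
      borel_measurable_const measurable_dot measurable_component_singleton) (use assms in auto)

lemma prob_space_sphere_measure: "prob_space (sphere_measure N)"
  unfolding sphere_measure_def uniform_sphere_def
  by (intro prob_space.prob_space_distr prob_space_std_gaussian measurable_on_sphere) auto

lemma prob_space_band_measure: "prob_space (band_measure N \<sigma> r)"
  unfolding band_measure_def uniform_sphere_def
  by (intro prob_space.prob_space_distr prob_space_std_gaussian measurable_on_sphere
      measurable_orth_proj)

lemma dot_self_nonneg: "0 \<le> dot N x x"
  unfolding dot_def by (intro sum_nonneg) auto

lemma dot_orth_proj:
  assumes "dot N \<sigma> \<sigma> \<noteq> 0"
  shows "dot N \<sigma> (orth_proj N \<sigma> x) = 0"
proof -
  have "dot N \<sigma> (orth_proj N \<sigma> x) = dot N x \<sigma> - dot N x \<sigma> / dot N \<sigma> \<sigma> * dot N \<sigma> \<sigma>"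
  proof -
    have "dot N \<sigma> (orth_proj N \<sigma> x)
        = (\<Sum>i<N. x i * \<sigma> i - dot N x \<sigma> / dot N \<sigma> \<sigma> * (\<sigma> i * \<sigma> i))"
      unfolding dot_def[of N \<sigma> "orth_proj N \<sigma> x"]
      by (intro sum.cong) (auto simp: orth_proj_def algebra_simps)
    also have "\<dots> = (\<Sum>i<N. x i * \<sigma> i) - dot N x \<sigma> / dot N \<sigma> \<sigma> * (\<Sum>i<N. \<sigma> i * \<sigma> i)"
      by (simp only: sum_subtractf sum_distrib_left)
    finally show ?thesis by (simp only: dot_def)
  qed
  with assms show ?thesis by simp
qed

lemma on_sphere_in_spin_sphere:
  assumes "vnorm N g \<noteq> 0"
  shows "on_sphere N (\<lambda>x. x) (\<lambda>_. 0) (sqrt (real N)) g \<in> spin_sphere N"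
proof -
  have nz: "dot N g g \<noteq> 0" using assms by (auto simp: vnorm_def)
  let ?y = "on_sphere N (\<lambda>x. x) (\<lambda>_. 0) (sqrt (real N)) g"
  have "dot N ?y ?y = (\<Sum>i<N. real N / dot N g g * (g i * g i))"
    unfolding dot_def[of N ?y]
    by (intro sum.cong) (auto simp: on_sphere_def vnorm_def dot_self_nonneg field_simps)
  also have "\<dots> = real N / dot N g g * dot N g g"
    by (simp only: dot_def sum_distrib_left)
  also have "\<dots> = real N"
    using nz by simp
  finally show ?thesis
    by (simp add: spin_sphere_def vnorm_def space_PiM on_sphere_def)
qed

lemma on_sphere_in_band:
  assumes \<sigma>: "\<sigma> \<in> spin_sphere N" and N: "0 < N" and r: "\<bar>r\<bar> < 1"
    and nz: "vnorm N (orth_proj N \<sigma> g) \<noteq> 0"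
  shows "on_sphere N (orth_proj N \<sigma>) (\<lambda>i. r * \<sigma> i) (sqrt (real N * (1 - r\<^sup>2))) g \<in> band N \<sigma> r"
proof -
  define p where "p = orth_proj N \<sigma> g"
  define c where "c = sqrt (real N * (1 - r\<^sup>2)) / vnorm N p"
  define y where "y = on_sphere N (orth_proj N \<sigma>) (\<lambda>i. r * \<sigma> i) (sqrt (real N * (1 - r\<^sup>2))) g"
  have y: "y i = r * \<sigma> i + c * p i" if "i < N" for i
    using that by (simp add: y_def on_sphere_def c_def p_def)
  have ss: "dot N \<sigma> \<sigma> = real N"
    using \<sigma> by (simp add: spin_sphere_def vnorm_def)
  have sp: "dot N \<sigma> p = 0"
    unfolding p_def by (rule dot_orth_proj) (use ss N in simp)
  have pp: "dot N p p \<noteq> 0" using nz by (auto simp: vnorm_def p_def)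
  have r1: "0 \<le> 1 - r\<^sup>2" using r by (simp add: abs_square_le_1)
  have c2: "c\<^sup>2 * dot N p p = real N * (1 - r\<^sup>2)"
    using pp r1 by (simp add: c_def power_divide vnorm_def dot_self_nonneg)
  have "dot N y \<sigma> = r * dot N \<sigma> \<sigma> + c * dot N \<sigma> p"
    unfolding dot_def
    by (simp add: y sum_distrib_left sum.distrib[symmetric] algebra_simps)
  with ss sp have ys: "dot N y \<sigma> = r * real N" by simp
  have "dot N y y = r\<^sup>2 * dot N \<sigma> \<sigma> + 2 * r * c * dot N \<sigma> p + c\<^sup>2 * dot N p p"
    unfolding dot_def
    by (simp add: y sum_distrib_left sum.distrib[symmetric] algebra_simps power2_eq_square)
  with ss sp c2 have yy: "dot N y y = real N" by (simp add: algebra_simps)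
  have "y \<in> space (vec_space N)"
    by (simp add: y_def on_sphere_def space_PiM)
  with ys yy N have "y \<in> band N \<sigma> r"
    by (simp add: band_def spin_sphere_def vnorm_def)
  then show ?thesis by (simp add: y_def)
qed

section \<open>Mixtures and Hamiltonians\<close>

text \<open>A model is given by its coefficients \<open>\<gamma> p\<close>; the values \<open>\<gamma> 0\<close> and \<open>\<gamma> 1\<close> are never used.\<close>

definition mixture_coeffs :: "(nat \<Rightarrow> real) \<Rightarrow> bool" where
  "mixture_coeffs \<gamma> \<longleftrightarrow>
     (\<forall>p\<ge>2. 0 \<le> \<gamma> p) \<and>
     (\<exists>\<epsilon>>0. summable (\<lambda>p. if 2 \<le> p then (\<gamma> p)\<^sup>2 * (1 + \<epsilon>) ^ p else 0))"

definition mixture :: "(nat \<Rightarrow> real) \<Rightarrow> real \<Rightarrow> real" where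
  "mixture \<gamma> t = (\<Sum>p. if 2 \<le> p then (\<gamma> p)\<^sup>2 * t ^ p else 0)"

definition shifted_mixture :: "(nat \<Rightarrow> real) \<Rightarrow> real \<Rightarrow> real \<Rightarrow> real" where
  "shifted_mixture \<gamma> q t = mixture \<gamma> (q + (1 - q) * t) - mixture \<gamma> q"

text \<open>
  The multi-index \<open>(i\<^sub>1, \<dots>, i\<^sub>p)\<close> is a list of length \<open>p\<close>, so a single family \<open>j\<close> of reals indexed
  by lists holds the coefficients of all degrees.
\<close>

definition indices :: "nat \<Rightarrow> nat \<Rightarrow> nat list set" where
  "indices N p = {l. length l = p \<and> set l \<subseteq> {..<N}}"

definition hamiltonian ::
    "(nat \<Rightarrow> real) \<Rightarrow> nat \<Rightarrow> (nat list \<Rightarrow> real) \<Rightarrow> (nat \<Rightarrow> real) \<Rightarrow> real" where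
  "hamiltonian \<gamma> N j \<sigma> =
     (\<Sum>p. if 2 \<le> p
       then \<gamma> p * real N powr (- (real p - 1) / 2) * (\<Sum>l\<in>indices N p. j l * prod_list (map \<sigma> l))
       else 0)"

text \<open>
  For each \<open>N\<close> the coefficients are i.i.d. standard normal; nothing is assumed about their joint law
  for different \<open>N\<close>.
\<close>

definition disorder :: "'a measure \<Rightarrow> (nat \<Rightarrow> nat list \<Rightarrow> 'a \<Rightarrow> real) \<Rightarrow> bool" where
  "disorder M J \<longleftrightarrow>
     prob_space M \<and>
     (\<forall>N. prob_space.indep_vars M (\<lambda>_. borel) (J N) (\<Union>p\<in>{2..}. indices N p) \<and>
          (\<forall>l\<in>(\<Union>p\<in>{2..}. indices N p). distributed M lborel (J N l) std_normal_density))"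

section \<open>Free energies and Gibbs measures\<close>

definition partition_function :: "nat \<Rightarrow> real \<Rightarrow> ((nat \<Rightarrow> real) \<Rightarrow> real) \<Rightarrow> real" where
  "partition_function N \<beta> h = (\<integral>\<sigma>. exp (\<beta> * h \<sigma>) \<partial>sphere_measure N)"

definition free_energy :: "nat \<Rightarrow> real \<Rightarrow> ((nat \<Rightarrow> real) \<Rightarrow> real) \<Rightarrow> real" where
  "free_energy N \<beta> h = 1 / real N * ln (partition_function N \<beta> h)"

definition gibbs :: "nat \<Rightarrow> real \<Rightarrow> ((nat \<Rightarrow> real) \<Rightarrow> real) \<Rightarrow> (nat \<Rightarrow> real) measure" where
  "gibbs N \<beta> h =
     density (sphere_measure N) (\<lambda>\<sigma>. ennreal (exp (\<beta> * h \<sigma>) / partition_function N \<beta> h))"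

definition band_free_energy ::
    "nat \<Rightarrow> real \<Rightarrow> real \<Rightarrow> ((nat \<Rightarrow> real) \<Rightarrow> real) \<Rightarrow> (nat \<Rightarrow> real) \<Rightarrow> real" where
  "band_free_energy N r \<beta> h \<sigma> =
     1 / real N * ln (\<integral>\<sigma>'. exp (\<beta> * h \<sigma>') \<partial>band_measure N \<sigma> r)"

definition critical_beta ::
    "(nat \<Rightarrow> real) \<Rightarrow> 'a measure \<Rightarrow> (nat \<Rightarrow> nat list \<Rightarrow> 'a \<Rightarrow> real) \<Rightarrow> real \<Rightarrow> bool" where
  "critical_beta \<gamma> M J \<beta>\<^sub>c \<longleftrightarrow>
     (\<forall>\<beta>\<ge>0.
       (\<lambda>N. \<integral>\<omega>. free_energy N \<beta> (hamiltonian \<gamma> N (\<lambda>l. J N l \<omega>)) \<partial>M) \<longlonglongrightarrow> \<beta>\<^sup>2 / 2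
       \<longleftrightarrow> \<beta> \<le> \<beta>\<^sub>c)"

section \<open>Gaussian fields with prescribed covariance\<close>

definition centered_normal :: "real \<Rightarrow> real measure" where
  "centered_normal s =
     (if s = 0 then return borel 0 else density lborel (normal_density 0 s))"

definition centered_gaussian_field ::
    "'b measure \<Rightarrow> 's set \<Rightarrow> ('s \<Rightarrow> 's \<Rightarrow> real) \<Rightarrow> ('s \<Rightarrow> 'b \<Rightarrow> real) \<Rightarrow> bool" where
  "centered_gaussian_field M S C X \<longleftrightarrow>
     prob_space M \<and>
     (\<forall>s\<in>S. X s \<in> borel_measurable M) \<and>
     (\<forall>A a. finite A \<and> A \<subseteq> S \<longrightarrow>
        (\<exists>s\<ge>0. distr M borel (\<lambda>\<omega>. \<Sum>x\<in>A. a x * X x \<omega>) = centered_normal s)) \<and>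
     (\<forall>x\<in>S. \<forall>y\<in>S. (\<integral>\<omega>. X x \<omega> * X y \<omega> \<partial>M) = C x y)"

text \<open>
  The fields on the spheres whose limiting expected free energy enters the result.  Joint
  measurability is what gives a meaning to the partition function; it is required on the whole
  of \<open>\<real>\<^sup>N\<close> only because \<open>sphere_measure N\<close> lives there (off the sphere, a null set, the
  field can be taken to vanish).
\<close>

definition shifted_model ::
    "(nat \<Rightarrow> real) \<Rightarrow> real \<Rightarrow> 'b measure \<Rightarrow> (nat \<Rightarrow> (nat \<Rightarrow> real) \<Rightarrow> 'b \<Rightarrow> real) \<Rightarrow> bool" where
  "shifted_model \<gamma> q M X \<longleftrightarrow>
     (\<forall>N\<ge>1.
       centered_gaussian_field M (spin_sphere N)
         (\<lambda>\<sigma> \<sigma>'. real N * shifted_mixture \<gamma> q (dot N \<sigma> \<sigma>' / real N)) (X N) \<and>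
       (\<lambda>(\<sigma>, \<omega>). X N \<sigma> \<omega>) \<in> borel_measurable (vec_space N \<Otimes>\<^sub>M M))"

definition limit_free_energy ::
    "'b measure \<Rightarrow> (nat \<Rightarrow> (nat \<Rightarrow> real) \<Rightarrow> 'b \<Rightarrow> real) \<Rightarrow> real \<Rightarrow> real \<Rightarrow> bool" where
  "limit_free_energy M X \<beta> F \<longleftrightarrow>
     (\<lambda>N. \<integral>\<omega>. free_energy N \<beta> (\<lambda>\<sigma>. X N \<sigma> \<omega>) \<partial>M) \<longlonglongrightarrow> F"

section \<open>Logarithm with value \<open>-\<infinity>\<close> at \<open>0\<close>\<close>

text \<open>The library's real \<open>ln\<close> takes the value \<open>0\<close> at \<open>0\<close>.\<close>

definition eln :: "real \<Rightarrow> ereal" where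
  "eln x = (if 0 < x then ereal (ln x) else - \<infinity>)"

end

theory Submission
  imports Defs
begin

text \<open>
  Write \<open>G\<close> for the Gibbs measure at inverse temperature \<open>\<beta>\<close>, \<open>Z\<close> for its partition function and \<open>f(\<sigma>)\<close> for the
  free energy of the band at \<open>\<sigma>\<close>.  Up to \<open>\<beta>\<^sub>c\<close> the quenched free energy equals the annealed one, so by
  Gaussian concentration \<open>Z \<ge> exp (N (\<beta>\<^sup>2/2 - \<epsilon>))\<close> outside an event of exponentially small
  probability.  On the complement of that event \<open>G A\<close> is at most \<open>exp (- N (\<beta>\<^sup>2/2 - \<epsilon>))\<close> times the
  integral of \<open>exp (\<beta> H)\<close> over \<open>A\<close>, and by Fubini it is enough to bound \<open>E (exp (\<beta> H(\<sigma>)); \<sigma> \<in> A)\<close> for a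
  fixed \<open>\<sigma>\<close>.  The weight \<open>exp (\<beta> H(\<sigma>))\<close>, of total mass \<open>exp (N \<beta>\<^sup>2/2)\<close>, changes the law of the field \<open>H\<close> by the
  drift \<open>\<beta> Cov(H(\<sigma>), H)\<close>.  On the band at \<open>\<sigma>\<close> this drift is the constant \<open>\<beta> N \<xi>(r)\<close>, and it moves \<open>f(\<sigma>)\<close>
  by exactly \<open>\<beta> \<beta>' \<xi>(r)\<close>.  Hence only the probability that the untilted \<open>f(\<sigma>)\<close> is further than \<open>\<delta>\<close> from
  \<open>F'\<close> is left.  It is at most \<open>2 exp (- c N)\<close> with \<open>c\<close> independent of \<open>\<epsilon>\<close>, so \<open>\<epsilon> = c/2\<close> proves the claim.

  Two facts about \<open>f(\<sigma>)\<close> enter: its concentration around its mean and the limit of that mean.  The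
  hyperplane orthogonal to \<open>\<sigma>\<close> has dimension \<open>N - 1\<close>, and on it the restriction of \<open>H\<close> to the band has the
  covariance of \<open>sqrt (N / (N - 1))\<close> times the shifted field in dimension \<open>N - 1\<close> plus an independent
  centred Gaussian common to all points.  The common Gaussian contributes \<open>0\<close> to the mean of the
  log-partition function, and the factor tends to \<open>1\<close>; convexity of the log-partition function in
  the inverse temperature shows that it is harmless (\<open>expected_band_log_partition\<close>,
  \<open>expected_band_free_energy_tendsto\<close>).

  All of this is carried out for fields which are Gaussian in the sense that the characteristic
  function of every finite linear combination is the Gaussian one.  The lemma on which everything
  rests is \<open>gaussian_field_partition_law\<close>: the law of a weighted integral of \<open>exp X\<close> over the
  index space depends on the covariance of \<open>X\<close> only.  Since exponentials of Gaussians are not determined by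
  their moments, \<open>exp x\<close> is first replaced by \<open>exp (x - \<epsilon> x\<^sup>2/2)\<close>, which is bounded and is a superposition of
  the characters \<open>cis (t x)\<close>; the moments of its integral are then explicit.  Tilting by \<open>exp (X a)\<close> again gives
  a Gaussian field, with a drift, and so \<open>gaussian_change_of_measure\<close> follows.

  Concentration (\<open>log_partition_concentration\<close>) is the rotation argument of Maurey and Pisier.  Two
  independent copies \<open>X\<close> and \<open>Y\<close> of the field are joined by the path \<open>sin \<theta> X + cos \<theta> Y\<close>, whose derivative at each
  time is an independent copy of the field at that time.  Along a fine subdivision each
  increment of the log-partition function is compared, by convexity, with the Gibbs average of the
  increment of the field; the change of measure evaluates the resulting exponential moments.
\<close>

section \<open>Laws and weighted expectations determined by characteristic functions\<close>

lemma char_distr_eq_cis: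
  assumes "A \<in> borel_measurable P"
  shows "char (distr P borel A) t = (\<integral>\<omega>. cis (t * A \<omega>) \<partial>P)"
  using assms by (simp add: char_def integral_distr cis_conv_exp)

lemma (in prob_space) integrable_cis [simp]:
  assumes "A \<in> borel_measurable M"
  shows "integrable M (\<lambda>\<omega>. cis (A \<omega>))"
  using assms by (intro integrable_const_bound[where B=1]) (auto simp: cis_conv_exp)

lemma measurable_cis [measurable]: "cis \<in> borel_measurable borel"
  by (intro borel_measurable_continuous_onI) (auto simp: cis_conv_exp intro!: continuous_intros)

lemma distr_eqI_cis:
  assumes "prob_space P" "prob_space P'"
    and "A \<in> borel_measurable P" "A' \<in> borel_measurable P'"
    and "\<And>t. (\<integral>\<omega>. cis (t * A \<omega>) \<partial>P) = (\<integral>\<omega>. cis (t * A' \<omega>) \<partial>P')"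
  shows "distr P borel A = distr P' borel A'"
proof (rule Levy_uniqueness)
  show "real_distribution (distr P borel A)" "real_distribution (distr P' borel A')"
    using assms by (auto intro: prob_space.real_distribution_distr)
  show "char (distr P borel A) = char (distr P' borel A')"
    using assms by (intro ext) (simp add: char_distr_eq_cis)
qed

lemma integral_eq_of_distr_eq:
  fixes h :: "real \<Rightarrow> 'b::{banach, second_countable_topology}"
  assumes "distr P borel A = distr P' borel A'"
    and [measurable]: "A \<in> borel_measurable P" "A' \<in> borel_measurable P'" "h \<in> borel_measurable borel"
  shows "(\<integral>\<omega>. h (A \<omega>) \<partial>P) = (\<integral>\<omega>. h (A' \<omega>) \<partial>P')"
  using arg_cong[OF assms(1), of "\<lambda>D. \<integral>x. h x \<partial>D"] by (simp add: integral_distr)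

lemma integrable_eq_of_distr_eq:
  fixes h :: "real \<Rightarrow> 'b::{banach, second_countable_topology}"
  assumes "distr P borel A = distr P' borel A'"
    and [measurable]: "A \<in> borel_measurable P" "A' \<in> borel_measurable P'" "h \<in> borel_measurable borel"
  shows "integrable P (\<lambda>\<omega>. h (A \<omega>)) \<longleftrightarrow> integrable P' (\<lambda>\<omega>. h (A' \<omega>))"
  using arg_cong[OF assms(1), of "\<lambda>D. integrable D h"] by (simp add: integrable_distr_eq)

lemma nn_integral_eq_of_distr_eq:
  assumes "distr P borel A = distr P' borel A'"
    and [measurable]: "A \<in> borel_measurable P" "A' \<in> borel_measurable P'" "h \<in> borel_measurable borel"
  shows "(\<integral>\<^sup>+\<omega>. h (A \<omega>) \<partial>P) = (\<integral>\<^sup>+\<omega>. h (A' \<omega>) \<partial>P')"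
  using arg_cong[OF assms(1), of "\<lambda>D. \<integral>\<^sup>+x. h x \<partial>D"] by (simp add: nn_integral_distr)

text \<open>
  A signed weight \<open>w\<close> bounded by \<open>1\<close> becomes a probability density after adding \<open>2\<close> and
  normalising; with \<open>1\<close> in place of \<open>2\<close> the total mass could vanish.
\<close>
lemma reweighted_measure:
  assumes P: "prob_space P" and [measurable]: "A \<in> borel_measurable P" "w \<in> borel_measurable P"
    and w: "\<And>\<omega>. \<bar>w \<omega>\<bar> \<le> (1::real)"
  defines "m \<equiv> 2 + (\<integral>\<omega>. w \<omega> \<partial>P)"
  obtains Q where "prob_space Q" "A \<in> borel_measurable Q" "0 < m"
    and "\<And>f :: real \<Rightarrow> complex. f \<in> borel_measurable borel \<Longrightarrow> integrable P (\<lambda>\<omega>. f (A \<omega>)) \<Longrightarrow>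
      (\<integral>\<omega>. f (A \<omega>) \<partial>Q) = (2 *\<^sub>R (\<integral>\<omega>. f (A \<omega>) \<partial>P) + (\<integral>\<omega>. w \<omega> *\<^sub>R f (A \<omega>) \<partial>P)) /\<^sub>R m"
proof -
  interpret P: prob_space P by fact
  have [simp]: "integrable P w"
    using w by (auto intro!: P.integrable_const_bound[where B=1])
  have int: "integrable P (\<lambda>\<omega>. w \<omega> *\<^sub>R f \<omega>)" if "integrable P f" for f :: "_ \<Rightarrow> complex"
    using that w by (intro Bochner_Integration.integrable_bound[OF that]) (auto simp: mult_left_le_one_le)
  have ge: "1 \<le> 2 + w \<omega>" for \<omega> using w[of \<omega>] by (simp add: abs_le_iff)
  have m: "0 < m"
  proof -
    have "(\<integral>\<omega>. 1 \<partial>P) \<le> (\<integral>\<omega>. 2 + w \<omega> \<partial>P)" using ge by (intro integral_mono) auto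
    then show ?thesis by (simp add: m_def P.prob_space)
  qed
  define Q where "Q = density P (\<lambda>\<omega>. ennreal ((2 + w \<omega>) / m))"
  have pos: "0 \<le> (2 + w \<omega>) / m" for \<omega> using ge[of \<omega>] m by simp
  show thesis
  proof (rule that[of Q])
    show "prob_space Q" unfolding Q_def
    proof (rule prob_spaceI)
      have "(\<integral>\<^sup>+\<omega>. ennreal ((2 + w \<omega>) / m) \<partial>P) = ennreal (\<integral>\<omega>. (2 + w \<omega>) / m \<partial>P)"
        using pos by (intro nn_integral_eq_integral) auto
      also have "\<dots> = 1" using m by (simp add: m_def P.prob_space)
      finally show "emeasure (density P (\<lambda>\<omega>. ennreal ((2 + w \<omega>) / m))) (space (density P (\<lambda>\<omega>. ennreal ((2 + w \<omega>) / m)))) = 1"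
        by (simp add: emeasure_density nn_integral_set_ennreal cong: nn_integral_cong)
    qed
    show "A \<in> borel_measurable Q" "0 < m" using m by (auto simp: Q_def)
    fix f :: "real \<Rightarrow> complex"
    assume f: "f \<in> borel_measurable borel" "integrable P (\<lambda>\<omega>. f (A \<omega>))"
    have "(\<integral>\<omega>. f (A \<omega>) \<partial>Q) = (\<integral>\<omega>. (2 *\<^sub>R f (A \<omega>) + w \<omega> *\<^sub>R f (A \<omega>)) /\<^sub>R m \<partial>P)"
      unfolding Q_def using pos f
      by (subst integral_density) (auto intro!: Bochner_Integration.integral_cong simp: scaleR_add_left[symmetric] divide_inverse mult.commute simp del: scaleR_add_left)
    also have "\<dots> = (2 *\<^sub>R (\<integral>\<omega>. f (A \<omega>) \<partial>P) + (\<integral>\<omega>. w \<omega> *\<^sub>R f (A \<omega>) \<partial>P)) /\<^sub>R m"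
      using f int[OF f(2)] by (simp del: scaleR_add_right)
    finally show "(\<integral>\<omega>. f (A \<omega>) \<partial>Q) = (2 *\<^sub>R (\<integral>\<omega>. f (A \<omega>) \<partial>P) + (\<integral>\<omega>. w \<omega> *\<^sub>R f (A \<omega>) \<partial>P)) /\<^sub>R m" .
  qed
qed

text \<open>
  The characteristic functions of \<open>A\<close> with and without the weight determine the characteristic function
  of \<open>A\<close> under the density proportional to \<open>2 + w\<close>, so the uniqueness theorem for probability measures
  applies to it.  The contribution of the constant \<open>2\<close> is then subtracted.
\<close>
lemma weighted_integral_eqI_real:
  fixes h :: "real \<Rightarrow> complex"
  assumes P: "prob_space P" and P': "prob_space P'"
    and [measurable]: "A \<in> borel_measurable P" "A' \<in> borel_measurable P'"
      "w \<in> borel_measurable P" "w' \<in> borel_measurable P'" "h \<in> borel_measurable borel"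
    and w: "\<And>\<omega>. \<bar>w \<omega>\<bar> \<le> (1::real)" and w': "\<And>\<omega>. \<bar>w' \<omega>\<bar> \<le> (1::real)"
    and eq: "\<And>t. (\<integral>\<omega>. cis (t * A \<omega>) \<partial>P) = (\<integral>\<omega>. cis (t * A' \<omega>) \<partial>P')"
    and eqw: "\<And>t. (\<integral>\<omega>. w \<omega> *\<^sub>R cis (t * A \<omega>) \<partial>P) = (\<integral>\<omega>. w' \<omega> *\<^sub>R cis (t * A' \<omega>) \<partial>P')"
    and h: "integrable P (\<lambda>\<omega>. h (A \<omega>))"
  shows "(\<integral>\<omega>. w \<omega> *\<^sub>R h (A \<omega>) \<partial>P) = (\<integral>\<omega>. w' \<omega> *\<^sub>R h (A' \<omega>) \<partial>P')"
proof -
  interpret P: prob_space P by fact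
  interpret P': prob_space P' by fact
  have d: "distr P borel A = distr P' borel A'" using assms by (intro distr_eqI_cis) auto
  have h': "integrable P' (\<lambda>\<omega>. h (A' \<omega>))"
    using h integrable_eq_of_distr_eq[OF d, of h] by simp
  have wm: "(\<integral>\<omega>. w' \<omega> \<partial>P') = (\<integral>\<omega>. w \<omega> \<partial>P)"
    using eqw[of 0] by (simp add: scaleR_conv_of_real)
  obtain Q where Q: "prob_space Q" "A \<in> borel_measurable Q" "0 < 2 + (\<integral>\<omega>. w \<omega> \<partial>P)"
    and dens: "\<And>f :: real \<Rightarrow> complex. f \<in> borel_measurable borel \<Longrightarrow> integrable P (\<lambda>\<omega>. f (A \<omega>)) \<Longrightarrow>
      (\<integral>\<omega>. f (A \<omega>) \<partial>Q) = (2 *\<^sub>R (\<integral>\<omega>. f (A \<omega>) \<partial>P) + (\<integral>\<omega>. w \<omega> *\<^sub>R f (A \<omega>) \<partial>P)) /\<^sub>R (2 + (\<integral>\<omega>. w \<omega> \<partial>P))"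
    by (rule reweighted_measure[OF P, of A w]) (use w in auto)
  obtain Q' where Q': "prob_space Q'" "A' \<in> borel_measurable Q'"
    and dens': "\<And>f :: real \<Rightarrow> complex. f \<in> borel_measurable borel \<Longrightarrow> integrable P' (\<lambda>\<omega>. f (A' \<omega>)) \<Longrightarrow>
      (\<integral>\<omega>. f (A' \<omega>) \<partial>Q') = (2 *\<^sub>R (\<integral>\<omega>. f (A' \<omega>) \<partial>P') + (\<integral>\<omega>. w' \<omega> *\<^sub>R f (A' \<omega>) \<partial>P')) /\<^sub>R (2 + (\<integral>\<omega>. w \<omega> \<partial>P))"
    unfolding wm[symmetric] by (rule reweighted_measure[OF P', of A' w']) (use w' in auto)
  have "distr Q borel A = distr Q' borel A'"
  proof (rule distr_eqI_cis[OF Q(1) Q'(1) Q(2) Q'(2)])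
    fix t show "(\<integral>\<omega>. cis (t * A \<omega>) \<partial>Q) = (\<integral>\<omega>. cis (t * A' \<omega>) \<partial>Q')"
      by (subst dens[of "\<lambda>x. cis (t * x)"], simp, simp, subst dens'[of "\<lambda>x. cis (t * x)"]) (simp_all add: eq eqw)
  qed
  from integral_eq_of_distr_eq[OF this Q(2) Q'(2), of h]
  have "(\<integral>\<omega>. h (A \<omega>) \<partial>Q) = (\<integral>\<omega>. h (A' \<omega>) \<partial>Q')" by simp
  then show ?thesis
    using dens[OF _ h] dens'[OF _ h'] integral_eq_of_distr_eq[OF d, of h] Q(3) by simp
qed

lemma integral_cnj_mult_cis:
  "(\<integral>\<omega>. cnj (V \<omega>) * cis (t * B \<omega>) \<partial>Q) = cnj (\<integral>\<omega>. V \<omega> * cis (- t * B \<omega>) \<partial>Q)"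
proof -
  have "cnj (\<integral>\<omega>. V \<omega> * cis (- t * B \<omega>) \<partial>Q) = (\<integral>\<omega>. cnj (V \<omega> * cis (- t * B \<omega>)) \<partial>Q)"
    by (rule Bochner_Integration.integral_cnj[symmetric])
  then show ?thesis by (simp add: cis_cnj)
qed

text \<open>
  This substitutes for a uniqueness theorem for characteristic functions of several variables:
  with \<open>W = cis B\<close> it turns knowledge of the joint characteristic function of \<open>A\<close> and \<open>B\<close> into knowledge
  of \<open>E (h A * cis B)\<close> for every \<open>h\<close> with \<open>h A\<close> integrable, one variable at a time.
\<close>
lemma weighted_integral_eqI:
  fixes h :: "real \<Rightarrow> complex"
  assumes P: "prob_space P" and P': "prob_space P'"
    and [measurable]: "A \<in> borel_measurable P" "A' \<in> borel_measurable P'"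
      "W \<in> borel_measurable P" "W' \<in> borel_measurable P'" "h \<in> borel_measurable borel"
    and W: "\<And>\<omega>. norm (W \<omega> :: complex) \<le> 1" and W': "\<And>\<omega>. norm (W' \<omega> :: complex) \<le> 1"
    and eq: "\<And>t. (\<integral>\<omega>. cis (t * A \<omega>) \<partial>P) = (\<integral>\<omega>. cis (t * A' \<omega>) \<partial>P')"
    and eqW: "\<And>t. (\<integral>\<omega>. W \<omega> * cis (t * A \<omega>) \<partial>P) = (\<integral>\<omega>. W' \<omega> * cis (t * A' \<omega>) \<partial>P')"
    and h: "integrable P (\<lambda>\<omega>. h (A \<omega>))"
  shows "(\<integral>\<omega>. W \<omega> * h (A \<omega>) \<partial>P) = (\<integral>\<omega>. W' \<omega> * h (A' \<omega>) \<partial>P')"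
proof -
  interpret P: prob_space P by fact
  interpret P': prob_space P' by fact
  have d: "distr P borel A = distr P' borel A'" using assms by (intro distr_eqI_cis) auto
  have h': "integrable P' (\<lambda>\<omega>. h (A' \<omega>))"
    using h integrable_eq_of_distr_eq[OF d, of h] by simp
  have int: "integrable P (\<lambda>\<omega>. w \<omega> * f \<omega>)" if "integrable P f" "w \<in> borel_measurable P" "\<And>\<omega>. norm (w \<omega>) \<le> 1" for f w :: "_ \<Rightarrow> complex"
    using that by (intro Bochner_Integration.integrable_bound[OF that(1)]) (auto simp: norm_mult mult_left_le_one_le)
  have int': "integrable P' (\<lambda>\<omega>. w \<omega> * f \<omega>)" if "integrable P' f" "w \<in> borel_measurable P'" "\<And>\<omega>. norm (w \<omega>) \<le> 1" for f w :: "_ \<Rightarrow> complex"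
    using that by (intro Bochner_Integration.integrable_bound[OF that(1)]) (auto simp: norm_mult mult_left_le_one_le)
  have cnj: "(\<integral>\<omega>. cnj (W \<omega>) * cis (t * A \<omega>) \<partial>P) = (\<integral>\<omega>. cnj (W' \<omega>) * cis (t * A' \<omega>) \<partial>P')" for t
  unfolding integral_cnj_mult_cis eqW ..
  have R: "Re z *\<^sub>R x = (1 / 2) * (z * x + cnj z * x)"
    "Im z *\<^sub>R x = (- \<i> / 2) * (z * x - cnj z * x)" for z x
    by (auto simp: complex_eq_iff field_simps)
  have Wm[measurable]: "(\<lambda>\<omega>. cnj (W \<omega>)) \<in> borel_measurable P" "(\<lambda>\<omega>. cnj (W' \<omega>)) \<in> borel_measurable P'"
    by (auto intro!: borel_measurable_continuous_on[where f=cnj] continuous_intros)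
  have i: "integrable P (\<lambda>\<omega>. W \<omega> * cis (t * A \<omega>))" "integrable P (\<lambda>\<omega>. cnj (W \<omega>) * cis (t * A \<omega>))"
    "integrable P' (\<lambda>\<omega>. W' \<omega> * cis (t * A' \<omega>))" "integrable P' (\<lambda>\<omega>. cnj (W' \<omega>) * cis (t * A' \<omega>))" for t
    using W W' by (auto intro!: int int')
  have re: "(\<integral>\<omega>. Re (W \<omega>) *\<^sub>R h (A \<omega>) \<partial>P) = (\<integral>\<omega>. Re (W' \<omega>) *\<^sub>R h (A' \<omega>) \<partial>P')"
  proof (rule weighted_integral_eqI_real[OF P P' _ _ _ _ _ _ _ eq _ h])
    show "(\<integral>\<omega>. Re (W \<omega>) *\<^sub>R cis (t * A \<omega>) \<partial>P) = (\<integral>\<omega>. Re (W' \<omega>) *\<^sub>R cis (t * A' \<omega>) \<partial>P')" for t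
      unfolding R integral_mult_right_zero by (simp only: Bochner_Integration.integral_add[OF i(1,2)] Bochner_Integration.integral_add[OF i(3,4)] eqW cnj)
  qed (use W W' abs_Re_le_cmod order_trans in \<open>auto, blast+\<close>)
  have im: "(\<integral>\<omega>. Im (W \<omega>) *\<^sub>R h (A \<omega>) \<partial>P) = (\<integral>\<omega>. Im (W' \<omega>) *\<^sub>R h (A' \<omega>) \<partial>P')"
  proof (rule weighted_integral_eqI_real[OF P P' _ _ _ _ _ _ _ eq _ h])
    show "(\<integral>\<omega>. Im (W \<omega>) *\<^sub>R cis (t * A \<omega>) \<partial>P) = (\<integral>\<omega>. Im (W' \<omega>) *\<^sub>R cis (t * A' \<omega>) \<partial>P')" for t
      unfolding R integral_mult_right_zero by (simp only: Bochner_Integration.integral_diff[OF i(1,2)] Bochner_Integration.integral_diff[OF i(3,4)] eqW cnj)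
  qed (use W W' abs_Im_le_cmod order_trans in \<open>auto, blast+\<close>)
  have split: "z * x = Re z *\<^sub>R x + \<i> * (Im z *\<^sub>R x)" for z x :: complex
    by (simp add: complex_eq_iff)
  have ih: "integrable P (\<lambda>\<omega>. complex_of_real (Re (W \<omega>)) * h (A \<omega>))" "integrable P (\<lambda>\<omega>. complex_of_real (Im (W \<omega>)) * h (A \<omega>))"
     "integrable P' (\<lambda>\<omega>. complex_of_real (Re (W' \<omega>)) * h (A' \<omega>))" "integrable P' (\<lambda>\<omega>. complex_of_real (Im (W' \<omega>)) * h (A' \<omega>))"
    using W W' abs_Re_le_cmod abs_Im_le_cmod order_trans by (auto intro!: int int' h h') blast+
  show ?thesis
    unfolding split[of "W _"] split[of "W' _"] using re im ih by (simp add: scaleR_conv_of_real)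
qed

section \<open>Gaussian systems and exponential tilting\<close>

text \<open>
  Gaussian processes are described by characteristic functions rather than by densities
  because degenerate combinations then need no separate treatment and because repeated indices
  are allowed among the \<open>s i\<close>.
\<close>
definition gaussian_system ::
    "'w measure \<Rightarrow> 's set \<Rightarrow> ('s \<Rightarrow> 's \<Rightarrow> real) \<Rightarrow> ('s \<Rightarrow> 'w \<Rightarrow> real) \<Rightarrow> bool" where
  "gaussian_system P S C X \<longleftrightarrow>
     prob_space P \<and> (\<forall>s\<in>S. X s \<in> borel_measurable P) \<and> (\<forall>s\<in>S. \<forall>t\<in>S. C s t = C t s) \<and>
     (\<forall>(n::nat) a s. (\<forall>i<n. s i \<in> S) \<longrightarrow>
        (\<integral>\<omega>. cis (\<Sum>i<n. a i * X (s i) \<omega>) \<partial>P) =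
          complex_of_real (exp (- (\<Sum>i<n. \<Sum>j<n. a i * a j * C (s i) (s j)) / 2)))"

abbreviation "normal01 \<equiv> std_normal_distribution"

lemma prob_space_normal01: "prob_space normal01"
  by (rule prob_space_normal_density) simp

lemma integral_cis_normal01: "(\<integral>x. cis (t * x) \<partial>normal01) = exp (- t\<^sup>2 / 2)"
proof -
  have "char normal01 t = (\<integral>x. cis (t * x) \<partial>normal01)"
    unfolding char_def by (simp add: cis_conv_exp)
  then show ?thesis by (simp add: char_std_normal_distribution)
qed

lemma std_normal_density_shift:
  "exp (t * x) * std_normal_density x = exp (t\<^sup>2 / 2) * std_normal_density (x - t)"
  by (simp add: std_normal_density_def exp_add[symmetric] power2_eq_square field_simps flip: exp_add)

lemma nn_integral_exp_normal01: "(\<integral>\<^sup>+x. ennreal (exp (t * x)) \<partial>normal01) = ennreal (exp (t\<^sup>2 / 2))"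
proof -
  have "(\<integral>\<^sup>+x. ennreal (exp (t * x)) \<partial>normal01)
      = (\<integral>\<^sup>+x. ennreal (std_normal_density x) * ennreal (exp (t * x)) \<partial>lborel)"
    by (subst nn_integral_density) auto
  also have "\<dots> = (\<integral>\<^sup>+x. ennreal (exp (t\<^sup>2 / 2)) * ennreal (normal_density t 1 x) \<partial>lborel)"
    using std_normal_density_shift[of t]
    by (intro nn_integral_cong) (simp add: ennreal_mult[symmetric] mult.commute normal_density_def)
  also have "\<dots> = ennreal (exp (t\<^sup>2 / 2)) * ennreal (\<integral>x. normal_density t 1 x \<partial>lborel)"
    by (subst nn_integral_cmult) (auto simp: nn_integral_eq_integral)
  finally show ?thesis by simp
qed

lemma integral_exp_cis_normal01:
  "(\<integral>x. complex_of_real (exp (t * x)) * cis (u * x) \<partial>normal01) = of_real (exp ((t\<^sup>2 - u\<^sup>2) / 2)) * cis (t * u)"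
proof -
  have "(\<integral>x. complex_of_real (exp (t * x)) * cis (u * x) \<partial>normal01)
      = (\<integral>x. std_normal_density x *\<^sub>R (complex_of_real (exp (t * x)) * cis (u * x)) \<partial>lborel)"
    by (subst integral_density) auto
  also have "\<dots> = (\<integral>x. complex_of_real (exp (t\<^sup>2 / 2)) * (std_normal_density (x - t) *\<^sub>R cis (u * x)) \<partial>lborel)"
  proof (intro Bochner_Integration.integral_cong refl)
    fix x
    have "std_normal_density x *\<^sub>R (complex_of_real (exp (t * x)) * cis (u * x))
       = of_real (exp (t * x) * std_normal_density x) * cis (u * x)" by (simp add: scaleR_conv_of_real)
    then show "std_normal_density x *\<^sub>R (complex_of_real (exp (t * x)) * cis (u * x)) =
         complex_of_real (exp (t\<^sup>2 / 2)) * (std_normal_density (x - t) *\<^sub>R cis (u * x))"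
      unfolding std_normal_density_shift by (simp add: scaleR_conv_of_real)
  qed
  also have "\<dots> = of_real (exp (t\<^sup>2 / 2)) * (\<integral>x. std_normal_density (x - t) *\<^sub>R cis (u * x) \<partial>lborel)"
    by (rule integral_mult_right_zero)
  also have "(\<integral>x. std_normal_density (x - t) *\<^sub>R cis (u * x) \<partial>lborel)
      = (\<integral>x. cis (t * u) * (std_normal_density x *\<^sub>R cis (u * x)) \<partial>lborel)"
  proof -
    have "std_normal_density (t + 1 * x - t) *\<^sub>R cis (u * (t + 1 * x)) = cis (t * u) * (std_normal_density x *\<^sub>R cis (u * x))" for x
      by (simp add: algebra_simps cis_mult)
    then have "(\<integral>x. std_normal_density (t + 1 * x - t) *\<^sub>R cis (u * (t + 1 * x)) \<partial>lborel) = (\<integral>x. cis (t * u) * (std_normal_density x *\<^sub>R cis (u * x)) \<partial>lborel)"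
      by (rule Bochner_Integration.integral_cong[OF refl])
    moreover have "(\<integral>x. std_normal_density (x - t) *\<^sub>R cis (u * x) \<partial>lborel)
        = \<bar>1\<bar> *\<^sub>R (\<integral>x. std_normal_density (t + 1 * x - t) *\<^sub>R cis (u * (t + 1 * x)) \<partial>lborel)"
      by (rule lborel_integral_real_affine) simp
    ultimately show ?thesis by (simp only: abs_one scaleR_one)
  qed
  also have "\<dots> = cis (t * u) * (\<integral>x. cis (u * x) \<partial>normal01)"
  proof -
    have "(\<integral>x. cis (u * x) \<partial>normal01) = (\<integral>x. std_normal_density x *\<^sub>R cis (u * x) \<partial>lborel)"
      by (subst integral_density) auto
    then show ?thesis by (simp only: integral_mult_right_zero)
  qed
  finally have c: "(\<integral>x. complex_of_real (exp (t * x)) * cis (u * x) \<partial>normal01)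
      = complex_of_real (exp (t\<^sup>2 / 2)) * (cis (t * u) * (\<integral>x. cis (u * x) \<partial>normal01))" .
  have e: "exp ((t\<^sup>2 - u\<^sup>2) / 2) = exp (t\<^sup>2 / 2) * exp (- u\<^sup>2 / 2)"
    unfolding exp_add[symmetric] by (simp add: field_simps)
  show ?thesis
    unfolding c integral_cis_normal01 e of_real_mult by (simp only: ac_simps)
qed

text \<open>
  \<open>B - \<kappa> A\<close> is uncorrelated with \<open>A\<close> for \<open>\<kappa> = k / v\<close>, so that \<open>cis (B - \<kappa> A)\<close> can be averaged out against any
  function of \<open>A\<close>; what remains is a one-dimensional Gaussian integral.  The result is the
  analytic continuation of \<open>cf\<close> to \<open>t = - \<i>\<close>.
\<close>
lemma gaussian_pair_exp_cis:
  fixes A B :: "'w \<Rightarrow> real"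
  assumes P: "prob_space P" and [measurable]: "A \<in> borel_measurable P" "B \<in> borel_measurable P"
    and cf: "\<And>t u. (\<integral>\<omega>. cis (t * A \<omega> + u * B \<omega>) \<partial>P) = complex_of_real (exp (- (t\<^sup>2 * v + 2 * t * u * k + u\<^sup>2 * w) / 2))"
  shows "(\<integral>\<omega>. complex_of_real (exp (A \<omega>)) * cis (B \<omega>) \<partial>P) = of_real (exp ((v - w) / 2)) * cis k"
    and "(\<integral>\<^sup>+\<omega>. ennreal (exp (A \<omega>)) \<partial>P) = ennreal (exp (v / 2))"
proof -
  interpret P: prob_space P by fact
  have le: "0 \<le> t\<^sup>2 * v + 2 * t * u * k + u\<^sup>2 * w" for t u
  proof -
    have "norm (\<integral>\<omega>. cis (t * A \<omega> + u * B \<omega>) \<partial>P) \<le> (\<integral>\<omega>. norm (cis (t * A \<omega> + u * B \<omega>)) \<partial>P)"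
      by (rule integral_norm_bound)
    also have "\<dots> = 1" by (simp add: P.prob_space)
    finally have "exp (- (t\<^sup>2 * v + 2 * t * u * k + u\<^sup>2 * w) / 2) \<le> 1"
      unfolding cf by (simp only: norm_of_real abs_exp_cancel)
    then show ?thesis by simp
  qed
  have v: "0 \<le> v" using le[of 1 0] by simp
  \<comment> \<open>For \<open>v = 0\<close> the quadratic form would be unbounded below in \<open>t\<close> unless \<open>k = 0\<close>; then \<open>k / v = 0\<close> is the right choice.\<close>
  have k0: "k = 0" if "v = 0"
  proof (rule ccontr)
    assume k: "k \<noteq> 0"
    have "0 \<le> 2 * (- (w + 1) / (2 * k)) * k + w" using le[of "- (w + 1) / (2 * k)" 1] that by simp
    also have "\<dots> = -1" using k by (simp add: field_simps)
    finally show False by simp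
  qed
  define \<kappa> where "\<kappa> = k / v"
  have \<kappa>: "\<kappa> * v = k" using k0 by (cases "v = 0") (auto simp: \<kappa>_def)
  define w' where "w' = w - \<kappa> * k"
  define B' where "B' = (\<lambda>\<omega>. B \<omega> - \<kappa> * A \<omega>)"
  have [measurable]: "B' \<in> borel_measurable P" unfolding B'_def by measurable
  have cf': "(\<integral>\<omega>. cis (B' \<omega>) * cis (t * A \<omega>) \<partial>P) = complex_of_real (exp (- w' / 2)) * complex_of_real (exp (- (t\<^sup>2 * v) / 2))" for t
  proof -
    have "(\<integral>\<omega>. cis (B' \<omega>) * cis (t * A \<omega>) \<partial>P) = (\<integral>\<omega>. cis ((t - \<kappa>) * A \<omega> + 1 * B \<omega>) \<partial>P)"
      by (simp add: B'_def cis_mult algebra_simps)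
    also have "\<dots> = complex_of_real (exp (- ((t - \<kappa>)\<^sup>2 * v + 2 * (t - \<kappa>) * k + w) / 2))"
      by (subst cf) simp
    also have "(t - \<kappa>)\<^sup>2 * v + 2 * (t - \<kappa>) * k + w = t\<^sup>2 * v + w'"
    proof -
      have "(t - \<kappa>)\<^sup>2 * v = t\<^sup>2 * v - 2 * t * (\<kappa> * v) + \<kappa> * (\<kappa> * v)"
        by (simp add: power2_eq_square algebra_simps)
      then show ?thesis unfolding \<kappa> w'_def by (simp add: algebra_simps)
    qed
    also have "exp (- (t\<^sup>2 * v + w') / 2) = exp (- w' / 2) * exp (- (t\<^sup>2 * v) / 2)"
      unfolding exp_add[symmetric] by (simp add: field_simps)
    finally show ?thesis by (simp only: of_real_mult)
  qed
  have cfA: "(\<integral>\<omega>. cis (t * A \<omega>) \<partial>P) = complex_of_real (exp (- (t\<^sup>2 * v) / 2))" for t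
    using cf[of t 0] by simp
  have law: "distr P borel A = distr normal01 borel (\<lambda>x. sqrt v * x)"
    using v by (intro distr_eqI_cis P prob_space_normal01)
      (auto simp: cfA integral_cis_normal01[of "_ * sqrt v"] power_mult_distrib mult.assoc[symmetric])
  show "(\<integral>\<^sup>+\<omega>. ennreal (exp (A \<omega>)) \<partial>P) = ennreal (exp (v / 2))"
    using nn_integral_eq_of_distr_eq[OF law, of "\<lambda>x. ennreal (exp x)"] v
    by (simp add: nn_integral_exp_normal01)
  then have ie: "integrable P (\<lambda>\<omega>. exp (A \<omega>))"
    by (intro integrableI_nonneg) auto
  define h where "h = (\<lambda>x. complex_of_real (exp x) * cis (\<kappa> * x))"
  have [measurable]: "h \<in> borel_measurable borel" unfolding h_def by measurable
  have ih: "integrable P (\<lambda>\<omega>. h (A \<omega>))"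
    by (rule Bochner_Integration.integrable_bound[OF ie]) (auto simp: h_def norm_mult)
  have w'0: "0 \<le> w'" using le[of "-\<kappa>" 1] by (simp add: w'_def power2_eq_square mult.assoc \<kappa>)
  have "(\<integral>\<omega>. complex_of_real (exp (A \<omega>)) * cis (B \<omega>) \<partial>P) = (\<integral>\<omega>. cis (B' \<omega>) * h (A \<omega>) \<partial>P)"
    by (simp add: B'_def h_def cis_mult mult.left_commute)
  also have "\<dots> = (\<integral>\<omega>. complex_of_real (exp (- w' / 2)) * h (A \<omega>) \<partial>P)"
    by (rule weighted_integral_eqI[OF P P]) (auto intro: ih simp: w'0 cf' cfA)
  also have "\<dots> = complex_of_real (exp (- w' / 2)) * (\<integral>\<omega>. h (A \<omega>) \<partial>P)" by simp
  also have "(\<integral>\<omega>. h (A \<omega>) \<partial>P) = (\<integral>x. h (sqrt v * x) \<partial>normal01)"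
    by (rule integral_eq_of_distr_eq[OF law]) auto
  also have "\<dots> = of_real (exp (((sqrt v)\<^sup>2 - (\<kappa> * sqrt v)\<^sup>2) / 2)) * cis (sqrt v * (\<kappa> * sqrt v))"
    unfolding h_def integral_exp_cis_normal01[symmetric] by (simp add: mult.assoc)
  also have k1: "sqrt v * (\<kappa> * sqrt v) = k" 
  proof -
    have "sqrt v * (\<kappa> * sqrt v) = \<kappa> * (sqrt v * sqrt v)" by (simp only: ac_simps)
    then show ?thesis using v \<kappa> by simp
  qed
  also have "(sqrt v)\<^sup>2 - (\<kappa> * sqrt v)\<^sup>2 = v - \<kappa> * k"
  proof -
    have "\<kappa>\<^sup>2 * v = \<kappa> * k" using \<kappa> by (simp add: power2_eq_square mult.assoc)
    then show ?thesis using v by (simp add: power_mult_distrib)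
  qed
  finally show "(\<integral>\<omega>. complex_of_real (exp (A \<omega>)) * cis (B \<omega>) \<partial>P) = of_real (exp ((v - w) / 2)) * cis k"
    unfolding mult.assoc[symmetric] of_real_mult[symmetric] exp_add[symmetric]
    by (simp add: w'_def field_simps)
qed

lemma gaussian_systemD:
  assumes "gaussian_system P S C X"
  shows gaussian_system_prob_space: "prob_space P"
    and gaussian_system_measurable: "s \<in> S \<Longrightarrow> X s \<in> borel_measurable P"
    and gaussian_system_sym: "s \<in> S \<Longrightarrow> t \<in> S \<Longrightarrow> C s t = C t s"
    and gaussian_system_cis: "(\<And>i. i < (n::nat) \<Longrightarrow> f i \<in> S) \<Longrightarrow>
        (\<integral>\<omega>. cis (\<Sum>i<n. a i * X (f i) \<omega>) \<partial>P) =
          complex_of_real (exp (- (\<Sum>i<n. \<Sum>j<n. a i * a j * C (f i) (f j)) / 2))"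
  using assms unfolding gaussian_system_def by auto

text \<open>
  The index \<open>s\<close> is added in front of the finite family, and its cross terms occur twice in the
  quadratic form.
\<close>
lemma gaussian_system_cis_extend:
  assumes G: "gaussian_system P S C X" and f: "\<And>i. i < (n::nat) \<Longrightarrow> f i \<in> S" and s: "s \<in> S"
  shows "(\<integral>\<omega>. cis (t * X s \<omega> + u * (\<Sum>i<n. a i * X (f i) \<omega>)) \<partial>P) =
    complex_of_real (exp (- (t\<^sup>2 * C s s + 2 * t * u * (\<Sum>i<n. a i * C s (f i))
       + u\<^sup>2 * (\<Sum>i<n. \<Sum>j<n. a i * a j * C (f i) (f j))) / 2))"
proof -
  define b where "b = (\<lambda>i. case i of 0 \<Rightarrow> t | Suc i \<Rightarrow> u * a i)"
  define g where "g = (\<lambda>i. case i of 0 \<Rightarrow> s | Suc i \<Rightarrow> f i)"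
  have g: "g i \<in> S" if "i < Suc n" for i
    using that f s by (auto simp: g_def split: nat.splits)
  have "(\<integral>\<omega>. cis (\<Sum>i<Suc n. b i * X (g i) \<omega>) \<partial>P) =
      complex_of_real (exp (- (\<Sum>i<Suc n. \<Sum>j<Suc n. b i * b j * C (g i) (g j)) / 2))"
    by (rule gaussian_system_cis[OF G g])
  also have "(\<lambda>\<omega>. \<Sum>i<Suc n. b i * X (g i) \<omega>) = (\<lambda>\<omega>. t * X s \<omega> + u * (\<Sum>i<n. a i * X (f i) \<omega>))"
    unfolding sum.lessThan_Suc_shift by (simp add: b_def g_def sum_distrib_left mult.assoc)
  also have "(\<Sum>i<Suc n. \<Sum>j<Suc n. b i * b j * C (g i) (g j)) =
      t\<^sup>2 * C s s + (\<Sum>j<n. t * (u * a j) * C s (f j)) + (\<Sum>i<n. u * a i * t * C (f i) s)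
       + (\<Sum>i<n. \<Sum>j<n. u * a i * (u * a j) * C (f i) (f j))"
    unfolding sum.lessThan_Suc_shift by (simp add: b_def g_def sum.distrib power2_eq_square)
  also have "(\<Sum>i<n. u * a i * t * C (f i) s) = (\<Sum>i<n. t * u * (a i * C s (f i)))"
    using gaussian_system_sym[OF G s f] by (intro sum.cong) (auto simp: ac_simps)
  also have "(\<Sum>j<n. t * (u * a j) * C s (f j)) = (\<Sum>i<n. t * u * (a i * C s (f i)))"
    by (simp add: ac_simps)
  also have "(\<Sum>i<n. \<Sum>j<n. u * a i * (u * a j) * C (f i) (f j)) = u\<^sup>2 * (\<Sum>i<n. \<Sum>j<n. a i * a j * C (f i) (f j))"
    by (simp add: sum_distrib_left power2_eq_square ac_simps)
  finally show ?thesis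
    by (simp only: sum_distrib_left[symmetric]) (simp add: mult.assoc)
qed

lemma nn_integral_exp_gaussian_system:
  assumes G: "gaussian_system P S C X" and s: "s \<in> S"
  shows "(\<integral>\<^sup>+\<omega>. ennreal (exp (c * X s \<omega>)) \<partial>P) = ennreal (exp (c\<^sup>2 * C s s / 2))"
proof -
  note [measurable] = gaussian_system_measurable[OF G s]
  have "(\<integral>\<omega>. cis (t * (c * X s \<omega>) + u * 0) \<partial>P) = complex_of_real (exp (- (t\<^sup>2 * (c\<^sup>2 * C s s) + 2 * t * u * 0 + u\<^sup>2 * 0) / 2))" for t u
    \<comment> \<open>The extension of the empty family by \<open>s\<close>.\<close>
    using gaussian_system_cis_extend[OF G _ s, of 0 undefined "t * c" 0] by (simp add: power_mult_distrib mult.assoc)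
  from gaussian_pair_exp_cis(2)[OF gaussian_system_prob_space[OF G] _ _ this]
  show ?thesis by simp
qed

text \<open>
  A characteristic function is bounded by \<open>1\<close> in modulus.
\<close>
lemma gaussian_system_psd:
  assumes G: "gaussian_system P S C X" and f: "\<And>i. i < (n::nat) \<Longrightarrow> f i \<in> S"
  shows "0 \<le> (\<Sum>i<n. \<Sum>j<n. a i * a j * C (f i) (f j))"
proof -
  interpret prob_space P by (rule gaussian_system_prob_space[OF G])
  have "norm (\<integral>\<omega>. cis (\<Sum>i<n. a i * X (f i) \<omega>) \<partial>P) \<le> (\<integral>\<omega>. norm (cis (\<Sum>i<n. a i * X (f i) \<omega>)) \<partial>P)"
    by (rule integral_norm_bound)
  also have "\<dots> = 1" by (simp add: prob_space)
  finally have "norm (complex_of_real (exp (- (\<Sum>i<n. \<Sum>j<n. a i * a j * C (f i) (f j)) / 2))) \<le> 1"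
    by (subst (asm) gaussian_system_cis[OF G, of n f]) (use f in auto)
  then show ?thesis by (simp only: norm_of_real abs_exp_cancel) simp
qed

lemma gaussian_system_abs_le:
  assumes G: "gaussian_system P S C X" and v: "\<And>s. s \<in> S \<Longrightarrow> C s s \<le> v" and st: "s \<in> S" "t \<in> S"
  shows "\<bar>C s t\<bar> \<le> v"
proof -
  have *: "0 \<le> C s s + C t t + 2 * e * C s t" if e: "e = 1 \<or> e = -1" for e
    using gaussian_system_psd[OF G, of 2 "\<lambda>i. if i = 0 then s else t" "\<lambda>i. if i = 0 then 1 else e"] st
      gaussian_system_sym[OF G st] e
    by (auto simp: numeral_2_eq_2 lessThan_Suc ac_simps)
  show ?thesis using *[of 1] *[of "-1"] v[OF st(1)] v[OF st(2)] by simp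
qed

text \<open>
  The Cameron-Martin formula: the drift in direction \<open>t\<close> is the covariance of \<open>X t\<close> with the
  exponent of the density.
\<close>
lemma gaussian_system_tilt:
  assumes G: "gaussian_system P S C X" and s: "s \<in> S"
  defines "Q \<equiv> density P (\<lambda>\<omega>. ennreal (exp (X s \<omega> - C s s / 2)))"
  shows "gaussian_system Q S C (\<lambda>t \<omega>. X t \<omega> - C s t)"
proof -
  interpret P: prob_space P by (rule gaussian_system_prob_space[OF G])
  note [measurable] = gaussian_system_measurable[OF G]
  have [measurable]: "X s \<in> borel_measurable P" using s by measurable
  have int: "(\<integral>\<^sup>+\<omega>. ennreal (exp (X s \<omega> - C s s / 2)) \<partial>P) = 1"
  proof -
    have "(\<integral>\<^sup>+\<omega>. ennreal (exp (X s \<omega> - C s s / 2)) \<partial>P) = (\<integral>\<^sup>+\<omega>. ennreal (exp (- C s s / 2)) * ennreal (exp (1 * X s \<omega>)) \<partial>P)"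
      by (intro nn_integral_cong) (simp add: ennreal_mult[symmetric] exp_add[symmetric])
    also have "\<dots> = ennreal (exp (- C s s / 2)) * ennreal (exp (C s s / 2))"
      by (subst nn_integral_cmult) (auto simp: nn_integral_exp_gaussian_system[OF G s, of 1, simplified])
    finally show ?thesis by (simp add: ennreal_mult[symmetric] exp_add[symmetric])
  qed
  have "prob_space Q" unfolding Q_def
    by (rule prob_spaceI) (simp add: emeasure_density int cong: nn_integral_cong)
  moreover have "(\<integral>\<omega>. cis (\<Sum>i<n. a i * (X (f i) \<omega> - C s (f i))) \<partial>Q) =
       complex_of_real (exp (- (\<Sum>i<n. \<Sum>j<n. a i * a j * C (f i) (f j)) / 2))"
    if f: "\<forall>i<n. f i \<in> S" for n :: nat and f a
  proof -
    define B where "B = (\<lambda>\<omega>. \<Sum>i<n. a i * X (f i) \<omega>)"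
    define k where "k = (\<Sum>i<n. a i * C s (f i))"
    define w where "w = (\<Sum>i<n. \<Sum>j<n. a i * a j * C (f i) (f j))"
    have [measurable]: "B \<in> borel_measurable P" unfolding B_def using f by (intro borel_measurable_sum) auto
    have cf: "(\<integral>\<omega>. cis (t * X s \<omega> + u * B \<omega>) \<partial>P) = complex_of_real (exp (- (t\<^sup>2 * C s s + 2 * t * u * k + u\<^sup>2 * w) / 2))" for t u
      unfolding B_def k_def w_def by (rule gaussian_system_cis_extend[OF G]) (use f s in auto)
    have "(\<integral>\<omega>. cis (\<Sum>i<n. a i * (X (f i) \<omega> - C s (f i))) \<partial>Q) = (\<integral>\<omega>. cis (B \<omega> - k) \<partial>Q)"
      by (simp add: B_def k_def right_diff_distrib sum_subtractf)
    also have "\<dots> = (\<integral>\<omega>. exp (X s \<omega> - C s s / 2) *\<^sub>R cis (B \<omega> - k) \<partial>P)"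
      unfolding Q_def by (subst integral_density) auto
    also have "\<dots> = (\<integral>\<omega>. (of_real (exp (- C s s / 2)) * cis (- k)) * (complex_of_real (exp (X s \<omega>)) * cis (B \<omega>)) \<partial>P)"
    proof (intro Bochner_Integration.integral_cong refl)
      fix \<omega>
      have "cis (B \<omega> - k) = cis (-k) * cis (B \<omega>)" by (simp add: cis_mult)
      moreover have "exp (X s \<omega> - C s s / 2) = exp (- C s s / 2) * exp (X s \<omega>)" by (simp add: exp_add[symmetric])
      ultimately show "exp (X s \<omega> - C s s / 2) *\<^sub>R cis (B \<omega> - k) = (of_real (exp (- C s s / 2)) * cis (- k)) * (complex_of_real (exp (X s \<omega>)) * cis (B \<omega>))"
        by (simp only: scaleR_conv_of_real of_real_mult ac_simps)
    qed
    also have "\<dots> = (of_real (exp (- C s s / 2)) * cis (- k)) * (of_real (exp ((C s s - w) / 2)) * cis k)"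
      unfolding integral_mult_right_zero
      by (subst gaussian_pair_exp_cis(1)[OF P.prob_space_axioms _ _ cf]) auto
    also have "\<dots> = of_real (exp (- C s s / 2) * exp ((C s s - w) / 2)) * (cis (-k) * cis k)"
      by (simp only: of_real_mult ac_simps)
    also have "\<dots> = of_real (exp (- w / 2))"
      by (simp add: cis_mult exp_add[symmetric] diff_divide_distrib)
    finally show ?thesis unfolding w_def .
  qed
  ultimately show ?thesis
    unfolding gaussian_system_def using gaussian_system_sym[OF G] gaussian_system_measurable[OF G]
    by (auto simp: Q_def)
qed

section \<open>The law of a Gaussian partition function\<close>

text \<open>
  For bounded variables the remainder of the Taylor expansion of the characteristic function tends
  to \<open>0\<close>, so the moments determine the law.
\<close>
lemma distr_eq_of_bounded_moments:
  assumes P: "prob_space P" and P': "prob_space P'"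
    and [measurable]: "U \<in> borel_measurable P" "V \<in> borel_measurable P'"
    and U: "\<And>\<omega>. \<bar>U \<omega>\<bar> \<le> b" and V: "\<And>\<omega>. \<bar>V \<omega>\<bar> \<le> (b::real)"
    and mom: "\<And>k. (\<integral>\<omega>. U \<omega> ^ k \<partial>P) = (\<integral>\<omega>. V \<omega> ^ k \<partial>P')"
  shows "distr P borel U = distr P' borel V"
proof (rule distr_eqI_cis[OF P P'])
  fix t
  interpret P: prob_space P by fact
  interpret P': prob_space P' by fact
  have b: "0 \<le> b" using U[of undefined] by simp
  have iU: "integrable P (\<lambda>\<omega>. U \<omega> ^ k)" "integrable P (\<lambda>\<omega>. \<bar>U \<omega>\<bar> ^ k)" for k
    using U by (auto intro!: P.integrable_const_bound[where B="b^k"] AE_I2 power_mono simp: power_abs)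
  have iV: "integrable P' (\<lambda>\<omega>. V \<omega> ^ k)" "integrable P' (\<lambda>\<omega>. \<bar>V \<omega>\<bar> ^ k)" for k
    using V by (auto intro!: P'.integrable_const_bound[where B="b^k"] AE_I2 power_mono simp: power_abs)
  have mU: "(\<integral>\<omega>. \<bar>U \<omega>\<bar> ^ n \<partial>P) \<le> b ^ n" for n
  proof -
    have "(\<integral>\<omega>. \<bar>U \<omega>\<bar> ^ n \<partial>P) \<le> (\<integral>\<omega>. b ^ n \<partial>P)"
      by (intro integral_mono iU power_mono U) auto
    then show ?thesis by (simp add: P.prob_space)
  qed
  have mV: "(\<integral>\<omega>. \<bar>V \<omega>\<bar> ^ n \<partial>P') \<le> b ^ n" for n
  proof -
    have "(\<integral>\<omega>. \<bar>V \<omega>\<bar> ^ n \<partial>P') \<le> (\<integral>\<omega>. b ^ n \<partial>P')"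
      by (intro integral_mono iV power_mono V) auto
    then show ?thesis by (simp add: P'.prob_space)
  qed
  let ?a = "char (distr P borel U) t" and ?b = "char (distr P' borel V) t"
  have "norm (?a - ?b) \<le> 4 * ((\<bar>t\<bar> * b) ^ n / fact n)" for n
  proof -
    let ?S = "\<Sum>k\<le>n. ((\<i> * t)^k / fact k) * (\<integral>\<omega>. U \<omega> ^ k \<partial>P)"
    have c: "0 \<le> 2 * \<bar>t\<bar>^n / fact n" by simp
    have "norm (?a - ?S) \<le> (2 * \<bar>t\<bar>^n / fact n) * (\<integral>\<omega>. \<bar>U \<omega>\<bar> ^ n \<partial>P)"
      by (rule P.char_approx1') (auto simp: iU)
    also have "\<dots> \<le> (2 * \<bar>t\<bar>^n / fact n) * b ^ n" by (rule mult_left_mono[OF mU c])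
    finally have 1: "norm (?a - ?S) \<le> (2 * \<bar>t\<bar>^n / fact n) * b ^ n" .
    have "norm (?b - ?S) \<le> (2 * \<bar>t\<bar>^n / fact n) * (\<integral>\<omega>. \<bar>V \<omega>\<bar> ^ n \<partial>P')"
      unfolding mom by (rule P'.char_approx1') (auto simp: iV)
    also have "\<dots> \<le> (2 * \<bar>t\<bar>^n / fact n) * b ^ n" by (rule mult_left_mono[OF mV c])
    finally have 2: "norm (?b - ?S) \<le> (2 * \<bar>t\<bar>^n / fact n) * b ^ n" .
    have "norm (?a - ?b) \<le> norm (?a - ?S) + norm (?b - ?S)"
      using norm_triangle_ineq4[of "?a - ?S" "?b - ?S"] by simp
    with 1 2 show ?thesis by (simp add: power_mult_distrib)
  qed
  moreover have "(\<lambda>n. 4 * ((\<bar>t\<bar> * b) ^ n / fact n)) \<longlonglongrightarrow> 4 * 0"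
    using summable_LIMSEQ_zero[OF summable_exp[of "\<bar>t\<bar> * b"]] by (intro tendsto_intros) (simp add: field_simps)
  ultimately have "norm (?a - ?b) \<le> 0"
    by (intro LIMSEQ_le_const[of _ 0]) auto
  then show "(\<integral>\<omega>. cis (t * U \<omega>) \<partial>P) = (\<integral>\<omega>. cis (t * V \<omega>) \<partial>P')"
    by (simp add: char_distr_eq_cis)
qed auto

lemma isCont_cis: "isCont cis x"
proof -
  have "cis = iexp" by (simp add: fun_eq_iff cis_conv_exp)
  then show ?thesis by (metis isCont_iexp)
qed

text \<open>
  A Gaussian field indexed by the points of a probability space \<open>\<mu>\<close>, jointly measurable, so that
  \<open>exp X\<close> can be integrated over the index space.  Only an upper bound for the variances is
  recorded; it may be enlarged at will.
\<close>
locale gaussian_field = index: prob_space \<mu> for \<mu> :: "'s measure" +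
  fixes P :: "'w measure" and C :: "'s \<Rightarrow> 's \<Rightarrow> real" and X :: "'s \<Rightarrow> 'w \<Rightarrow> real" and v :: real
  assumes gaussian: "gaussian_system P (space \<mu>) C X"
    and jointly_measurable: "(\<lambda>(s, \<omega>). X s \<omega>) \<in> borel_measurable (\<mu> \<Otimes>\<^sub>M P)"
    and variance_le: "s \<in> space \<mu> \<Longrightarrow> C s s \<le> v"
begin

sublocale P: prob_space P by (rule gaussian_system_prob_space[OF gaussian])
sublocale PS: pair_prob_space \<mu> P ..

lemma measurable_field [measurable (raw)]:
  assumes "f \<in> measurable N \<mu>" "g \<in> measurable N P"
  shows "(\<lambda>x. X (f x) (g x)) \<in> borel_measurable N"
  using measurable_compose[OF measurable_Pair[OF assms] jointly_measurable] by simp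

lemma measurable_section [measurable]: "\<omega> \<in> space P \<Longrightarrow> (\<lambda>s. X s \<omega>) \<in> borel_measurable \<mu>"
  by measurable

lemma measurable_at [measurable]: "s \<in> space \<mu> \<Longrightarrow> X s \<in> borel_measurable P"
  by (rule gaussian_system_measurable[OF gaussian])

lemma nn_integral_exp_le:
  "(\<integral>\<^sup>+\<omega>. \<integral>\<^sup>+s. ennreal (exp (c * X s \<omega>)) \<partial>\<mu> \<partial>P) \<le> ennreal (exp (c\<^sup>2 * v / 2))"
proof -
  have "(\<integral>\<^sup>+\<omega>. \<integral>\<^sup>+s. ennreal (exp (c * X s \<omega>)) \<partial>\<mu> \<partial>P) = (\<integral>\<^sup>+s. \<integral>\<^sup>+\<omega>. ennreal (exp (c * X s \<omega>)) \<partial>P \<partial>\<mu>)"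
    by (rule PS.Fubini') measurable
  also have "\<dots> \<le> (\<integral>\<^sup>+s. ennreal (exp (c\<^sup>2 * v / 2)) \<partial>\<mu>)"
    by (intro nn_integral_mono) (auto simp: nn_integral_exp_gaussian_system[OF gaussian] mult_left_mono variance_le)
  finally show ?thesis by (simp add: index.emeasure_space_1)
qed

lemma AE_integrable_exp: "AE \<omega> in P. integrable \<mu> (\<lambda>s. exp (c * X s \<omega>))"
proof -
  have "(\<integral>\<^sup>+\<omega>. \<integral>\<^sup>+s. ennreal (exp (c * X s \<omega>)) \<partial>\<mu> \<partial>P) < \<infinity>"
    using nn_integral_exp_le[of c] by (rule order_le_less_trans) simp
  then have "AE \<omega> in P. (\<integral>\<^sup>+s. ennreal (exp (c * X s \<omega>)) \<partial>\<mu>) \<noteq> \<infinity>"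
    by (intro nn_integral_PInf_AE) auto
  moreover have "AE \<omega> in P. \<omega> \<in> space P" by simp
  ultimately show ?thesis
  proof eventually_elim
    case (elim \<omega>)
    then show ?case by (intro integrableI_nonneg) (auto simp: top.not_eq_extremum)
  qed
qed

text \<open>
  The factor \<open>exp (- \<epsilon> x\<^sup>2/2)\<close> makes the integrand bounded, so that the moments of the integral determine
  its law.
\<close>
definition regularised :: "('s \<Rightarrow> real) \<Rightarrow> real \<Rightarrow> 'w \<Rightarrow> real" where
  "regularised w \<epsilon> \<omega> = (\<integral>s. w s * exp (X s \<omega> - \<epsilon> * (X s \<omega>)\<^sup>2 / 2) \<partial>\<mu>)"

lemma exp_regularised_le:
  fixes x \<epsilon> :: real
  assumes "0 < \<epsilon>"
  shows "exp (x - \<epsilon> * x\<^sup>2 / 2) \<le> exp (1 / (2 * \<epsilon>))"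
proof -
  have "x - \<epsilon> * x\<^sup>2 / 2 = 1 / (2 * \<epsilon>) - \<epsilon> * (x - 1 / \<epsilon>)\<^sup>2 / 2"
    using assms by (simp add: power2_eq_square field_simps)
  then show ?thesis using assms by simp
qed

lemma regularised_bound:
  assumes w: "\<And>s. 0 \<le> w s" "\<And>s. w s \<le> W" and \<epsilon>: "0 < \<epsilon>"
  shows "\<bar>regularised w \<epsilon> \<omega>\<bar> \<le> W * exp (1 / (2 * \<epsilon>))"
proof (cases "integrable \<mu> (\<lambda>s. w s * exp (X s \<omega> - \<epsilon> * (X s \<omega>)\<^sup>2 / 2))")
  case True
  have "norm (regularised w \<epsilon> \<omega>) \<le> (\<integral>s. norm (w s * exp (X s \<omega> - \<epsilon> * (X s \<omega>)\<^sup>2 / 2)) \<partial>\<mu>)"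
    unfolding regularised_def by (rule integral_norm_bound)
  also have "\<dots> \<le> (\<integral>s. W * exp (1 / (2 * \<epsilon>)) \<partial>\<mu>)"
    using True w exp_regularised_le[OF \<epsilon>] by (intro integral_mono) (auto simp: abs_mult intro!: mult_mono order_trans[OF w])
  finally show ?thesis by (simp add: index.prob_space)
next
  case False
  have "0 \<le> W" using w[of undefined] by simp
  with False show ?thesis by (simp add: regularised_def not_integrable_integral_eq)
qed

lemma measurable_regularised [measurable]:
  assumes [measurable]: "w \<in> borel_measurable \<mu>"
  shows "regularised w \<epsilon> \<in> borel_measurable P"
  unfolding regularised_def by measurable

text \<open>
  Averaged over a standard normal \<open>g\<close> this is \<open>w s * exp (x - \<epsilon> x\<^sup>2/2)\<close>: completing the square gives
  \<open>exp (1/(2\<epsilon>)) * exp (- \<epsilon> (x - 1/\<epsilon>)\<^sup>2/2)\<close>, and the second factor is a Gaussian characteristic function.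
\<close>
definition fourier_kernel :: "('s \<Rightarrow> real) \<Rightarrow> real \<Rightarrow> 's \<times> real \<Rightarrow> real \<Rightarrow> complex" where
  "fourier_kernel w \<epsilon> = (\<lambda>(s, g) x. of_real (w s * exp (1 / (2 * \<epsilon>))) * cis (sqrt \<epsilon> * g * x - sqrt \<epsilon> * g / \<epsilon>))"

abbreviation "index_noise \<equiv> \<mu> \<Otimes>\<^sub>M normal01"

lemma integral_fourier_kernel:
  assumes \<epsilon>: "0 < \<epsilon>"
  shows "(\<integral>g. fourier_kernel w \<epsilon> (s, g) x \<partial>normal01) = of_real (w s * exp (x - \<epsilon> * x\<^sup>2 / 2))"
proof -
  have "(\<integral>g. fourier_kernel w \<epsilon> (s, g) x \<partial>normal01) = of_real (w s * exp (1 / (2 * \<epsilon>))) * (\<integral>g. cis ((sqrt \<epsilon> * (x - 1 / \<epsilon>)) * g) \<partial>normal01)"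
    unfolding integral_mult_right_zero[symmetric] fourier_kernel_def
    by (simp add: algebra_simps)
  also have "\<dots> = of_real (w s * (exp (1 / (2 * \<epsilon>)) * exp (- (sqrt \<epsilon> * (x - 1 / \<epsilon>))\<^sup>2 / 2)))"
    unfolding integral_cis_normal01 by simp
  also have "exp (1 / (2 * \<epsilon>)) * exp (- (sqrt \<epsilon> * (x - 1 / \<epsilon>))\<^sup>2 / 2) = exp (x - \<epsilon> * x\<^sup>2 / 2)"
    unfolding exp_add[symmetric] using \<epsilon> by (simp add: power_mult_distrib power2_eq_square field_simps)
  finally show ?thesis .
qed

lemma norm_fourier_kernel_le:
  assumes w: "\<And>s. 0 \<le> w s" "\<And>s. w s \<le> W"
  shows "norm (fourier_kernel w \<epsilon> q x) \<le> W * exp (1 / (2 * \<epsilon>))"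
  using w by (auto simp: fourier_kernel_def norm_mult split: prod.split)

lemma measurable_fourier_kernel [measurable]:
  assumes [measurable]: "w \<in> borel_measurable \<mu>" "f \<in> measurable N index_noise" "h \<in> borel_measurable N"
  shows "(\<lambda>x. fourier_kernel w \<epsilon> (f x) (h x)) \<in> borel_measurable N"
proof -
  have [measurable]: "(\<lambda>x. fst (f x)) \<in> measurable N \<mu>" "(\<lambda>x. snd (f x)) \<in> borel_measurable N"
    using measurable_compose[OF assms(2) measurable_fst] measurable_compose[OF assms(2) measurable_snd]
    by (simp_all cong: measurable_cong_sets)
  show ?thesis unfolding fourier_kernel_def case_prod_beta by measurable
qed

lemma regularised_eq_integral_kernel:
  assumes [measurable]: "w \<in> borel_measurable \<mu>" and w: "\<And>s. 0 \<le> w s" "\<And>s. w s \<le> W"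
    and \<epsilon>: "0 < \<epsilon>" and \<omega>: "\<omega> \<in> space P"
  shows "complex_of_real (regularised w \<epsilon> \<omega>) = (\<integral>q. fourier_kernel w \<epsilon> q (X (fst q) \<omega>) \<partial>index_noise)"
proof -
  interpret N: prob_space normal01 by (rule prob_space_normal01)
  interpret IN: pair_prob_space \<mu> normal01 ..
  have "(\<integral>q. fourier_kernel w \<epsilon> q (X (fst q) \<omega>) \<partial>index_noise) = (\<integral>s. \<integral>g. fourier_kernel w \<epsilon> (s, g) (X s \<omega>) \<partial>normal01 \<partial>\<mu>)"
    using \<omega> norm_fourier_kernel_le[of w W, OF w]
    by (subst IN.integral_fst'[symmetric]) (auto intro!: IN.P.integrable_const_bound AE_I2)
  then show ?thesis
    unfolding integral_fourier_kernel[OF \<epsilon>] regularised_def by (simp only: integral_complex_of_real)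
qed

text \<open>
  The \<open>k\<close>-th power is an integral over \<open>k\<close> independent points and frequencies.  Exchanging it
  with the expectation leaves the expectation of \<open>cis\<close> of a linear combination of field values, and this
  depends on the covariance only.
\<close>
lemma moment_regularised:
  fixes k :: nat
  assumes [measurable]: "w \<in> borel_measurable \<mu>" and w: "\<And>s. 0 \<le> w s" "\<And>s. w s \<le> W" and \<epsilon>: "0 < \<epsilon>"
  shows "complex_of_real (\<integral>\<omega>. regularised w \<epsilon> \<omega> ^ k \<partial>P) =
    (\<integral>q. (\<Prod>j<k. fourier_kernel w \<epsilon> (q j) 0) *
       of_real (exp (- (\<Sum>i<k. \<Sum>j<k. (sqrt \<epsilon> * snd (q i)) * (sqrt \<epsilon> * snd (q j)) * C (fst (q i)) (fst (q j))) / 2))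
      \<partial>PiM {..<k} (\<lambda>_. index_noise))"
proof -
  interpret N: prob_space normal01 by (rule prob_space_normal01)
  interpret IN: pair_prob_space \<mu> normal01 ..
  interpret Q: product_prob_space "\<lambda>_. index_noise" "{..<k}" by standard
  let ?Q = "PiM {..<k} (\<lambda>_. index_noise)"
  interpret QP: prob_space ?Q by (rule prob_space_PiM) (rule IN.P.prob_space_axioms)
  interpret PQ: pair_prob_space P ?Q ..
  let ?K = "\<lambda>\<omega> q. \<Prod>j<k. fourier_kernel w \<epsilon> (q j) (X (fst (q j)) \<omega>)"
  define b where "b = W * exp (1 / (2 * \<epsilon>))"
  have K_le: "norm (fourier_kernel w \<epsilon> q x) \<le> b" for q x
    unfolding b_def by (rule norm_fourier_kernel_le[OF w])
  have [measurable]: "(\<lambda>z. ?K (fst z) (snd z)) \<in> borel_measurable (P \<Otimes>\<^sub>M ?Q)"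
    by measurable
  have K_int: "integrable (P \<Otimes>\<^sub>M ?Q) (\<lambda>z. ?K (fst z) (snd z))"
  proof (rule PQ.P.integrable_const_bound[where B="b^k"])
    have "norm (?K (fst z) (snd z)) \<le> b ^ k" for z
    proof -
      have "norm (?K (fst z) (snd z)) = (\<Prod>j<k. norm (fourier_kernel w \<epsilon> (snd z j) (X (fst (snd z j)) (fst z))))"
        by (rule prod_norm[symmetric])
      also have "\<dots> \<le> (\<Prod>j<k. b)" by (intro prod_mono conjI norm_ge_zero K_le)
      finally show ?thesis by simp
    qed
    then show "AE z in P \<Otimes>\<^sub>M ?Q. norm (?K (fst z) (snd z)) \<le> b ^ k" by simp
  qed measurable
  have "complex_of_real (\<integral>\<omega>. regularised w \<epsilon> \<omega> ^ k \<partial>P) = (\<integral>\<omega>. complex_of_real (regularised w \<epsilon> \<omega>) ^ k \<partial>P)"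
    by (simp flip: integral_complex_of_real)
  also have "\<dots> = (\<integral>\<omega>. \<integral>q. ?K \<omega> q \<partial>?Q \<partial>P)"
  proof (intro Bochner_Integration.integral_cong refl)
    fix \<omega> assume \<omega>: "\<omega> \<in> space P"
    have "(\<integral>q. ?K \<omega> q \<partial>?Q) = (\<Prod>j<k. \<integral>q. fourier_kernel w \<epsilon> q (X (fst q) \<omega>) \<partial>index_noise)"
      using \<omega> K_le by (intro Q.product_integral_prod) (auto intro!: IN.P.integrable_const_bound AE_I2)
    also have "\<dots> = complex_of_real (regularised w \<epsilon> \<omega>) ^ k"
      using regularised_eq_integral_kernel[of w W, OF _ w \<epsilon> \<omega>] by simp
    finally show "complex_of_real (regularised w \<epsilon> \<omega>) ^ k = (\<integral>q. ?K \<omega> q \<partial>?Q)" ..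
  qed
  also have "\<dots> = (\<integral>q. \<integral>\<omega>. ?K \<omega> q \<partial>P \<partial>?Q)"
    using PQ.Fubini_integral[of "\<lambda>\<omega> q. ?K \<omega> q"] K_int by (simp add: case_prod_beta')
  also have "\<dots> = (\<integral>q. (\<Prod>j<k. fourier_kernel w \<epsilon> (q j) 0) *
       of_real (exp (- (\<Sum>i<k. \<Sum>j<k. (sqrt \<epsilon> * snd (q i)) * (sqrt \<epsilon> * snd (q j)) * C (fst (q i)) (fst (q j))) / 2)) \<partial>?Q)"
  proof (intro Bochner_Integration.integral_cong refl)
    fix q assume q: "q \<in> space ?Q"
    have "fst (q j) \<in> space \<mu>" if "j < k" for j
      using q that by (auto simp: space_PiM space_pair_measure PiE_def Pi_def mem_Times_iff)
    then have f: "(\<integral>\<omega>. cis (\<Sum>j<k. (sqrt \<epsilon> * snd (q j)) * X (fst (q j)) \<omega>) \<partial>P) =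
        of_real (exp (- (\<Sum>i<k. \<Sum>j<k. (sqrt \<epsilon> * snd (q i)) * (sqrt \<epsilon> * snd (q j)) * C (fst (q i)) (fst (q j))) / 2))"
      by (intro gaussian_system_cis[OF gaussian])
    have cis_sum: "cis (\<Sum>j\<in>A. f j) = (\<Prod>j\<in>A. cis (f j))" for f :: "nat \<Rightarrow> real" and A
      by (induction A rule: infinite_finite_induct) (auto simp: cis_mult[symmetric])
    have fk: "fourier_kernel w \<epsilon> (q j) x = fourier_kernel w \<epsilon> (q j) 0 * cis ((sqrt \<epsilon> * snd (q j)) * x)" for j x
    proof -
      have "cis (sqrt \<epsilon> * snd (q j) * x - sqrt \<epsilon> * snd (q j) / \<epsilon>) = cis (sqrt \<epsilon> * snd (q j) * 0 - sqrt \<epsilon> * snd (q j) / \<epsilon>) * cis (sqrt \<epsilon> * snd (q j) * x)"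
        unfolding cis_mult by simp
      then show ?thesis unfolding fourier_kernel_def case_prod_beta by (simp only: mult.assoc)
    qed
    have "(\<integral>\<omega>. ?K \<omega> q \<partial>P) = (\<integral>\<omega>. (\<Prod>j<k. fourier_kernel w \<epsilon> (q j) 0) * cis (\<Sum>j<k. (sqrt \<epsilon> * snd (q j)) * X (fst (q j)) \<omega>) \<partial>P)"
      unfolding cis_sum prod.distrib[symmetric]
      by (intro Bochner_Integration.integral_cong prod.cong refl fk)
    also have "\<dots> = (\<Prod>j<k. fourier_kernel w \<epsilon> (q j) 0) * (\<integral>\<omega>. cis (\<Sum>j<k. (sqrt \<epsilon> * snd (q j)) * X (fst (q j)) \<omega>) \<partial>P)"
      by (rule integral_mult_right_zero)
    finally show "(\<integral>\<omega>. ?K \<omega> q \<partial>P) = (\<Prod>j<k. fourier_kernel w \<epsilon> (q j) 0) *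
       of_real (exp (- (\<Sum>i<k. \<Sum>j<k. (sqrt \<epsilon> * snd (q i)) * (sqrt \<epsilon> * snd (q j)) * C (fst (q i)) (fst (q j))) / 2))"
      unfolding f .
  qed
  finally show ?thesis .
qed

lemma integral_cis_regularised_tendsto:
  assumes [measurable]: "w \<in> borel_measurable \<mu>" and w: "\<And>s. 0 \<le> w s" "\<And>s. w s \<le> W"
  shows "(\<lambda>n. \<integral>\<omega>. cis (t * regularised w (1 / real (Suc n)) \<omega>) \<partial>P)
    \<longlonglongrightarrow> (\<integral>\<omega>. cis (t * (\<integral>s. w s * exp (X s \<omega>) \<partial>\<mu>)) \<partial>P)"
proof (rule integral_dominated_convergence[where w="\<lambda>_. 1"])
  show "AE \<omega> in P. (\<lambda>n. cis (t * regularised w (1 / real (Suc n)) \<omega>)) \<longlonglongrightarrow> cis (t * (\<integral>s. w s * exp (X s \<omega>) \<partial>\<mu>))"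
    using AE_integrable_exp[of 1] AE_space
  proof eventually_elim
    case (elim \<omega>)
    have "(\<lambda>n. regularised w (1 / real (Suc n)) \<omega>) \<longlonglongrightarrow> (\<integral>s. w s * exp (X s \<omega>) \<partial>\<mu>)"
      unfolding regularised_def
    proof (rule integral_dominated_convergence[where w="\<lambda>s. W * exp (X s \<omega>)"])
      show "integrable \<mu> (\<lambda>s. W * exp (X s \<omega>))" using elim(1) by simp
      have "(\<lambda>n. w s * exp (X s \<omega> - 1 / real (Suc n) * (X s \<omega>)\<^sup>2 / 2)) \<longlonglongrightarrow> w s * exp (X s \<omega> - 0 * (X s \<omega>)\<^sup>2 / 2)" for s
        by (intro tendsto_intros LIMSEQ_Suc[OF lim_1_over_n]) simp
      then show "AE s in \<mu>. (\<lambda>n. w s * exp (X s \<omega> - 1 / real (Suc n) * (X s \<omega>)\<^sup>2 / 2)) \<longlonglongrightarrow> w s * exp (X s \<omega>)"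
        by simp
      show "AE s in \<mu>. norm (w s * exp (X s \<omega> - 1 / real (Suc n) * (X s \<omega>)\<^sup>2 / 2)) \<le> W * exp (X s \<omega>)" for n
        using w by (intro AE_I2) (auto simp: abs_mult intro!: mult_mono order_trans[OF w])
    qed (use elim(2) in measurable)
    then show ?case by (intro isCont_tendsto_compose[OF isCont_cis] tendsto_intros)
  qed
qed auto

end

text \<open>
  Equal covariances give equal moments, hence equal laws, of the regularised integrals, and the
  characteristic functions converge as the regularisation is removed.
\<close>
lemma gaussian_field_partition_law:
  assumes X: "gaussian_field \<mu> P C X v" and Y: "gaussian_field \<mu> P' C Y v"
    and [measurable]: "w \<in> borel_measurable \<mu>" and w: "\<And>s. 0 \<le> w s" "\<And>s. w s \<le> W"
  shows "distr P borel (\<lambda>\<omega>. \<integral>s. w s * exp (X s \<omega>) \<partial>\<mu>) = distr P' borel (\<lambda>\<omega>. \<integral>s. w s * exp (Y s \<omega>) \<partial>\<mu>)"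
proof -
  interpret X: gaussian_field \<mu> P C X v by fact
  interpret Y: gaussian_field \<mu> P' C Y v by fact
  have reg: "distr P borel (X.regularised w \<epsilon>) = distr P' borel (Y.regularised w \<epsilon>)" if \<epsilon>: "0 < \<epsilon>" for \<epsilon>
  proof (rule distr_eq_of_bounded_moments[OF X.P.prob_space_axioms Y.P.prob_space_axioms _ _ X.regularised_bound[OF w \<epsilon>] Y.regularised_bound[OF w \<epsilon>]])
    show "(\<integral>\<omega>. X.regularised w \<epsilon> \<omega> ^ k \<partial>P) = (\<integral>\<omega>. Y.regularised w \<epsilon> \<omega> ^ k \<partial>P')" for k
      using X.moment_regularised[of w W, OF _ w \<epsilon>] Y.moment_regularised[of w W, OF _ w \<epsilon>]
      by (simp flip: of_real_eq_iff[where 'a=complex] add: X.fourier_kernel_def Y.fourier_kernel_def)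
  qed auto
  show ?thesis
  proof (rule distr_eqI_cis[OF X.P.prob_space_axioms Y.P.prob_space_axioms])
    fix t
    have "(\<integral>\<omega>. cis (t * X.regularised w (1 / real (Suc n)) \<omega>) \<partial>P) = (\<integral>\<omega>. cis (t * Y.regularised w (1 / real (Suc n)) \<omega>) \<partial>P')" for n
      by (rule integral_eq_of_distr_eq[OF reg, where h="\<lambda>x. cis (t * x)"]) auto
    then show "(\<integral>\<omega>. cis (t * (\<integral>s. w s * exp (X s \<omega>) \<partial>\<mu>)) \<partial>P) = (\<integral>\<omega>. cis (t * (\<integral>s. w s * exp (Y s \<omega>) \<partial>\<mu>)) \<partial>P')"
      using X.integral_cis_regularised_tendsto[of w W t, OF _ w] Y.integral_cis_regularised_tendsto[of w W t, OF _ w]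
      by (auto intro: LIMSEQ_unique)
  qed auto
qed

section \<open>Gaussian change of measure\<close>

lemma gaussian_system_cis_set:
  assumes G: "gaussian_system P S C X" and I: "finite I" and f: "\<And>i. i \<in> I \<Longrightarrow> f i \<in> S"
  shows "(\<integral>\<omega>. cis (\<Sum>i\<in>I. a i * X (f i) \<omega>) \<partial>P) =
    complex_of_real (exp (- (\<Sum>i\<in>I. \<Sum>j\<in>I. a i * a j * C (f i) (f j)) / 2))"
proof -
  obtain h where h: "bij_betw h {0..<card I} I" using ex_bij_betw_nat_finite[OF I] by auto
  then have h: "bij_betw h {..<card I} I" by (simp add: atLeast0LessThan)
  have "h i \<in> I" if "i < card I" for i using h that by (auto simp: bij_betw_def)
  then have "(\<integral>\<omega>. cis (\<Sum>i<card I. a (h i) * X (f (h i)) \<omega>) \<partial>P) =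
    complex_of_real (exp (- (\<Sum>i<card I. \<Sum>j<card I. a (h i) * a (h j) * C (f (h i)) (f (h j))) / 2))"
    using f by (intro gaussian_system_cis[OF G]) auto
  also have "(\<lambda>\<omega>. \<Sum>i<card I. a (h i) * X (f (h i)) \<omega>) = (\<lambda>\<omega>. \<Sum>i\<in>I. a i * X (f i) \<omega>)"
    by (intro ext sum.reindex_bij_betw[OF h, of "\<lambda>i. a i * X (f i) _"])
  also have "(\<Sum>i<card I. \<Sum>j<card I. a (h i) * a (h j) * C (f (h i)) (f (h j))) = (\<Sum>i<card I. \<Sum>j\<in>I. a (h i) * a j * C (f (h i)) (f j))"
    by (intro sum.cong refl sum.reindex_bij_betw[OF h, of "\<lambda>j. a (h _) * a j * C (f (h _)) (f j)"])
  also have "\<dots> = (\<Sum>i\<in>I. \<Sum>j\<in>I. a i * a j * C (f i) (f j))"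
    by (rule sum.reindex_bij_betw[OF h, of "\<lambda>i. \<Sum>j\<in>I. a i * a j * C (f i) (f j)"])
  finally show ?thesis .
qed

text \<open>
  All Gaussian systems below are obtained by this lemma from independent normal variables, from
  products of systems, or from systems given in advance.
\<close>
lemma gaussian_system_linear:
  assumes G: "gaussian_system P S C X" and F: "finite F"
    and p: "\<And>t k. t \<in> T \<Longrightarrow> k \<in> F \<Longrightarrow> p t k \<in> S"
    and Y: "\<And>t \<omega>. t \<in> T \<Longrightarrow> Y t \<omega> = (\<Sum>k\<in>F. b t k * X (p t k) \<omega>)"
    and D: "\<And>t t'. t \<in> T \<Longrightarrow> t' \<in> T \<Longrightarrow> D t t' = (\<Sum>k\<in>F. \<Sum>l\<in>F. b t k * b t' l * C (p t k) (p t' l))"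
  shows "gaussian_system P T D Y"
  unfolding gaussian_system_def
proof (intro conjI ballI allI impI)
  show "prob_space P" by (rule gaussian_system_prob_space[OF G])
  show "Y t \<in> borel_measurable P" if "t \<in> T" for t
    using that p gaussian_system_measurable[OF G] by (subst measurable_cong[OF Y]) auto
  show "D t t' = D t' t" if "t \<in> T" "t' \<in> T" for t t'
    unfolding D[OF that] D[OF that(2,1)]
    by (subst sum.swap, intro sum.cong refl) (simp add: gaussian_system_sym[OF G] p that mult.commute)
  fix n :: nat and a f assume f: "\<forall>i<n. f i \<in> T"
  let ?I = "{..<n} \<times> F"
  have "(\<integral>\<omega>. cis (\<Sum>i<n. a i * Y (f i) \<omega>) \<partial>P) = (\<integral>\<omega>. cis (\<Sum>z\<in>?I. (a (fst z) * b (f (fst z)) (snd z)) * X (p (f (fst z)) (snd z)) \<omega>) \<partial>P)"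
    using f by (simp add: Y sum.cartesian_product' sum_distrib_left mult.assoc)
  also have "\<dots> = complex_of_real (exp (- (\<Sum>z\<in>?I. \<Sum>z'\<in>?I. (a (fst z) * b (f (fst z)) (snd z)) * (a (fst z') * b (f (fst z')) (snd z')) * C (p (f (fst z)) (snd z)) (p (f (fst z')) (snd z'))) / 2))"
    using f p F by (intro gaussian_system_cis_set[OF G]) auto
  also have "(\<Sum>z\<in>?I. \<Sum>z'\<in>?I. (a (fst z) * b (f (fst z)) (snd z)) * (a (fst z') * b (f (fst z')) (snd z')) * C (p (f (fst z)) (snd z)) (p (f (fst z')) (snd z')))
     = (\<Sum>i<n. \<Sum>k\<in>F. \<Sum>j<n. \<Sum>l\<in>F. a i * a j * (b (f i) k * b (f j) l * C (p (f i) k) (p (f j) l)))"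
    by (simp add: sum.cartesian_product' ac_simps)
  also have "\<dots> = (\<Sum>i<n. \<Sum>j<n. \<Sum>k\<in>F. \<Sum>l\<in>F. a i * a j * (b (f i) k * b (f j) l * C (p (f i) k) (p (f j) l)))"
    by (intro sum.cong refl sum.swap)
  also have "\<dots> = (\<Sum>i<n. \<Sum>j<n. a i * a j * D (f i) (f j))"
    using f by (intro sum.cong refl) (simp add: D sum_distrib_left)
  finally show "(\<integral>\<omega>. cis (\<Sum>i<n. a i * Y (f i) \<omega>) \<partial>P) = complex_of_real (exp (- (\<Sum>i<n. \<Sum>j<n. a i * a j * D (f i) (f j)) / 2))" .
qed

lemma gaussian_system_reindex:
  assumes G: "gaussian_system P S C X" and p: "\<And>t. t \<in> T \<Longrightarrow> p t \<in> S"
    and D: "\<And>t t'. t \<in> T \<Longrightarrow> t' \<in> T \<Longrightarrow> D t t' = C (p t) (p t')"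
    and Y: "\<And>t \<omega>. t \<in> T \<Longrightarrow> Y t \<omega> = X (p t) \<omega>"
  shows "gaussian_system P T D Y"
  by (rule gaussian_system_linear[OF G, of "{()}" T "\<lambda>t _. p t" Y "\<lambda>_ _. 1"]) (auto simp: p D Y)

text \<open>
  Weighting by \<open>exp (X a)\<close> adds the drift \<open>K a\<close> to the field, and the law of the partition function of
  the drifted field depends on the covariance only.  In particular the field on the right may live on another
  probability space, and \<open>a\<close> need not be one of the indices that are integrated over.
\<close>
lemma gaussian_change_of_measure:
  assumes G: "gaussian_system P S K X" and a: "a \<in> S" and \<iota>: "\<And>s. s \<in> space \<mu> \<Longrightarrow> \<iota> s \<in> S"
    and meas: "(\<lambda>(s, \<omega>). X (\<iota> s) \<omega>) \<in> borel_measurable (\<mu> \<Otimes>\<^sub>M P)"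
    and Y: "gaussian_field \<mu> P' C Y v"
    and C: "\<And>s t. s \<in> space \<mu> \<Longrightarrow> t \<in> space \<mu> \<Longrightarrow> C s t = K (\<iota> s) (\<iota> t)"
    and c[measurable]: "(\<lambda>s. K a (\<iota> s)) \<in> borel_measurable \<mu>"
    and \<Phi>[measurable]: "\<Phi> \<in> borel_measurable borel"
  shows "(\<integral>\<^sup>+\<omega>. ennreal (exp (X a \<omega>)) * \<Phi> (\<integral>s. exp (X (\<iota> s) \<omega>) \<partial>\<mu>) \<partial>P)
    = ennreal (exp (K a a / 2)) * (\<integral>\<^sup>+\<omega>. \<Phi> (\<integral>s. exp (K a (\<iota> s)) * exp (Y s \<omega>) \<partial>\<mu>) \<partial>P')"
proof -
  interpret Y: gaussian_field \<mu> P' C Y v by fact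
  interpret P: prob_space P by (rule gaussian_system_prob_space[OF G])
  define Q where "Q = density P (\<lambda>\<omega>. ennreal (exp (X a \<omega> - K a a / 2)))"
  define c where "c = (\<lambda>s. K a (\<iota> s))"
  define X' where "X' = (\<lambda>s \<omega>. X (\<iota> s) \<omega> - c s)"
  have [measurable]: "X a \<in> borel_measurable P" by (rule gaussian_system_measurable[OF G a])
  have [measurable]: "c \<in> borel_measurable \<mu>" unfolding c_def by measurable
  have sQ[measurable_cong]: "sets Q = sets P" and spQ: "space Q = space P" by (auto simp: Q_def)
  have gQ: "gaussian_system Q S K (\<lambda>t \<omega>. X t \<omega> - K a t)"
    unfolding Q_def by (rule gaussian_system_tilt[OF G a])
  have mX': "(\<lambda>(s, \<omega>). X' s \<omega>) \<in> borel_measurable (\<mu> \<Otimes>\<^sub>M P)"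
    unfolding X'_def using meas by (simp add: case_prod_beta')
  interpret X': gaussian_field \<mu> Q C X' v
  proof
    show "gaussian_system Q (space \<mu>) C X'"
      by (rule gaussian_system_reindex[OF gQ \<iota>]) (auto simp: C X'_def c_def)
    show "(\<lambda>(s, \<omega>). X' s \<omega>) \<in> borel_measurable (\<mu> \<Otimes>\<^sub>M Q)"
      using mX' by (simp cong: measurable_cong_sets[OF sets_pair_measure_cong[OF refl sQ]])
    show "s \<in> space \<mu> \<Longrightarrow> C s s \<le> v" for s by (rule Y.variance_le)
  qed
  define V where "V = max (K a a) v"
  have cV: "\<bar>c s\<bar> \<le> V" if "s \<in> space \<mu>" for s
  proof -
    have "gaussian_system P (insert a (\<iota> ` space \<mu>)) K X"
      by (rule gaussian_system_reindex[OF G, where p="\<lambda>x. x"]) (use a \<iota> in auto)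
    moreover have "K x x \<le> V" if "x \<in> insert a (\<iota> ` space \<mu>)" for x
      using that Y.variance_le by (auto simp: V_def C[symmetric] le_max_iff_disj)
    ultimately have "\<bar>K a (\<iota> s)\<bar> \<le> V"
      using that by (intro gaussian_system_abs_le) auto
    then show ?thesis by (simp add: c_def)
  qed
  \<comment> \<open>Bounded on the whole type, as the law of the partition function is stated for bounded weights.\<close>
  define w where "w = (\<lambda>s. if s \<in> space \<mu> then exp (c s) else 0)"
  have [measurable]: "w \<in> borel_measurable \<mu>" unfolding w_def by measurable
  have w: "0 \<le> w s" "w s \<le> exp V" for s
    using cV[of s] by (auto simp: w_def)
  have eX: "(\<integral>s. exp (X (\<iota> s) \<omega>) \<partial>\<mu>) = (\<integral>s. w s * exp (X' s \<omega>) \<partial>\<mu>)" for \<omega>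
    by (intro Bochner_Integration.integral_cong refl) (simp add: w_def X'_def exp_add[symmetric])
  have eY: "(\<integral>s. exp (K a (\<iota> s)) * exp (Y s \<omega>) \<partial>\<mu>) = (\<integral>s. w s * exp (Y s \<omega>) \<partial>\<mu>)" for \<omega>
    by (intro Bochner_Integration.integral_cong refl) (simp add: w_def c_def)
  have mU: "(\<lambda>\<omega>. \<integral>s. w s * exp (X' s \<omega>) \<partial>\<mu>) \<in> borel_measurable Q" by measurable
  then have [measurable]: "(\<lambda>\<omega>. \<integral>s. w s * exp (X' s \<omega>) \<partial>\<mu>) \<in> borel_measurable P"
    by (simp cong: measurable_cong_sets)
  have "(\<integral>\<^sup>+\<omega>. ennreal (exp (X a \<omega>)) * \<Phi> (\<integral>s. exp (X (\<iota> s) \<omega>) \<partial>\<mu>) \<partial>P)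
      = (\<integral>\<^sup>+\<omega>. ennreal (exp (K a a / 2)) * (ennreal (exp (X a \<omega> - K a a / 2)) * \<Phi> (\<integral>s. w s * exp (X' s \<omega>) \<partial>\<mu>)) \<partial>P)"
    unfolding eX by (intro nn_integral_cong) (simp add: ennreal_mult[symmetric] exp_add[symmetric] mult.assoc[symmetric])
  also have "\<dots> = ennreal (exp (K a a / 2)) * (\<integral>\<^sup>+\<omega>. ennreal (exp (X a \<omega> - K a a / 2)) * \<Phi> (\<integral>s. w s * exp (X' s \<omega>) \<partial>\<mu>) \<partial>P)"
    by (rule nn_integral_cmult) measurable
  also have "(\<integral>\<^sup>+\<omega>. ennreal (exp (X a \<omega> - K a a / 2)) * \<Phi> (\<integral>s. w s * exp (X' s \<omega>) \<partial>\<mu>) \<partial>P)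
      = (\<integral>\<^sup>+\<omega>. \<Phi> (\<integral>s. w s * exp (X' s \<omega>) \<partial>\<mu>) \<partial>Q)"
    unfolding Q_def by (rule nn_integral_density[symmetric]) measurable
  also have "\<dots> = (\<integral>\<^sup>+\<omega>. \<Phi> (\<integral>s. w s * exp (Y s \<omega>) \<partial>\<mu>) \<partial>P')"
    by (rule nn_integral_eq_of_distr_eq[OF gaussian_field_partition_law[OF X'.gaussian_field_axioms Y]])
       (use w mU in measurable)
  finally show ?thesis unfolding eY .
qed

section \<open>Concentration of the log-partition function\<close>

text \<open>
  Two independent systems over the same index set, distinguished by a Boolean tag.
\<close>
lemma gaussian_system_product:
  fixes S :: "'s set"
  assumes G: "gaussian_system P S C X" and G': "gaussian_system P' S C' X'"
  shows "gaussian_system (P \<Otimes>\<^sub>M P') (UNIV \<times> S)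
     (\<lambda>x y. if fst x = fst y then (if fst x then C (snd x) (snd y) else C' (snd x) (snd y)) else 0)
     (\<lambda>x \<omega>. if fst x then X (snd x) (fst \<omega>) else X' (snd x) (snd \<omega>))"
  unfolding gaussian_system_def
proof (intro conjI ballI allI impI)
  interpret P: prob_space P by (rule gaussian_system_prob_space[OF G])
  interpret P': prob_space P' by (rule gaussian_system_prob_space[OF G'])
  interpret R: pair_prob_space P P' ..
  show "prob_space (P \<Otimes>\<^sub>M P')" by (rule R.P.prob_space_axioms)
  show "(\<lambda>\<omega>. if fst x then X (snd x) (fst \<omega>) else X' (snd x) (snd \<omega>)) \<in> borel_measurable (P \<Otimes>\<^sub>M P')"
    if "x \<in> UNIV \<times> S" for x
    using that gaussian_system_measurable[OF G, of "snd x"] gaussian_system_measurable[OF G', of "snd x"]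
    by (cases "fst x") (auto intro: measurable_compose[OF measurable_fst] measurable_compose[OF measurable_snd])
  show "(if fst x = fst y then (if fst x then C (snd x) (snd y) else C' (snd x) (snd y)) else 0) = (if fst y = fst x then (if fst y then C (snd y) (snd x) else C' (snd y) (snd x)) else 0)"
    if "x \<in> UNIV \<times> S" "y \<in> UNIV \<times> S" for x y :: "bool \<times> 's"
    using that gaussian_system_sym[OF G] gaussian_system_sym[OF G'] by auto
  fix n :: nat and a and f :: "nat \<Rightarrow> bool \<times> 's" assume f: "\<forall>i<n. f i \<in> UNIV \<times> S"
  let ?I = "{i. i < n \<and> fst (f i)}" and ?J = "{i. i < n \<and> \<not> fst (f i)}"
  have part: "{..<n} = ?I \<union> ?J" "?I \<inter> ?J = {}" by auto
  have split: "(\<Sum>i<n. g i) = sum g ?I + sum g ?J" for g :: "nat \<Rightarrow> real"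
    unfolding part(1) by (rule sum.union_disjoint) auto
  define u where "u = (\<lambda>\<omega>. \<Sum>i\<in>?I. a i * X (snd (f i)) \<omega>)"
  define u' where "u' = (\<lambda>\<omega>. \<Sum>i\<in>?J. a i * X' (snd (f i)) \<omega>)"
  have [measurable]: "u \<in> borel_measurable P" "u' \<in> borel_measurable P'"
    unfolding u_def u'_def using f gaussian_system_measurable[OF G] gaussian_system_measurable[OF G']
    by (auto intro!: borel_measurable_sum borel_measurable_times simp: mem_Times_iff)
  have "(\<integral>\<omega>. cis (\<Sum>i<n. a i * (if fst (f i) then X (snd (f i)) (fst \<omega>) else X' (snd (f i)) (snd \<omega>))) \<partial>(P \<Otimes>\<^sub>M P'))
      = (\<integral>\<omega>. cis (u (fst \<omega>)) * cis (u' (snd \<omega>)) \<partial>(P \<Otimes>\<^sub>M P'))"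
    unfolding split cis_mult u_def u'_def by simp
  also have "\<dots> = (\<integral>x. \<integral>y. cis (u x) * cis (u' y) \<partial>P' \<partial>P)"
    by (subst R.integral_fst'[symmetric]) (auto intro!: R.P.integrable_const_bound[where B=1] simp: norm_mult)
  also have "\<dots> = (\<integral>x. cis (u x) \<partial>P) * (\<integral>y. cis (u' y) \<partial>P')"
    by simp
  also have "(\<integral>x. cis (u x) \<partial>P) = complex_of_real (exp (- (\<Sum>i\<in>?I. \<Sum>j\<in>?I. a i * a j * C (snd (f i)) (snd (f j))) / 2))"
    unfolding u_def using f by (intro gaussian_system_cis_set[OF G]) (auto simp: mem_Times_iff)
  also have "(\<integral>x. cis (u' x) \<partial>P') = complex_of_real (exp (- (\<Sum>i\<in>?J. \<Sum>j\<in>?J. a i * a j * C' (snd (f i)) (snd (f j))) / 2))"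
    unfolding u'_def using f by (intro gaussian_system_cis_set[OF G']) (auto simp: mem_Times_iff)
  also have "complex_of_real (exp (- (\<Sum>i\<in>?I. \<Sum>j\<in>?I. a i * a j * C (snd (f i)) (snd (f j))) / 2)) * complex_of_real (exp (- (\<Sum>i\<in>?J. \<Sum>j\<in>?J. a i * a j * C' (snd (f i)) (snd (f j))) / 2))
     = complex_of_real (exp (- (\<Sum>i<n. \<Sum>j<n. a i * a j * (if fst (f i) = fst (f j) then (if fst (f i) then C (snd (f i)) (snd (f j)) else C' (snd (f i)) (snd (f j))) else 0)) / 2))"
    unfolding of_real_mult[symmetric] exp_add[symmetric] split by (simp add: add_divide_distrib)
  finally show "(\<integral>\<omega>. cis (\<Sum>i<n. a i * (if fst (f i) then X (snd (f i)) (fst \<omega>) else X' (snd (f i)) (snd \<omega>))) \<partial>(P \<Otimes>\<^sub>M P')) = complex_of_real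
        (exp (- (\<Sum>i<n. \<Sum>j<n. a i * a j * (if fst (f i) = fst (f j) then (if fst (f i) then C (snd (f i)) (snd (f j)) else C' (snd (f i)) (snd (f j))) else 0)) / 2))" .
qed

text \<open>
  Jensen's inequality for \<open>z \<mapsto> 1 / z\<close>, obtained by integrating its tangent line at the mean.
\<close>
lemma inverse_integral_exp_le:
  assumes "prob_space \<mu>" and i: "integrable \<mu> (\<lambda>s. exp (x s))" "integrable \<mu> (\<lambda>s. exp (- x s :: real))"
  shows "0 < (\<integral>s. exp (x s) \<partial>\<mu>)" and "1 / (\<integral>s. exp (x s) \<partial>\<mu>) \<le> (\<integral>s. exp (- x s) \<partial>\<mu>)"
proof -
  interpret prob_space \<mu> by fact
  let ?z = "\<integral>s. exp (x s) \<partial>\<mu>"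
  show z: "0 < ?z"
  proof -
    have "?z \<noteq> 0"
    proof
      assume "?z = 0"
      then have "AE s in \<mu>. exp (x s) = 0"
        using integral_nonneg_eq_0_iff_AE[OF i(1)] by simp
      then show False by simp
    qed
    moreover have "0 \<le> ?z" by simp
    ultimately show ?thesis by linarith
  qed
  have "2 / ?z - exp (x s) / ?z\<^sup>2 \<le> exp (- x s)" for s
  proof -
    have "0 \<le> (exp (x s) / ?z - 1)\<^sup>2 * exp (- x s)" by simp
    also have "\<dots> = exp (x s) / ?z\<^sup>2 - 2 / ?z + exp (- x s)"
      using z by (simp add: power2_eq_square field_simps exp_minus)
    finally show ?thesis by simp
  qed
  then have "(\<integral>s. 2 / ?z - exp (x s) / ?z\<^sup>2 \<partial>\<mu>) \<le> (\<integral>s. exp (- x s) \<partial>\<mu>)"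
    using i by (intro integral_mono) auto
  also have "(\<integral>s. 2 / ?z - exp (x s) / ?z\<^sup>2 \<partial>\<mu>) = 1 / ?z"
    using i z by (simp add: prob_space power2_eq_square field_simps)
  finally show "1 / ?z \<le> (\<integral>s. exp (- x s) \<partial>\<mu>)" .
qed

lemma ennreal_integral_le_nn_integral:
  fixes f :: "'s \<Rightarrow> real"
  assumes "integrable \<mu> f"
  shows "ennreal (\<integral>x. f x \<partial>\<mu>) \<le> (\<integral>\<^sup>+x. ennreal (f x) \<partial>\<mu>)"
proof -
  have "(\<integral>x. f x \<partial>\<mu>) \<le> (\<integral>x. max 0 (f x) \<partial>\<mu>)"
    using assms by (intro integral_mono) auto
  moreover have "ennreal (\<integral>x. max 0 (f x) \<partial>\<mu>) = (\<integral>\<^sup>+x. ennreal (max 0 (f x)) \<partial>\<mu>)"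
    using assms by (intro nn_integral_eq_integral[symmetric]) auto
  moreover have "(\<integral>\<^sup>+x. ennreal (max 0 (f x)) \<partial>\<mu>) = (\<integral>\<^sup>+x. ennreal (f x) \<partial>\<mu>)"
    by (intro nn_integral_cong) (simp add: max_def ennreal_neg)
  ultimately show ?thesis by (metis ennreal_leI)
qed

text \<open>
  With \<open>p\<close> and \<open>q\<close> the two normalised densities, the claim says that the integral of
  \<open>p * (p / q) powr m\<close> is at least \<open>1\<close>.  It follows by integrating
  \<open>(p / q) powr m \<ge> 1 + m * ln (p / q) \<ge> 1 + m * (1 - q / p)\<close> against \<open>p\<close>.
\<close>
lemma partition_ratio_powr_le:
  assumes "prob_space \<mu>" and i: "integrable \<mu> (\<lambda>s. exp (x s))" "integrable \<mu> (\<lambda>s. exp (y s))" and m: "0 \<le> m"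
    and pos: "0 < (\<integral>s. exp (x s) \<partial>\<mu>)" "0 < (\<integral>s. exp (y s) \<partial>\<mu>)"
  shows "ennreal (exp (m * (ln (\<integral>s. exp (x s) \<partial>\<mu>) - ln (\<integral>s. exp (y s) \<partial>\<mu>))))
     \<le> (\<integral>\<^sup>+s. ennreal (exp (x s + m * (x s - y s))) * ennreal (1 / (\<integral>s. exp (x s) \<partial>\<mu>)) \<partial>\<mu>)"
proof -
  interpret prob_space \<mu> by fact
  let ?x = "\<integral>s. exp (x s) \<partial>\<mu>" and ?y = "\<integral>s. exp (y s) \<partial>\<mu>"
  let ?E = "exp (m * (ln ?x - ln ?y))"
  have [measurable]: "x \<in> borel_measurable \<mu>" "y \<in> borel_measurable \<mu>"
    using borel_measurable_ln[OF borel_measurable_integrable[OF i(1)]] borel_measurable_ln[OF borel_measurable_integrable[OF i(2)]]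
    by simp_all
  have le: "?E * ((1 + m) * (exp (x s) / ?x) - m * (exp (y s) / ?y)) \<le> exp (x s + m * (x s - y s)) * (1 / ?x)" for s
  proof -
    \<comment> \<open>\<open>p\<close> and \<open>q\<close> are the two normalised densities at \<open>s\<close>.\<close>
    define p where "p = exp (x s) / ?x"
    define q where "q = exp (y s) / ?y"
    have pq: "0 < p" "0 < q" using pos by (auto simp: p_def q_def)
    have lp: "ln p = x s - ln ?x" "ln q = y s - ln ?y" using pos by (auto simp: p_def q_def ln_div)
    have "(1 + m) * p - m * q = p * (1 + m * (1 - q / p))" using pq by (simp add: field_simps)
    also have "\<dots> \<le> p * (1 + m * (ln p - ln q))"
    proof -
      have "ln (q / p) \<le> q / p - 1" using pq by (intro ln_le_minus_one) simp
      then have "1 - q / p \<le> ln p - ln q" using pq by (simp add: ln_div)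
      then show ?thesis using pq m by (intro mult_left_mono add_left_mono) auto
    qed
    also have "\<dots> \<le> p * exp (m * (ln p - ln q))"
      using pq exp_ge_add_one_self[of "m * (ln p - ln q)"] by (intro mult_left_mono) auto
    finally have "?E * ((1 + m) * p - m * q) \<le> ?E * (p * exp (m * (ln p - ln q)))" by simp
    also have "\<dots> = exp (x s + m * (x s - y s)) * (1 / ?x)"
      unfolding lp by (simp add: p_def exp_add[symmetric] algebra_simps)
    finally show ?thesis unfolding p_def q_def .
  qed
  have "?E = (\<integral>s. ?E * ((1 + m) * (exp (x s) / ?x) - m * (exp (y s) / ?y)) \<partial>\<mu>)"
    using i pos by simp
  then have "ennreal ?E = ennreal (\<integral>s. ?E * ((1 + m) * (exp (x s) / ?x) - m * (exp (y s) / ?y)) \<partial>\<mu>)" by simp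
  also have "\<dots> \<le> (\<integral>\<^sup>+s. ennreal (?E * ((1 + m) * (exp (x s) / ?x) - m * (exp (y s) / ?y))) \<partial>\<mu>)"
    by (rule ennreal_integral_le_nn_integral) (use i in simp)
  also have "\<dots> \<le> (\<integral>\<^sup>+s. ennreal (exp (x s + m * (x s - y s)) * (1 / ?x)) \<partial>\<mu>)"
    by (intro nn_integral_mono ennreal_leI le)
  also have "\<dots> = (\<integral>\<^sup>+s. ennreal (exp (x s + m * (x s - y s))) * ennreal (1 / ?x) \<partial>\<mu>)"
    by (intro nn_integral_cong ennreal_mult) (use pos in auto)
  finally show ?thesis .
qed

text \<open>
  Jensen's inequality for \<open>exp\<close> and \<open>n\<close> equal weights.
\<close>
lemma exp_sum_le_average:
  assumes "0 < (n::nat)"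
  shows "exp (\<Sum>k<n. d k :: real) \<le> (\<Sum>k<n. exp (real n * d k)) / real n"
proof -
  let ?S = "\<Sum>k<n. d k"
  have "exp (real n * d k) \<ge> exp ?S * (1 + (real n * d k - ?S))" for k
  proof -
    have "exp ?S * (1 + (real n * d k - ?S)) \<le> exp ?S * exp (real n * d k - ?S)"
      by (intro mult_left_mono exp_ge_add_one_self) auto
    then show ?thesis by (simp add: exp_add[symmetric])
  qed
  then have "(\<Sum>k<n. exp ?S * (1 + (real n * d k - ?S))) \<le> (\<Sum>k<n. exp (real n * d k))"
    by (rule sum_mono)
  also have "(\<Sum>k<n. exp ?S * (1 + (real n * d k - ?S))) = exp ?S * real n"
    unfolding sum_distrib_left[symmetric] by (simp add: sum.distrib sum_subtractf sum_distrib_left[symmetric])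
  finally show ?thesis using assms by (simp add: field_simps)
qed

context gaussian_field
begin

definition log_partition :: "'w \<Rightarrow> real" where
  "log_partition \<omega> = ln (\<integral>s. exp (X s \<omega>) \<partial>\<mu>)"

lemma measurable_log_partition [measurable]: "log_partition \<in> borel_measurable P"
  unfolding log_partition_def by measurable

text \<open>
  The covariance can be read off from characteristic functions of sums of two field values, and these are
  measurable in the index by Fubini.
\<close>
lemma measurable_covariance: "s \<in> space \<mu> \<Longrightarrow> (\<lambda>t. C s t) \<in> borel_measurable \<mu>"
proof -
  assume s: "s \<in> space \<mu>"
  have eq: "C s t = ln (Re (\<integral>\<omega>. cis (X t \<omega>) \<partial>P)) - ln (Re (\<integral>\<omega>. cis (X s \<omega> + X t \<omega>) \<partial>P)) - C s s / 2"
    if t: "t \<in> space \<mu>" for t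
  proof -
    have "Re (\<integral>\<omega>. cis (X t \<omega>) \<partial>P) = exp (- C t t / 2)"
      using gaussian_system_cis_extend[OF gaussian _ t, of 0 undefined 1 0] by simp
    moreover have "Re (\<integral>\<omega>. cis (X s \<omega> + X t \<omega>) \<partial>P) = exp (- (C s s + 2 * C s t + C t t) / 2)"
      using gaussian_system_cis_extend[OF gaussian _ s, of 1 "\<lambda>_. t" 1 1 "\<lambda>_. 1"] t by simp
    ultimately show ?thesis by (simp add: field_simps)
  qed
  have "(\<lambda>t. ln (Re (\<integral>\<omega>. cis (X t \<omega>) \<partial>P)) - ln (Re (\<integral>\<omega>. cis (X s \<omega> + X t \<omega>) \<partial>P)) - C s s / 2) \<in> borel_measurable \<mu>"
    using s by measurable
  then show ?thesis by (subst measurable_cong[OF eq])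
qed

lemma variance_nonneg: "s \<in> space \<mu> \<Longrightarrow> 0 \<le> C s s"
  using gaussian_system_psd[OF gaussian, of 1 "\<lambda>_. s" "\<lambda>_. 1"] by simp

lemma variance_bound_nonneg: "0 \<le> v"
  using index.not_empty variance_nonneg variance_le by (meson all_not_in_conv order_trans)

end

text \<open>
  Convexity of \<open>exp\<close> between \<open>0\<close> and \<open>x\<close>.
\<close>
lemma exp_mult_le_affine:
  assumes "0 \<le> c" "c \<le> (1::real)"
  shows "exp (c * x) \<le> 1 - c + c * exp x"
proof -
  have "exp (c * x) * (1 - c * x) \<le> exp (c * x) * exp (- (c * x))"
    using exp_ge_add_one_self[of "- (c * x)"] by (intro mult_left_mono) auto
  then have a: "exp (c * x) * (1 - c * x) \<le> 1" by (simp add: exp_add[symmetric])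
  have "exp (c * x) * (1 + (1 - c) * x) \<le> exp (c * x) * exp ((1 - c) * x)"
    by (intro mult_left_mono exp_ge_add_one_self) auto
  also have "exp (c * x) * exp ((1 - c) * x) = exp x" by (simp add: exp_add[symmetric] algebra_simps)
  finally have b: "exp (c * x) * (1 + (1 - c) * x) \<le> exp x" .
  have "exp (c * x) = (1 - c) * (exp (c * x) * (1 - c * x)) + c * (exp (c * x) * (1 + (1 - c) * x))"
    by (simp add: algebra_simps)
  also have "\<dots> \<le> (1 - c) * 1 + c * exp x"
    using assms a b by (intro add_mono mult_left_mono) auto
  finally show ?thesis by simp
qed

lemma ennreal_mult_add_mult:
  assumes "0 \<le> a" "0 \<le> x" "0 \<le> b" "0 \<le> y"
  shows "ennreal a * ennreal x + ennreal b * ennreal y = ennreal (a * x + b * y)"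
  using assms by (simp add: ennreal_mult)

context gaussian_field
begin

sublocale PP: pair_prob_space P P ..

text \<open>
  The path between two independent copies: \<open>\<theta> = 0\<close> gives the second copy and \<open>\<theta> = pi/2\<close> the first.
\<close>
definition rotated :: "real \<Rightarrow> 's \<Rightarrow> 'w \<times> 'w \<Rightarrow> real" where
  "rotated \<theta> s \<omega> = sin \<theta> * X s (fst \<omega>) + cos \<theta> * X s (snd \<omega>)"

definition rotated_deriv :: "real \<Rightarrow> 's \<Rightarrow> 'w \<times> 'w \<Rightarrow> real" where
  "rotated_deriv \<theta> s \<omega> = cos \<theta> * X s (fst \<omega>) - sin \<theta> * X s (snd \<omega>)"

abbreviation "P2 \<equiv> P \<Otimes>\<^sub>M P"

lemma measurable_rotated [measurable (raw)]:
  assumes [measurable]: "f \<in> measurable N \<mu>" "g \<in> measurable N P2"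
  shows "(\<lambda>x. rotated \<theta> (f x) (g x)) \<in> borel_measurable N"
    and "(\<lambda>x. rotated_deriv \<theta> (f x) (g x)) \<in> borel_measurable N"
  unfolding rotated_def rotated_deriv_def by measurable

lemma rotated_diff:
  "rotated \<theta> s \<omega> - rotated (\<theta> - \<delta>) s \<omega> = (1 - cos \<delta>) * rotated \<theta> s \<omega> + sin \<delta> * rotated_deriv \<theta> s \<omega>"
  by (simp add: rotated_def rotated_deriv_def sin_diff cos_diff algebra_simps)

text \<open>
  For each angle the rotated field is a copy of \<open>X\<close> and its derivative is an independent copy.  The
  additional index \<open>None\<close> carries the exponent by which the system will be tilted.
\<close>
lemma gaussian_system_rotated:
  assumes s: "s \<in> space \<mu>"
  shows "gaussian_system P2 (insert None (Some ` space \<mu>))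
     (\<lambda>t t'. case t of
        None \<Rightarrow> (case t' of None \<Rightarrow> (\<alpha>\<^sup>2 + \<kappa>\<^sup>2) * C s s | Some u' \<Rightarrow> \<alpha> * C s u')
      | Some u \<Rightarrow> (case t' of None \<Rightarrow> \<alpha> * C u s | Some u' \<Rightarrow> C u u'))
     (\<lambda>t \<omega>. case t of None \<Rightarrow> \<alpha> * rotated \<theta> s \<omega> + \<kappa> * rotated_deriv \<theta> s \<omega> | Some u \<Rightarrow> rotated \<theta> u \<omega>)"
    (is "gaussian_system _ _ ?K ?V")
proof (rule gaussian_system_linear[OF gaussian_system_product[OF gaussian gaussian, unfolded if_cancel]])
  let ?p = "\<lambda>t k. (k :: bool, case t of None \<Rightarrow> s | Some u \<Rightarrow> u)"
  let ?b = "\<lambda>t k. case t of None \<Rightarrow> if k then \<alpha> * sin \<theta> + \<kappa> * cos \<theta> else \<alpha> * cos \<theta> - \<kappa> * sin \<theta>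
     | Some (u :: 's) \<Rightarrow> if k then sin \<theta> else cos \<theta>"
  show "finite (UNIV :: bool set)" by simp
  show "?p t k \<in> UNIV \<times> space \<mu>" if "t \<in> insert None (Some ` space \<mu>)" "k \<in> UNIV" for t k
    using that s by auto
  show "?V t \<omega> = (\<Sum>k\<in>UNIV. ?b t k * (if fst (?p t k) then X (snd (?p t k)) (fst \<omega>) else X (snd (?p t k)) (snd \<omega>)))" for t \<omega>
    by (cases t) (simp_all add: UNIV_bool rotated_def rotated_deriv_def algebra_simps)
  \<comment> \<open>The three covariances, from orthonormality of \<open>(sin \<theta>, cos \<theta>)\<close> and \<open>(cos \<theta>, - sin \<theta>)\<close>.\<close>
  have sc: "sin \<theta> * sin \<theta> + cos \<theta> * cos \<theta> = 1"
    using sin_cos_squared_add[of \<theta>] by (simp add: power2_eq_square)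
  have e1: "(\<alpha> * sin \<theta> + \<kappa> * cos \<theta>) * (\<alpha> * sin \<theta> + \<kappa> * cos \<theta>) + (\<alpha> * cos \<theta> - \<kappa> * sin \<theta>) * (\<alpha> * cos \<theta> - \<kappa> * sin \<theta>) = \<alpha>\<^sup>2 + \<kappa>\<^sup>2"
  proof -
    have "(\<alpha> * sin \<theta> + \<kappa> * cos \<theta>) * (\<alpha> * sin \<theta> + \<kappa> * cos \<theta>) + (\<alpha> * cos \<theta> - \<kappa> * sin \<theta>) * (\<alpha> * cos \<theta> - \<kappa> * sin \<theta>)
       = (\<alpha>\<^sup>2 + \<kappa>\<^sup>2) * (sin \<theta> * sin \<theta> + cos \<theta> * cos \<theta>)"
      unfolding power2_eq_square by (simp only: algebra_simps)
    then show ?thesis by (simp add: sc)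
  qed
  have e2: "(\<alpha> * sin \<theta> + \<kappa> * cos \<theta>) * sin \<theta> + (\<alpha> * cos \<theta> - \<kappa> * sin \<theta>) * cos \<theta> = \<alpha>"
  proof -
    have "(\<alpha> * sin \<theta> + \<kappa> * cos \<theta>) * sin \<theta> + (\<alpha> * cos \<theta> - \<kappa> * sin \<theta>) * cos \<theta> = \<alpha> * (sin \<theta> * sin \<theta> + cos \<theta> * cos \<theta>)"
      by (simp only: algebra_simps)
    then show ?thesis by (simp add: sc)
  qed
  have e3: "sin \<theta> * (\<alpha> * sin \<theta> + \<kappa> * cos \<theta>) + cos \<theta> * (\<alpha> * cos \<theta> - \<kappa> * sin \<theta>) = \<alpha>"
    using e2 by (simp only: mult.commute)
  have F: "(\<Sum>k\<in>UNIV. \<Sum>l\<in>UNIV. b k * b' l * (if k = l then c else 0)) = (b True * b' True + b False * b' False) * c"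
    for b b' :: "bool \<Rightarrow> real" and c
    by (simp add: UNIV_bool distrib_right)
  have FF: "(\<Sum>k\<in>UNIV. \<Sum>l\<in>UNIV. ?b t k * ?b t' l * (if fst (?p t k) = fst (?p t' l) then C (snd (?p t k)) (snd (?p t' l)) else 0))
    = (?b t True * ?b t' True + ?b t False * ?b t' False) * C (case t of None \<Rightarrow> s | Some u \<Rightarrow> u) (case t' of None \<Rightarrow> s | Some u \<Rightarrow> u)" for t t'
    unfolding fst_conv snd_conv by (rule F)
  show "?K t t' = (\<Sum>k\<in>UNIV. \<Sum>l\<in>UNIV. ?b t k * ?b t' l * (if fst (?p t k) = fst (?p t' l) then C (snd (?p t k)) (snd (?p t' l)) else 0))" for t t'
    unfolding FF by (cases t; cases t') (simp_all only: option.case if_True if_False e1 e2 e3 sc mult_1_left)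
qed

lemma gaussian_field_rotated: "gaussian_field \<mu> P2 C (rotated \<theta>) v"
proof
  obtain s where s: "s \<in> space \<mu>" using index.not_empty by auto
  show "gaussian_system P2 (space \<mu>) C (rotated \<theta>)"
    by (rule gaussian_system_reindex[OF gaussian_system_rotated[OF s, of 0 0 \<theta>], where p=Some]) auto
qed (auto simp: variance_le case_prod_beta')

text \<open>
  The derivative enters the exponent but has no covariance with the rotated field, so it
  contributes to the total mass and not to the drift.
\<close>
lemma rotated_change_of_measure:
  assumes s: "s \<in> space \<mu>" and \<Phi>: "\<Phi> \<in> borel_measurable borel"
  shows "(\<integral>\<^sup>+\<omega>. ennreal (exp (\<alpha> * rotated \<theta> s \<omega> + \<kappa> * rotated_deriv \<theta> s \<omega>)) * \<Phi> (\<integral>t. exp (rotated \<theta> t \<omega>) \<partial>\<mu>) \<partial>P2)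
    = ennreal (exp ((\<alpha>\<^sup>2 + \<kappa>\<^sup>2) * C s s / 2)) * (\<integral>\<^sup>+\<omega>. \<Phi> (\<integral>t. exp (\<alpha> * C s t) * exp (X t \<omega>) \<partial>\<mu>) \<partial>P)"
  using gaussian_change_of_measure[OF gaussian_system_rotated[OF s, of \<alpha> \<kappa> \<theta>], of None \<mu> Some P C X v \<Phi>]
    gaussian_field_axioms measurable_covariance[OF s] \<Phi>
  by (simp add: case_prod_beta')

text \<open>
  The previous lemma is used twice, the second time at \<open>\<theta> = pi/2\<close> and \<open>\<kappa> = 0\<close>, where the rotated field is the
  original field.  Both times the drifted partition function has the same law, so only the total masses differ.
\<close>
lemma rotated_change_of_measure':
  assumes s: "s \<in> space \<mu>" and \<Phi>[measurable]: "\<Phi> \<in> borel_measurable borel"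
  shows "(\<integral>\<^sup>+\<omega>. ennreal (exp (\<alpha> * rotated \<theta> s \<omega> + \<kappa> * rotated_deriv \<theta> s \<omega>)) * \<Phi> (\<integral>t. exp (rotated \<theta> t \<omega>) \<partial>\<mu>) \<partial>P2)
    = ennreal (exp (\<kappa>\<^sup>2 * C s s / 2)) * (\<integral>\<^sup>+\<omega>. ennreal (exp (\<alpha> * X s \<omega>)) * \<Phi> (\<integral>t. exp (X t \<omega>) \<partial>\<mu>) \<partial>P)"
proof -
  let ?I = "\<integral>\<^sup>+\<omega>. \<Phi> (\<integral>t. exp (\<alpha> * C s t) * exp (X t \<omega>) \<partial>\<mu>) \<partial>P"
  have "(\<integral>\<^sup>+\<omega>. ennreal (exp (\<alpha> * X s (fst \<omega>))) * \<Phi> (\<integral>t. exp (X t (fst \<omega>)) \<partial>\<mu>) \<partial>P2) = ennreal (exp (\<alpha>\<^sup>2 * C s s / 2)) * ?I"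
    using rotated_change_of_measure[OF s \<Phi>, of \<alpha> "pi / 2" 0] by (simp add: rotated_def)
  moreover have "(\<integral>\<^sup>+\<omega>. ennreal (exp (\<alpha> * X s (fst \<omega>))) * \<Phi> (\<integral>t. exp (X t (fst \<omega>)) \<partial>\<mu>) \<partial>P2)
      = (\<integral>\<^sup>+\<omega>. ennreal (exp (\<alpha> * X s \<omega>)) * \<Phi> (\<integral>t. exp (X t \<omega>) \<partial>\<mu>) \<partial>P)"
    using s by (subst P.nn_integral_fst[symmetric]) (auto simp: P.emeasure_space_1)
  ultimately show ?thesis
    unfolding rotated_change_of_measure[OF s \<Phi>]
    by (simp add: mult.assoc[symmetric] ennreal_mult[symmetric] exp_add[symmetric] distrib_right add_divide_distrib add.commute)
qed

definition inverse_partition :: "'w \<Rightarrow> ennreal" where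
  "inverse_partition \<omega> = ennreal (1 / (\<integral>s. exp (X s \<omega>) \<partial>\<mu>))"

lemma measurable_inverse_partition [measurable]: "inverse_partition \<in> borel_measurable P"
  unfolding inverse_partition_def by measurable

lemma AE_partition_pos: "AE \<omega> in P. 0 < (\<integral>s. exp (X s \<omega>) \<partial>\<mu>)"
  using AE_integrable_exp[of 1] AE_integrable_exp[of "-1"]
  by eventually_elim (auto intro: inverse_integral_exp_le(1)[OF index.prob_space_axioms])

text \<open>
  A crude bound: the inverse partition function is at most the integral of \<open>exp (- X)\<close>, and
  \<open>2 a b \<le> a\<^sup>2 + b\<^sup>2\<close>.  Only its finiteness matters, because it will be multiplied by a factor that tends
  to \<open>0\<close>.
\<close>
lemma moment_ratio_bound:
  "(\<integral>\<^sup>+\<omega>. \<integral>\<^sup>+s. ennreal (exp (2 * X s \<omega>)) * inverse_partition \<omega> \<partial>\<mu> \<partial>P) \<le> ennreal ((exp (8 * v) + exp (2 * v)) / 2)"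
proof -
  have "AE \<omega> in P. (\<integral>\<^sup>+s. ennreal (exp (2 * X s \<omega>)) * inverse_partition \<omega> \<partial>\<mu>)
      \<le> ennreal (1/2) * (\<integral>\<^sup>+s. ennreal (exp (4 * X s \<omega>)) \<partial>\<mu>) + ennreal (1/2) * (\<integral>\<^sup>+s. ennreal (exp (- 2 * X s \<omega>)) \<partial>\<mu>)"
    using AE_integrable_exp[of 1] AE_integrable_exp[of "-1"] AE_space
  proof eventually_elim
    case (elim \<omega>)
    note [measurable] = measurable_section[OF elim(3)]
    have "inverse_partition \<omega> \<le> ennreal (\<integral>t. exp (- X t \<omega>) \<partial>\<mu>)"
      unfolding inverse_partition_def using elim(1,2)
      by (intro ennreal_leI inverse_integral_exp_le(2)[OF index.prob_space_axioms]) auto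
    also have "\<dots> = (\<integral>\<^sup>+t. ennreal (exp (- X t \<omega>)) \<partial>\<mu>)"
      using elim(2) by (intro nn_integral_eq_integral[symmetric]) auto
    finally have i: "inverse_partition \<omega> \<le> (\<integral>\<^sup>+t. ennreal (exp (- X t \<omega>)) \<partial>\<mu>)" .
    have le: "exp (2 * a) * exp (- b) \<le> 1/2 * exp (4 * a) + 1/2 * exp (- 2 * b)" for a b :: real
    proof -
      have "0 \<le> (exp (2 * a) - exp (- b))\<^sup>2" by simp
      also have "\<dots> = exp (4 * a) + exp (- 2 * b) - 2 * (exp (2 * a) * exp (- b))"
        by (simp add: power2_eq_square algebra_simps exp_add[symmetric])
      finally show ?thesis by simp
    qed
    have "(\<integral>\<^sup>+s. ennreal (exp (2 * X s \<omega>)) * inverse_partition \<omega> \<partial>\<mu>)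
        \<le> (\<integral>\<^sup>+s. ennreal (exp (2 * X s \<omega>)) * (\<integral>\<^sup>+t. ennreal (exp (- X t \<omega>)) \<partial>\<mu>) \<partial>\<mu>)"
      by (intro nn_integral_mono mult_left_mono i) auto
    also have "\<dots> = (\<integral>\<^sup>+s. \<integral>\<^sup>+t. ennreal (exp (2 * X s \<omega>) * exp (- X t \<omega>)) \<partial>\<mu> \<partial>\<mu>)"
      by (simp add: nn_integral_cmult[symmetric] ennreal_mult)
    also have "\<dots> \<le> (\<integral>\<^sup>+s. \<integral>\<^sup>+t. ennreal (1/2 * exp (4 * X s \<omega>) + 1/2 * exp (- 2 * X t \<omega>)) \<partial>\<mu> \<partial>\<mu>)"
      by (intro nn_integral_mono ennreal_leI le)
    also have "\<dots> = (\<integral>\<^sup>+s. \<integral>\<^sup>+t. ennreal (1/2) * ennreal (exp (4 * X s \<omega>)) + ennreal (1/2) * ennreal (exp (- 2 * X t \<omega>)) \<partial>\<mu> \<partial>\<mu>)"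
      by (intro nn_integral_cong ennreal_mult_add_mult[symmetric]) auto
    also have "\<dots> = ennreal (1/2) * (\<integral>\<^sup>+s. ennreal (exp (4 * X s \<omega>)) \<partial>\<mu>) + ennreal (1/2) * (\<integral>\<^sup>+s. ennreal (exp (- 2 * X s \<omega>)) \<partial>\<mu>)"
      by (simp add: nn_integral_add nn_integral_cmult index.emeasure_space_1)
    finally show ?case .
  qed
  then have "(\<integral>\<^sup>+\<omega>. \<integral>\<^sup>+s. ennreal (exp (2 * X s \<omega>)) * inverse_partition \<omega> \<partial>\<mu> \<partial>P)
      \<le> (\<integral>\<^sup>+\<omega>. ennreal (1/2) * (\<integral>\<^sup>+s. ennreal (exp (4 * X s \<omega>)) \<partial>\<mu>) + ennreal (1/2) * (\<integral>\<^sup>+s. ennreal (exp (- 2 * X s \<omega>)) \<partial>\<mu>) \<partial>P)"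
    by (rule nn_integral_mono_AE)
  also have "\<dots> = ennreal (1/2) * (\<integral>\<^sup>+\<omega>. \<integral>\<^sup>+s. ennreal (exp (4 * X s \<omega>)) \<partial>\<mu> \<partial>P) + ennreal (1/2) * (\<integral>\<^sup>+\<omega>. \<integral>\<^sup>+s. ennreal (exp (- 2 * X s \<omega>)) \<partial>\<mu> \<partial>P)"
    by (simp add: nn_integral_add nn_integral_cmult)
  also have "\<dots> \<le> ennreal (1/2) * ennreal (exp (8 * v)) + ennreal (1/2) * ennreal (exp (2 * v))"
    using nn_integral_exp_le[of 4] nn_integral_exp_le[of "-2"] by (intro add_mono mult_left_mono) auto
  also have "\<dots> = ennreal (1/2 * exp (8 * v) + 1/2 * exp (2 * v))"
    by (rule ennreal_mult_add_mult) auto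
  also have "1/2 * exp (8 * v) + 1/2 * exp (2 * v) = (exp (8 * v) + exp (2 * v)) / 2"
    by simp
  finally show ?thesis .
qed

text \<open>
  Interpolation between the Gibbs average of \<open>1\<close> at \<open>c = 0\<close> and the previous bound at \<open>c = 1\<close>.
\<close>
lemma tilted_average_bound:
  assumes c: "0 \<le> c" "c \<le> 1"
  shows "(\<integral>\<^sup>+\<omega>. \<integral>\<^sup>+s. ennreal (exp ((1 + c) * X s \<omega>)) * inverse_partition \<omega> \<partial>\<mu> \<partial>P) \<le> ennreal (1 + c * ((exp (8 * v) + exp (2 * v)) / 2))"
proof -
  have "AE \<omega> in P. (\<integral>\<^sup>+s. ennreal (exp ((1 + c) * X s \<omega>)) * inverse_partition \<omega> \<partial>\<mu>)
      \<le> 1 + ennreal c * (\<integral>\<^sup>+s. ennreal (exp (2 * X s \<omega>)) * inverse_partition \<omega> \<partial>\<mu>)"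
    using AE_integrable_exp[of 1] AE_partition_pos AE_space
  proof eventually_elim
    case (elim \<omega>)
    note [measurable] = measurable_section[OF elim(3)]
    have le: "exp ((1 + c) * x) \<le> exp x + c * exp (2 * x)" for x
    proof -
      have "exp ((1 + c) * x) = exp x * exp (c * x)" by (simp add: exp_add[symmetric] algebra_simps)
      also have "\<dots> \<le> exp x * (1 - c + c * exp x)" by (intro mult_left_mono exp_mult_le_affine c) auto
      also have "\<dots> \<le> exp x + c * exp (2 * x)" using c by (simp add: algebra_simps exp_add[symmetric])
      finally show ?thesis .
    qed
    have "(\<integral>\<^sup>+s. ennreal (exp ((1 + c) * X s \<omega>)) * inverse_partition \<omega> \<partial>\<mu>)
        \<le> (\<integral>\<^sup>+s. ennreal (exp (X s \<omega>) + c * exp (2 * X s \<omega>)) * inverse_partition \<omega> \<partial>\<mu>)"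
      by (intro nn_integral_mono mult_right_mono ennreal_leI le) auto
    also have "\<dots> = (\<integral>\<^sup>+s. ennreal (exp (X s \<omega>)) * inverse_partition \<omega> + ennreal c * (ennreal (exp (2 * X s \<omega>)) * inverse_partition \<omega>) \<partial>\<mu>)"
      using c by (intro nn_integral_cong) (simp add: ennreal_mult distrib_right mult.assoc)
    also have "\<dots> = (\<integral>\<^sup>+s. ennreal (exp (X s \<omega>)) \<partial>\<mu>) * inverse_partition \<omega> + ennreal c * (\<integral>\<^sup>+s. ennreal (exp (2 * X s \<omega>)) * inverse_partition \<omega> \<partial>\<mu>)"
      by (simp add: nn_integral_add nn_integral_cmult nn_integral_multc)
    also have "(\<integral>\<^sup>+s. ennreal (exp (X s \<omega>)) \<partial>\<mu>) * inverse_partition \<omega> = 1"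
      using elim(1,2) by (subst nn_integral_eq_integral) (auto simp: inverse_partition_def ennreal_mult[symmetric])
    finally show ?case .
  qed
  then have "(\<integral>\<^sup>+\<omega>. \<integral>\<^sup>+s. ennreal (exp ((1 + c) * X s \<omega>)) * inverse_partition \<omega> \<partial>\<mu> \<partial>P)
      \<le> (\<integral>\<^sup>+\<omega>. 1 + ennreal c * (\<integral>\<^sup>+s. ennreal (exp (2 * X s \<omega>)) * inverse_partition \<omega> \<partial>\<mu>) \<partial>P)"
    by (rule nn_integral_mono_AE)
  also have "\<dots> = 1 + ennreal c * (\<integral>\<^sup>+\<omega>. \<integral>\<^sup>+s. ennreal (exp (2 * X s \<omega>)) * inverse_partition \<omega> \<partial>\<mu> \<partial>P)"
    by (simp add: nn_integral_add nn_integral_cmult P.emeasure_space_1)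
  also have "\<dots> \<le> 1 + ennreal c * ennreal ((exp (8 * v) + exp (2 * v)) / 2)"
    by (intro add_left_mono mult_left_mono moment_ratio_bound) auto
  also have "\<dots> = ennreal (1 + c * ((exp (8 * v) + exp (2 * v)) / 2))"
  proof -
    have "0 \<le> (exp (8 * v) + exp (2 * v)) / 2" by (simp add: add_nonneg_nonneg)
    then have "ennreal 1 * ennreal 1 + ennreal c * ennreal ((exp (8 * v) + exp (2 * v)) / 2) = ennreal (1 * 1 + c * ((exp (8 * v) + exp (2 * v)) / 2))"
      using c by (intro ennreal_mult_add_mult) auto
    then show ?thesis by (simp only: ennreal_1 mult_1_left)
  qed
  finally show ?thesis .
qed

end

context gaussian_field
begin

text \<open>
  The expectation of the Gibbs average that dominates one step of the path.
\<close>
lemma rotated_step_bound: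
  assumes c: "0 \<le> c" "c \<le> 1"
  shows "(\<integral>\<^sup>+\<omega>. \<integral>\<^sup>+s. ennreal (exp ((1 + c) * rotated \<theta> s \<omega> + \<kappa> * rotated_deriv \<theta> s \<omega>)) * ennreal (1 / (\<integral>t. exp (rotated \<theta> t \<omega>) \<partial>\<mu>)) \<partial>\<mu> \<partial>P2)
    \<le> ennreal (exp (\<kappa>\<^sup>2 * v / 2)) * ennreal (1 + c * ((exp (8 * v) + exp (2 * v)) / 2))"
proof -
  interpret MR: pair_prob_space \<mu> P2 ..
  have "(\<integral>\<^sup>+\<omega>. \<integral>\<^sup>+s. ennreal (exp ((1 + c) * rotated \<theta> s \<omega> + \<kappa> * rotated_deriv \<theta> s \<omega>)) * ennreal (1 / (\<integral>t. exp (rotated \<theta> t \<omega>) \<partial>\<mu>)) \<partial>\<mu> \<partial>P2)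
    = (\<integral>\<^sup>+s. \<integral>\<^sup>+\<omega>. ennreal (exp ((1 + c) * rotated \<theta> s \<omega> + \<kappa> * rotated_deriv \<theta> s \<omega>)) * ennreal (1 / (\<integral>t. exp (rotated \<theta> t \<omega>) \<partial>\<mu>)) \<partial>P2 \<partial>\<mu>)"
    by (rule MR.Fubini') measurable
  also have "\<dots> = (\<integral>\<^sup>+s. ennreal (exp (\<kappa>\<^sup>2 * C s s / 2)) * (\<integral>\<^sup>+\<omega>. ennreal (exp ((1 + c) * X s \<omega>)) * inverse_partition \<omega> \<partial>P) \<partial>\<mu>)"
    unfolding inverse_partition_def
    by (intro nn_integral_cong rotated_change_of_measure'[where \<Phi>="\<lambda>z. ennreal (1 / z)"]) auto
  also have "\<dots> \<le> (\<integral>\<^sup>+s. ennreal (exp (\<kappa>\<^sup>2 * v / 2)) * (\<integral>\<^sup>+\<omega>. ennreal (exp ((1 + c) * X s \<omega>)) * inverse_partition \<omega> \<partial>P) \<partial>\<mu>)"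
    by (intro nn_integral_mono mult_right_mono) (auto simp: mult_left_mono variance_le)
  also have "\<dots> = ennreal (exp (\<kappa>\<^sup>2 * v / 2)) * (\<integral>\<^sup>+s. \<integral>\<^sup>+\<omega>. ennreal (exp ((1 + c) * X s \<omega>)) * inverse_partition \<omega> \<partial>P \<partial>\<mu>)"
    by (rule nn_integral_cmult) measurable
  also have "(\<integral>\<^sup>+s. \<integral>\<^sup>+\<omega>. ennreal (exp ((1 + c) * X s \<omega>)) * inverse_partition \<omega> \<partial>P \<partial>\<mu>)
      = (\<integral>\<^sup>+\<omega>. \<integral>\<^sup>+s. ennreal (exp ((1 + c) * X s \<omega>)) * inverse_partition \<omega> \<partial>\<mu> \<partial>P)"
    by (rule PS.Fubini'[symmetric]) measurable
  also have "ennreal (exp (\<kappa>\<^sup>2 * v / 2)) * \<dots> \<le> ennreal (exp (\<kappa>\<^sup>2 * v / 2)) * ennreal (1 + c * ((exp (8 * v) + exp (2 * v)) / 2))"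
    by (intro mult_left_mono tilted_average_bound c) auto
  finally show ?thesis .
qed

text \<open>
  The quarter circle is divided into \<open>n\<close> steps of angle \<open>\<delta>\<close>.  The exponential of the sum of the increments is
  at most the average of the exponentials of \<open>n\<close> times each increment.  A step of the field is
  \<open>(1 - cos \<delta>)\<close> times the field plus \<open>sin \<delta>\<close> times the derivative; after multiplication by \<open>\<tau> n\<close> the first
  coefficient is \<open>O(1/n)\<close> and the second is at most \<open>2 \<tau>\<close>.
\<close>
lemma exp_difference_bound_discrete:
  fixes n :: nat
  assumes n: "0 < n" "2 * \<tau> \<le> real n" and \<tau>: "0 < \<tau>"
  shows "(\<integral>\<^sup>+\<omega>. ennreal (exp (\<tau> * (log_partition (fst \<omega>) - log_partition (snd \<omega>)))) \<partial>P2)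
    \<le> ennreal (exp (2 * \<tau>\<^sup>2 * v) * (1 + 2 * \<tau> / real n * ((exp (8 * v) + exp (2 * v)) / 2)))"
proof -
  define K where "K = (exp (8 * v) + exp (2 * v)) / 2"
  define \<delta> where "\<delta> = pi / (2 * real n)"
  define m where "m = \<tau> * real n"
  define c where "c = m * (1 - cos \<delta>)"
  define \<kappa> where "\<kappa> = m * sin \<delta>"
  define V where "V = (\<lambda>k \<omega>. ln (\<integral>s. exp (rotated (real k * \<delta>) s \<omega>) \<partial>\<mu>))"
  define G where "G = (\<lambda>k \<omega>. \<integral>\<^sup>+s. ennreal (exp ((1 + c) * rotated (real (Suc k) * \<delta>) s \<omega> + \<kappa> * rotated_deriv (real (Suc k) * \<delta>) s \<omega>)) * ennreal (1 / (\<integral>t. exp (rotated (real (Suc k) * \<delta>) t \<omega>) \<partial>\<mu>)) \<partial>\<mu>)"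
  have K: "0 \<le> K" by (simp add: K_def add_nonneg_nonneg)
  have m: "0 < m" using n \<tau> by (simp add: m_def)
  have \<delta>: "0 < \<delta>" "\<delta> * real n = pi / 2" using n by (auto simp: \<delta>_def)
  have sin_le: "\<bar>sin x\<bar> \<le> \<bar>x\<bar>" for x :: real by (rule abs_sin_x_le_abs_x)
  have \<kappa>: "\<kappa>\<^sup>2 \<le> 4 * \<tau>\<^sup>2"
  proof -
    have "\<bar>\<kappa>\<bar> \<le> m * \<delta>" unfolding \<kappa>_def using m sin_le[of \<delta>] \<delta> by (simp add: abs_mult)
    also have "\<dots> = \<tau> * (pi / 2)" using \<delta>(2) by (simp add: m_def mult.assoc mult.commute)
    also have "\<dots> \<le> \<tau> * 2" using \<tau> pi_less_4 by (intro mult_left_mono) auto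
    finally have "\<bar>\<kappa>\<bar>\<^sup>2 \<le> (\<tau> * 2)\<^sup>2" by (rule power_mono) simp
    then show ?thesis by (simp add: power_mult_distrib)
  qed
  have c: "0 \<le> c" "c \<le> 2 * \<tau> / real n"
  proof -
    show "0 \<le> c" using m by (simp add: c_def)
    have "1 - cos \<delta> = 2 * (sin (\<delta> / 2))\<^sup>2" using cos_double_sin[of "\<delta> / 2"] by simp
    also have "\<dots> \<le> 2 * (\<delta> / 2)\<^sup>2"
      using power_mono[OF sin_le[of "\<delta> / 2"], of 2] by (simp add: power_divide)
    finally have "c \<le> m * (2 * (\<delta> / 2)\<^sup>2)" unfolding c_def using m by (intro mult_left_mono) auto
    also have "m * (2 * (\<delta> / 2)\<^sup>2) = \<tau> * (\<delta> * real n)\<^sup>2 / (2 * real n)"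
      using n by (simp add: m_def power2_eq_square field_simps)
    also have "\<dots> \<le> \<tau> * 2\<^sup>2 / (2 * real n)"
      unfolding \<delta>(2) using \<tau> n pi_less_4 pi_gt_zero by (intro divide_right_mono mult_left_mono power_mono) auto
    also have "\<dots> = 2 * \<tau> / real n" by simp
    finally show "c \<le> 2 * \<tau> / real n" .
  qed
  have "2 * \<tau> / real n \<le> 1" using n by simp
  then have c1: "c \<le> 1" using c(2) by simp
  have AE_all: "AE \<omega> in P2. \<forall>k. integrable \<mu> (\<lambda>s. exp (rotated (real k * \<delta>) s \<omega>)) \<and> 0 < (\<integral>s. exp (rotated (real k * \<delta>) s \<omega>) \<partial>\<mu>)"
  proof (rule AE_all_countable[THEN iffD2], rule allI)
    fix k
    interpret rot: gaussian_field \<mu> P2 C "rotated (real k * \<delta>)" v by (rule gaussian_field_rotated)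
    show "AE \<omega> in P2. integrable \<mu> (\<lambda>s. exp (rotated (real k * \<delta>) s \<omega>)) \<and> 0 < (\<integral>s. exp (rotated (real k * \<delta>) s \<omega>) \<partial>\<mu>)"
      using rot.AE_integrable_exp[of 1] rot.AE_partition_pos by eventually_elim simp
  qed
  have "AE \<omega> in P2. ennreal (exp (\<tau> * (log_partition (fst \<omega>) - log_partition (snd \<omega>)))) \<le> (\<Sum>k<n. ennreal (1 / real n) * G k \<omega>)"
    using AE_all
  proof eventually_elim
    case (elim \<omega>)
    have nd: "real n * \<delta> = pi / 2" using \<delta>(2) by (simp only: mult.commute)
    have "rotated (real n * \<delta>) s \<omega> = X s (fst \<omega>)" "rotated (real 0 * \<delta>) s \<omega> = X s (snd \<omega>)" for s
      unfolding rotated_def nd by simp_all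
    then have "log_partition (fst \<omega>) - log_partition (snd \<omega>) = V n \<omega> - V 0 \<omega>"
      by (simp only: V_def log_partition_def)
    also have "\<dots> = (\<Sum>k<n. V (Suc k) \<omega> - V k \<omega>)" by (rule sum_lessThan_telescope[symmetric])
    finally have "exp (\<tau> * (log_partition (fst \<omega>) - log_partition (snd \<omega>))) = exp (\<Sum>k<n. \<tau> * (V (Suc k) \<omega> - V k \<omega>))"
      by (simp add: sum_distrib_left)
    also have "\<dots> \<le> (\<Sum>k<n. exp (real n * (\<tau> * (V (Suc k) \<omega> - V k \<omega>)))) / real n"
      by (rule exp_sum_le_average[OF n(1)])
    also have "\<dots> = (\<Sum>k<n. 1 / real n * exp (m * (V (Suc k) \<omega> - V k \<omega>)))"
      by (simp add: m_def sum_divide_distrib ac_simps)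
    finally have "ennreal (exp (\<tau> * (log_partition (fst \<omega>) - log_partition (snd \<omega>)))) \<le> ennreal (\<Sum>k<n. 1 / real n * exp (m * (V (Suc k) \<omega> - V k \<omega>)))"
      by (rule ennreal_leI)
    also have "\<dots> = (\<Sum>k<n. ennreal (1 / real n) * ennreal (exp (m * (V (Suc k) \<omega> - V k \<omega>))))"
    proof -
      have "(\<Sum>k<n. ennreal (1 / real n) * ennreal (exp (m * (V (Suc k) \<omega> - V k \<omega>)))) = (\<Sum>k<n. ennreal (1 / real n * exp (m * (V (Suc k) \<omega> - V k \<omega>))))"
        by (intro sum.cong refl ennreal_mult[symmetric]) auto
      also have "\<dots> = ennreal (\<Sum>k<n. 1 / real n * exp (m * (V (Suc k) \<omega> - V k \<omega>)))"
        by (rule sum_ennreal) auto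
      finally show ?thesis ..
    qed
    also have "\<dots> \<le> (\<Sum>k<n. ennreal (1 / real n) * G k \<omega>)"
    proof (intro sum_mono mult_left_mono)
      fix k
      let ?x = "\<lambda>s. rotated (real (Suc k) * \<delta>) s \<omega>" and ?y = "\<lambda>s. rotated (real k * \<delta>) s \<omega>"
      have y: "?y s = rotated (real (Suc k) * \<delta> - \<delta>) s \<omega>" for s by (simp add: algebra_simps)
      have e: "?x s + m * (?x s - ?y s) = (1 + c) * rotated (real (Suc k) * \<delta>) s \<omega> + \<kappa> * rotated_deriv (real (Suc k) * \<delta>) s \<omega>" for s
        unfolding y rotated_diff c_def \<kappa>_def by (simp add: distrib_left distrib_right mult.assoc)
      have "ennreal (exp (m * (V (Suc k) \<omega> - V k \<omega>))) \<le> (\<integral>\<^sup>+s. ennreal (exp (?x s + m * (?x s - ?y s))) * ennreal (1 / (\<integral>s. exp (?x s) \<partial>\<mu>)) \<partial>\<mu>)"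
        unfolding V_def using elim m
        by (intro partition_ratio_powr_le[OF index.prob_space_axioms]) (auto simp del: of_nat_Suc)
      then show "ennreal (exp (m * (V (Suc k) \<omega> - V k \<omega>))) \<le> G k \<omega>"
        unfolding e G_def .
    qed simp
    finally show ?case .
  qed
  then have "(\<integral>\<^sup>+\<omega>. ennreal (exp (\<tau> * (log_partition (fst \<omega>) - log_partition (snd \<omega>)))) \<partial>P2) \<le> (\<integral>\<^sup>+\<omega>. (\<Sum>k<n. ennreal (1 / real n) * G k \<omega>) \<partial>P2)"
    by (rule nn_integral_mono_AE)
  also have "\<dots> = (\<Sum>k<n. ennreal (1 / real n) * (\<integral>\<^sup>+\<omega>. G k \<omega> \<partial>P2))"
  proof -
    have [measurable]: "G k \<in> borel_measurable P2" for k unfolding G_def by measurable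
    show ?thesis by (simp add: nn_integral_sum nn_integral_cmult)
  qed
  also have "\<dots> \<le> (\<Sum>k<n. ennreal (1 / real n) * (ennreal (exp (\<kappa>\<^sup>2 * v / 2)) * ennreal (1 + c * K)))"
    unfolding G_def K_def by (intro sum_mono mult_left_mono rotated_step_bound c c1) auto
  also have "\<dots> = ennreal (exp (\<kappa>\<^sup>2 * v / 2)) * ennreal (1 + c * K)"
  proof -
    have "(\<Sum>k<n. ennreal (1 / real n) * x) = x" for x
    proof -
      have "(\<Sum>k<n. ennreal (1 / real n) * x) = (\<Sum>k<n. ennreal (1 / real n)) * x" by (simp only: sum_distrib_right)
      also have "(\<Sum>k<n. ennreal (1 / real n)) = 1" using n by (subst sum_ennreal) auto
      finally show ?thesis by simp
    qed
    then show ?thesis .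
  qed
  also have "\<dots> \<le> ennreal (exp (2 * \<tau>\<^sup>2 * v)) * ennreal (1 + 2 * \<tau> / real n * K)"
  proof (intro mult_mono ennreal_leI)
    show "exp (\<kappa>\<^sup>2 * v / 2) \<le> exp (2 * \<tau>\<^sup>2 * v)" using mult_right_mono[OF \<kappa> variance_bound_nonneg] by simp
    show "1 + c * K \<le> 1 + 2 * \<tau> / real n * K" using mult_right_mono[OF c(2) K] by simp
  qed auto
  also have "\<dots> = ennreal (exp (2 * \<tau>\<^sup>2 * v) * (1 + 2 * \<tau> / real n * K))"
    using K \<tau> by (intro ennreal_mult[symmetric]) auto
  finally show ?thesis unfolding K_def .
qed

lemma exp_difference_bound:
  assumes \<tau>: "0 < \<tau>"
  shows "(\<integral>\<^sup>+\<omega>. ennreal (exp (\<tau> * (log_partition (fst \<omega>) - log_partition (snd \<omega>)))) \<partial>P2) \<le> ennreal (exp (2 * \<tau>\<^sup>2 * v))"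
proof -
  let ?K = "(exp (8 * v) + exp (2 * v)) / 2"
  have "(\<lambda>n. exp (2 * \<tau>\<^sup>2 * v) * (1 + 2 * \<tau> * (1 / real n) * ?K)) \<longlonglongrightarrow> exp (2 * \<tau>\<^sup>2 * v) * (1 + 2 * \<tau> * 0 * ?K)"
    by (intro tendsto_intros lim_1_over_n)
  then have "(\<lambda>n. ennreal (exp (2 * \<tau>\<^sup>2 * v) * (1 + 2 * \<tau> / real n * ?K))) \<longlonglongrightarrow> ennreal (exp (2 * \<tau>\<^sup>2 * v))"
    by (intro tendsto_ennrealI) simp
  then show ?thesis
  proof (rule LIMSEQ_le_const)
    show "\<exists>N. \<forall>n\<ge>N. (\<integral>\<^sup>+\<omega>. ennreal (exp (\<tau> * (log_partition (fst \<omega>) - log_partition (snd \<omega>)))) \<partial>P2)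
       \<le> ennreal (exp (2 * \<tau>\<^sup>2 * v) * (1 + 2 * \<tau> / real n * ?K))"
      using \<tau> by (intro exI[of _ "Suc (nat \<lceil>2 * \<tau>\<rceil>)"] allI impI exp_difference_bound_discrete) linarith+
  qed
qed

lemma integrable_log_partition: "integrable P log_partition"
proof (rule Bochner_Integration.integrable_bound)
  let ?g = "\<lambda>\<omega>. (\<integral>s. exp (1 * X s \<omega>) \<partial>\<mu>) + (\<integral>s. exp (-1 * X s \<omega>) \<partial>\<mu>)"
  have "integrable P (\<lambda>\<omega>. \<integral>s. exp (c * X s \<omega>) \<partial>\<mu>)" for c
  proof (rule integrableI_nonneg)
    have "(\<integral>\<^sup>+\<omega>. ennreal (\<integral>s. exp (c * X s \<omega>) \<partial>\<mu>) \<partial>P) = (\<integral>\<^sup>+\<omega>. \<integral>\<^sup>+s. ennreal (exp (c * X s \<omega>)) \<partial>\<mu> \<partial>P)"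
      using AE_integrable_exp[of c]
      by (intro nn_integral_cong_AE, eventually_elim) (subst nn_integral_eq_integral, auto)
    also have "\<dots> < \<infinity>" using nn_integral_exp_le[of c] by (rule order_le_less_trans) simp
    finally show "(\<integral>\<^sup>+\<omega>. ennreal (\<integral>s. exp (c * X s \<omega>) \<partial>\<mu>) \<partial>P) < \<infinity>" .
  qed auto
  then show "integrable P ?g" by (intro Bochner_Integration.integrable_add)
  show "AE \<omega> in P. norm (log_partition \<omega>) \<le> norm (?g \<omega>)"
    using AE_integrable_exp[of 1] AE_integrable_exp[of "-1"]
  proof eventually_elim
    case (elim \<omega>)
    then have z: "0 < (\<integral>s. exp (X s \<omega>) \<partial>\<mu>)" "1 / (\<integral>s. exp (X s \<omega>) \<partial>\<mu>) \<le> (\<integral>s. exp (- X s \<omega>) \<partial>\<mu>)"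
      using inverse_integral_exp_le[OF index.prob_space_axioms, of "\<lambda>s. X s \<omega>"] by auto
    have "log_partition \<omega> \<le> (\<integral>s. exp (X s \<omega>) \<partial>\<mu>)"
      unfolding log_partition_def using z(1) ln_le_minus_one[of "\<integral>s. exp (X s \<omega>) \<partial>\<mu>"] by linarith
    moreover have "- log_partition \<omega> \<le> (\<integral>s. exp (- X s \<omega>) \<partial>\<mu>)"
      unfolding log_partition_def using z ln_le_minus_one[of "1 / (\<integral>s. exp (X s \<omega>) \<partial>\<mu>)"] by (simp add: ln_div)
    moreover have "norm x \<le> norm (p + q)" if "x \<le> p" "- x \<le> q" "0 < p" "0 \<le> q" for x p q :: real
      using that by auto
    ultimately have "norm (log_partition \<omega>) \<le> norm ((\<integral>s. exp (X s \<omega>) \<partial>\<mu>) + (\<integral>s. exp (- X s \<omega>) \<partial>\<mu>))"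
      using z(1) by (meson exp_ge_zero Bochner_Integration.integral_nonneg)
    then show ?case by simp
  qed
qed simp

lemma jensen_exp_log_partition:
  "ennreal (exp (c * (\<integral>\<omega>. log_partition \<omega> \<partial>P))) \<le> (\<integral>\<^sup>+\<omega>. ennreal (exp (c * log_partition \<omega>)) \<partial>P)"
proof -
  let ?m = "\<integral>\<omega>. log_partition \<omega> \<partial>P"
  let ?g = "\<lambda>\<omega>. exp (c * ?m) * (1 + c * (log_partition \<omega> - ?m))"
  have le: "?g \<omega> \<le> exp (c * log_partition \<omega>)" for \<omega>
  proof -
    have "?g \<omega> \<le> exp (c * ?m) * exp (c * (log_partition \<omega> - ?m))"
      by (intro mult_left_mono exp_ge_add_one_self) auto
    then show ?thesis by (simp add: exp_add[symmetric] algebra_simps)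
  qed
  have "exp (c * ?m) = (\<integral>\<omega>. ?g \<omega> \<partial>P)"
    using integrable_log_partition by (simp add: P.prob_space)
  then have "ennreal (exp (c * ?m)) = ennreal (\<integral>\<omega>. ?g \<omega> \<partial>P)" by (rule arg_cong)
  also have "\<dots> \<le> (\<integral>\<^sup>+\<omega>. ennreal (?g \<omega>) \<partial>P)"
    using integrable_log_partition by (intro ennreal_integral_le_nn_integral) auto
  also have "\<dots> \<le> (\<integral>\<^sup>+\<omega>. ennreal (exp (c * log_partition \<omega>)) \<partial>P)"
    by (intro nn_integral_mono ennreal_leI le)
  finally show ?thesis .
qed

text \<open>
  By independence of the two copies the exponential moment of the difference factorises, and
  the factor of the opposite sign is bounded below by Jensen's inequality.
\<close>
lemma exp_centered_bound:
  assumes \<tau>: "0 < \<tau>" and e: "e = 1 \<or> e = -1"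
  shows "(\<integral>\<^sup>+\<omega>. ennreal (exp (\<tau> * (e * (log_partition \<omega> - (\<integral>\<omega>. log_partition \<omega> \<partial>P))))) \<partial>P) \<le> ennreal (exp (2 * \<tau>\<^sup>2 * v))"
proof -
  let ?m = "\<integral>\<omega>. log_partition \<omega> \<partial>P"
  let ?E = "\<lambda>c. \<integral>\<^sup>+\<omega>. ennreal (exp (c * log_partition \<omega>)) \<partial>P"
  have prod: "?E \<tau> * ?E (- \<tau>) \<le> ennreal (exp (2 * \<tau>\<^sup>2 * v))"
  proof -
    have "?E \<tau> * ?E (- \<tau>) = (\<integral>\<^sup>+x. \<integral>\<^sup>+y. ennreal (exp (\<tau> * log_partition x)) * ennreal (exp (- \<tau> * log_partition y)) \<partial>P \<partial>P)"
      by (simp add: nn_integral_cmult nn_integral_multc)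
    also have "\<dots> = (\<integral>\<^sup>+x. \<integral>\<^sup>+y. ennreal (exp (\<tau> * (log_partition x - log_partition y))) \<partial>P \<partial>P)"
      by (simp add: ennreal_mult[symmetric] exp_add[symmetric] algebra_simps)
    also have "\<dots> = (\<integral>\<^sup>+\<omega>. ennreal (exp (\<tau> * (log_partition (fst \<omega>) - log_partition (snd \<omega>)))) \<partial>P2)"
      by (subst P.nn_integral_fst[symmetric]) auto
    finally show ?thesis using exp_difference_bound[OF \<tau>] by simp
  qed
  have *: "?E (e * \<tau>) * ?E (- e * \<tau>) \<le> ennreal (exp (2 * \<tau>\<^sup>2 * v))"
    using prod e by (auto simp: mult.commute)
  have "(\<integral>\<^sup>+\<omega>. ennreal (exp (\<tau> * (e * (log_partition \<omega> - ?m)))) \<partial>P) = (\<integral>\<^sup>+\<omega>. ennreal (exp (e * \<tau> * log_partition \<omega>)) * ennreal (exp (- e * \<tau> * ?m)) \<partial>P)"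
    by (intro nn_integral_cong) (simp add: ennreal_mult[symmetric] exp_add[symmetric] algebra_simps)
  also have "\<dots> = ?E (e * \<tau>) * ennreal (exp (- e * \<tau> * ?m))"
    by (rule nn_integral_multc) measurable
  also have "\<dots> \<le> ?E (e * \<tau>) * ?E (- e * \<tau>)"
    by (intro mult_left_mono jensen_exp_log_partition) auto
  finally show ?thesis using * by (rule order_trans)
qed

text \<open>
  Markov's inequality with the optimal \<open>\<tau> = u / (4 v)\<close>, for the upper and the lower tail.
\<close>
theorem log_partition_concentration:
  assumes u: "0 < u" and v: "0 < v"
  shows "measure P {\<omega> \<in> space P. u \<le> \<bar>log_partition \<omega> - (\<integral>\<omega>. log_partition \<omega> \<partial>P)\<bar>} \<le> 2 * exp (- u\<^sup>2 / (8 * v))"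
proof -
  let ?m = "\<integral>\<omega>. log_partition \<omega> \<partial>P"
  have one: "measure P {\<omega> \<in> space P. u \<le> e * (log_partition \<omega> - ?m)} \<le> exp (- u\<^sup>2 / (8 * v))"
    if e: "e = 1 \<or> e = -1" for e
  proof -
    define \<tau> where "\<tau> = u / (4 * v)"
    have \<tau>: "0 < \<tau>" using u v by (simp add: \<tau>_def)
    have "emeasure P {\<omega> \<in> space P. u \<le> e * (log_partition \<omega> - ?m)} \<le> (\<integral>\<^sup>+\<omega>. ennreal (exp (- \<tau> * u)) * ennreal (exp (\<tau> * (e * (log_partition \<omega> - ?m)))) \<partial>P)"
    proof (subst nn_integral_indicator[symmetric])
      show "(\<integral>\<^sup>+\<omega>. indicator {\<omega> \<in> space P. u \<le> e * (log_partition \<omega> - ?m)} \<omega> \<partial>P) \<le> (\<integral>\<^sup>+\<omega>. ennreal (exp (- \<tau> * u)) * ennreal (exp (\<tau> * (e * (log_partition \<omega> - ?m)))) \<partial>P)"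
      proof (intro nn_integral_mono)
        fix \<omega>
        have "1 \<le> exp (- \<tau> * u) * exp (\<tau> * (e * (log_partition \<omega> - ?m)))" if "u \<le> e * (log_partition \<omega> - ?m)"
          using mult_left_mono[OF that, of \<tau>] \<tau> by (simp add: exp_add[symmetric])
        then show "indicator {\<omega> \<in> space P. u \<le> e * (log_partition \<omega> - ?m)} \<omega> \<le> ennreal (exp (- \<tau> * u)) * ennreal (exp (\<tau> * (e * (log_partition \<omega> - ?m))))"
          by (auto simp: ennreal_mult[symmetric] split: split_indicator)
      qed
    qed measurable
    also have "\<dots> = ennreal (exp (- \<tau> * u)) * (\<integral>\<^sup>+\<omega>. ennreal (exp (\<tau> * (e * (log_partition \<omega> - ?m)))) \<partial>P)"
      by (rule nn_integral_cmult) measurable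
    also have "\<dots> \<le> ennreal (exp (- \<tau> * u)) * ennreal (exp (2 * \<tau>\<^sup>2 * v))"
      by (intro mult_left_mono exp_centered_bound[OF \<tau> e]) auto
    also have "\<dots> = ennreal (exp (- \<tau> * u + 2 * \<tau>\<^sup>2 * v))"
      by (simp add: ennreal_mult[symmetric] exp_add[symmetric])
    also have "- \<tau> * u + 2 * \<tau>\<^sup>2 * v = - u\<^sup>2 / (8 * v)"
      using v by (simp add: \<tau>_def power2_eq_square field_simps)
    finally show ?thesis by (simp add: P.emeasure_eq_measure)
  qed
  have "measure P {\<omega> \<in> space P. u \<le> \<bar>log_partition \<omega> - ?m\<bar>}
     \<le> measure P ({\<omega> \<in> space P. u \<le> 1 * (log_partition \<omega> - ?m)} \<union> {\<omega> \<in> space P. u \<le> -1 * (log_partition \<omega> - ?m)})"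
    by (intro P.finite_measure_mono) (auto simp: abs_if)
  also have "\<dots> \<le> measure P {\<omega> \<in> space P. u \<le> 1 * (log_partition \<omega> - ?m)} + measure P {\<omega> \<in> space P. u \<le> -1 * (log_partition \<omega> - ?m)}"
    by (intro measure_Un_le) measurable
  finally show ?thesis using one[of 1] one[of "-1"] by linarith
qed

end

section \<open>The Hamiltonian as a Gaussian system\<close>

text \<open>
  For distinct indices; repeated indices are collected by adding their coefficients.
\<close>
lemma gaussian_systemI:
  assumes "prob_space P" "\<And>s. s \<in> S \<Longrightarrow> X s \<in> borel_measurable P" "\<And>s t. s \<in> S \<Longrightarrow> t \<in> S \<Longrightarrow> C s t = C t s"
    and fin: "\<And>A a. finite A \<Longrightarrow> A \<subseteq> S \<Longrightarrow>
      (\<integral>\<omega>. cis (\<Sum>x\<in>A. a x * X x \<omega>) \<partial>P) = complex_of_real (exp (- (\<Sum>x\<in>A. \<Sum>y\<in>A. a x * a y * C x y) / 2))"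
  shows "gaussian_system P S C X"
  unfolding gaussian_system_def
proof (intro conjI ballI allI impI)
  fix n :: nat and a :: "nat \<Rightarrow> real" and f assume f: "\<forall>i<n. f i \<in> S"
  let ?A = "f ` {..<n}"
  define b where "b = (\<lambda>x. \<Sum>i\<in>{i \<in> {..<n}. f i = x}. a i)"
  have gen: "(\<Sum>i<n. a i * g (f i)) = (\<Sum>x\<in>?A. b x * g x)" for g :: "_ \<Rightarrow> real"
  proof -
    have "(\<Sum>i<n. a i * g (f i)) = (\<Sum>x\<in>?A. \<Sum>i\<in>{i \<in> {..<n}. f i = x}. a i * g (f i))"
      by (rule sum.image_gen) simp
    also have "\<dots> = (\<Sum>x\<in>?A. b x * g x)"
      unfolding b_def sum_distrib_right by (intro sum.cong) auto
    finally show ?thesis .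
  qed
  have "(\<Sum>i<n. \<Sum>j<n. a i * a j * C (f i) (f j)) = (\<Sum>i<n. a i * (\<Sum>j<n. a j * C (f i) (f j)))"
    by (simp add: sum_distrib_left mult.assoc)
  also have "\<dots> = (\<Sum>x\<in>?A. b x * (\<Sum>y\<in>?A. b y * C x y))"
    unfolding gen[of "\<lambda>x. C _ x"] by (rule gen)
  also have "\<dots> = (\<Sum>x\<in>?A. \<Sum>y\<in>?A. b x * b y * C x y)"
    by (simp add: sum_distrib_left mult.assoc)
  finally have q: "(\<Sum>i<n. \<Sum>j<n. a i * a j * C (f i) (f j)) = (\<Sum>x\<in>?A. \<Sum>y\<in>?A. b x * b y * C x y)" .
  show "(\<integral>\<omega>. cis (\<Sum>i<n. a i * X (f i) \<omega>) \<partial>P) = complex_of_real (exp (- (\<Sum>i<n. \<Sum>j<n. a i * a j * C (f i) (f j)) / 2))"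
    unfolding q gen[of "\<lambda>x. X x _"] using f by (intro fin) auto
qed (use assms in auto)

lemma sum_mult_delta:
  fixes g :: "'b \<Rightarrow> real"
  assumes "finite F" "x \<in> F"
  shows "(\<Sum>l\<in>F. g l * (if x = l then 1 else 0)) = g x"
proof -
  have "(\<Sum>l\<in>F. g l * (if x = l then 1 else 0)) = (\<Sum>l\<in>F. if x = l then g l else 0)"
    by (intro sum.cong) auto
  then show ?thesis using assms by (simp add: sum.delta')
qed

lemma finite_indices: "finite (indices N p)"
  using finite_lists_length_eq[of "{..<N}" p] by (simp add: indices_def conj_commute)

lemma indices_Suc: "indices N (Suc p) = (\<lambda>(i, l). i # l) ` ({..<N} \<times> indices N p)"
  by (auto simp: indices_def length_Suc_conv image_iff)

text \<open>
  The expansion of a power of an inner product over all multi-indices; it makes the covariance of the degree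
  \<open>p\<close> part of the Hamiltonian a function of the overlap.
\<close>
lemma sum_indices_prod: "(\<Sum>l\<in>indices N p. prod_list (map \<sigma> l) * prod_list (map \<sigma>' l)) = dot N \<sigma> \<sigma>' ^ p"
proof (induction p)
  case 0
  have "indices N 0 = {[]}" by (auto simp: indices_def)
  then show ?case by simp
next
  case (Suc p)
  have "(\<Sum>l\<in>indices N (Suc p). prod_list (map \<sigma> l) * prod_list (map \<sigma>' l))
      = (\<Sum>(i, l)\<in>{..<N} \<times> indices N p. (\<sigma> i * \<sigma>' i) * (prod_list (map \<sigma> l) * prod_list (map \<sigma>' l)))"
    unfolding indices_Suc by (subst sum.reindex) (auto simp: inj_on_def ac_simps intro!: sum.cong)
  also have "\<dots> = dot N \<sigma> \<sigma>' * dot N \<sigma> \<sigma>' ^ p"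
    by (simp add: sum.cartesian_product[symmetric] sum_distrib_left[symmetric] Suc sum_distrib_right[symmetric])
       (simp add: dot_def)
  finally show ?case by simp
qed

lemma dot_commute: "dot N x y = dot N y x"
  by (simp add: dot_def mult.commute)

lemma abs_dot_sphere_le:
  assumes "\<sigma> \<in> spin_sphere N" "\<sigma>' \<in> spin_sphere N"
  shows "\<bar>dot N \<sigma> \<sigma>'\<bar> \<le> real N"
proof -
  have n: "dot N \<sigma> \<sigma> = real N" "dot N \<sigma>' \<sigma>' = real N"
    using assms by (simp_all add: spin_sphere_def vnorm_def)
  have "2 * \<bar>dot N \<sigma> \<sigma>'\<bar> \<le> (\<Sum>i<N. 2 * \<bar>\<sigma> i * \<sigma>' i\<bar>)"
    unfolding dot_def by (simp add: sum_distrib_left[symmetric])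
  also have "\<dots> \<le> (\<Sum>i<N. \<sigma> i * \<sigma> i + \<sigma>' i * \<sigma>' i)"
  proof (intro sum_mono)
    fix i
    have "0 \<le> (\<bar>\<sigma> i\<bar> - \<bar>\<sigma>' i\<bar>)\<^sup>2" by simp
    then show "2 * \<bar>\<sigma> i * \<sigma>' i\<bar> \<le> \<sigma> i * \<sigma> i + \<sigma>' i * \<sigma>' i"
      by (simp add: power2_eq_square abs_mult algebra_simps)
  qed
  also have "\<dots> = 2 * real N" using n by (simp add: sum.distrib dot_def)
  finally show ?thesis by simp
qed

lemma mixture_summable:
  assumes \<gamma>: "mixture_coeffs \<gamma>" and t: "\<bar>t\<bar> \<le> 1"
  shows "summable (\<lambda>p. if 2 \<le> p then (\<gamma> p)\<^sup>2 * t ^ p else 0)"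
proof -
  obtain \<epsilon> where \<epsilon>: "0 < \<epsilon>" "summable (\<lambda>p. if 2 \<le> p then (\<gamma> p)\<^sup>2 * (1 + \<epsilon>) ^ p else 0)"
    using \<gamma> by (auto simp: mixture_coeffs_def)
  show ?thesis
  proof (rule summable_comparison_test'[OF \<epsilon>(2), of 0])
    fix p
    have "\<bar>t\<bar> ^ p \<le> (1 + \<epsilon>) ^ p" using t \<epsilon>(1) by (intro power_mono) auto
    then show "norm (if 2 \<le> p then (\<gamma> p)\<^sup>2 * t ^ p else 0) \<le> (if 2 \<le> p then (\<gamma> p)\<^sup>2 * (1 + \<epsilon>) ^ p else 0)"
      by (auto simp: abs_mult power_abs intro: mult_left_mono)
  qed
qed

text \<open>
  The geometric weight in the condition on the mixture gives more than square summability: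
  \<open>\<gamma> p \<le> q\<^sup>-\<^sup>1 + (\<gamma> p)\<^sup>2 q\<close> with \<open>q = (1 + \<epsilon>)\<^sup>p\<close>.
\<close>
lemma coeffs_summable:
  assumes \<gamma>: "mixture_coeffs \<gamma>"
  shows "summable (\<lambda>p. if 2 \<le> p then \<gamma> p else 0)"
proof -
  obtain \<epsilon> where \<epsilon>: "0 < \<epsilon>" "summable (\<lambda>p. if 2 \<le> p then (\<gamma> p)\<^sup>2 * (1 + \<epsilon>) ^ p else 0)"
    and pos: "\<And>p. 2 \<le> p \<Longrightarrow> 0 \<le> \<gamma> p"
    using \<gamma> by (auto simp: mixture_coeffs_def)
  have geo: "summable (\<lambda>p. (1 / (1 + \<epsilon>)) ^ p)" using \<epsilon>(1) by (intro summable_geometric) simp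
  show ?thesis
  proof (rule summable_comparison_test'[OF summable_add[OF geo \<epsilon>(2)], of 0])
    fix p
    show "norm (if 2 \<le> p then \<gamma> p else 0) \<le> (1 / (1 + \<epsilon>)) ^ p + (if 2 \<le> p then (\<gamma> p)\<^sup>2 * (1 + \<epsilon>) ^ p else 0)"
    proof (cases "2 \<le> p")
      case True
      define q where "q = (1 + \<epsilon>) ^ p"
      have q: "0 < q" using \<epsilon>(1) by (simp add: q_def)
      have "0 \<le> (\<gamma> p * q - 1)\<^sup>2 / q" using q by simp
      also have "\<dots> = (\<gamma> p)\<^sup>2 * q - 2 * \<gamma> p + 1 / q" using q by (simp add: power2_eq_square field_simps)
      finally have "\<gamma> p \<le> 1 / q + (\<gamma> p)\<^sup>2 * q" using pos[OF True] by simp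
      then show ?thesis using True pos[OF True] by (simp add: q_def power_divide)
    qed (use \<epsilon>(1) in simp)
  qed
qed

lemma disorder_gaussian:
  assumes "disorder M J"
  shows "gaussian_system M (\<Union>p\<in>{2..}. indices N p) (\<lambda>l l'. if l = l' then 1 else 0) (J N)"
proof (rule gaussian_systemI)
  let ?I = "\<Union>p\<in>{2..}. indices N p"
  interpret prob_space M using assms by (simp add: disorder_def)
  have ind: "indep_vars (\<lambda>_. borel) (J N) ?I" and dist: "\<And>l. l \<in> ?I \<Longrightarrow> distributed M lborel (J N l) std_normal_density"
    using assms by (auto simp: disorder_def)
  show "prob_space M" by (rule prob_space_axioms)
  show meas: "J N l \<in> borel_measurable M" if "l \<in> ?I" for l
    using distributed_measurable[OF dist[OF that]] by simp
  fix A a assume A: "finite A" "A \<subseteq> ?I"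
  have one: "(\<integral>\<omega>. cis (c * J N l \<omega>) \<partial>M) = complex_of_real (exp (- c\<^sup>2 / 2))" if "l \<in> ?I" for l c
  proof -
    have "distr M lborel (J N l) = normal01" using dist[OF that] by (simp add: distributed_distr_eq_density)
    then have "(\<integral>x. cis (c * x) \<partial>normal01) = (\<integral>x. cis (c * x) \<partial>distr M lborel (J N l))" by simp
    also have "\<dots> = (\<integral>\<omega>. cis (c * J N l \<omega>) \<partial>M)"
      using meas[OF that] by (subst integral_distr) auto
    finally show ?thesis by (simp add: integral_cis_normal01)
  qed
  have "indep_vars (\<lambda>_. borel) (\<lambda>l \<omega>. a l * J N l \<omega>) A"
    by (rule indep_vars_compose2[OF indep_vars_subset[OF ind A(2)]]) auto
  from char_distr_sum[OF this, of 1]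
  have "(\<integral>\<omega>. cis (\<Sum>x\<in>A. a x * J N x \<omega>) \<partial>M) = (\<Prod>l\<in>A. \<integral>\<omega>. cis (a l * J N l \<omega>) \<partial>M)"
  proof (subst (asm) char_distr_eq_cis, goal_cases)
    case 2
    have "char (distr M borel (\<lambda>\<omega>. a l * J N l \<omega>)) 1 = (\<integral>\<omega>. cis (a l * J N l \<omega>) \<partial>M)" if "l \<in> A" for l
    proof -
      have [measurable]: "J N l \<in> borel_measurable M" by (rule meas) (use A that in blast)
      show ?thesis by (subst char_distr_eq_cis) auto
    qed
    with 2 show ?case by simp
  qed (intro borel_measurable_sum borel_measurable_times borel_measurable_const meas, use A in blast)
  also have "\<dots> = (\<Prod>l\<in>A. complex_of_real (exp (- (a l)\<^sup>2 / 2)))"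
    using A(2) by (intro prod.cong refl one) auto
  also have "\<dots> = complex_of_real (exp (- (\<Sum>l\<in>A. (a l)\<^sup>2) / 2))"
    by (simp add: exp_sum[OF A(1), symmetric] sum_negf sum_divide_distrib flip: of_real_prod)
  also have "(\<Sum>l\<in>A. (a l)\<^sup>2) = (\<Sum>x\<in>A. \<Sum>y\<in>A. a x * a y * (if x = y then 1 else 0))"
    using sum_mult_delta[OF A(1), of _ "\<lambda>y. a _ * a y"] by (intro sum.cong refl) (simp add: power2_eq_square)
  finally show "(\<integral>\<omega>. cis (\<Sum>x\<in>A. a x * J N x \<omega>) \<partial>M) = complex_of_real (exp (- (\<Sum>x\<in>A. \<Sum>y\<in>A. a x * a y * (if x = y then 1 else 0)) / 2))" .
qed auto

definition degree_term :: "(nat \<Rightarrow> real) \<Rightarrow> nat \<Rightarrow> (nat list \<Rightarrow> real) \<Rightarrow> (nat \<Rightarrow> real) \<Rightarrow> nat \<Rightarrow> real" where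
  "degree_term \<gamma> N j \<sigma> p = (if 2 \<le> p
     then \<gamma> p * real N powr (- (real p - 1) / 2) * (\<Sum>l\<in>indices N p. j l * prod_list (map \<sigma> l))
     else 0)"

lemma hamiltonian_eq_suminf: "hamiltonian \<gamma> N j \<sigma> = (\<Sum>p. degree_term \<gamma> N j \<sigma> p)"
  by (simp add: hamiltonian_def degree_term_def)

lemma degree_terms_gaussian:
  assumes J: "disorder M J" and N: "0 < N" and D: "finite D" "D \<subseteq> {2..}"
  shows "gaussian_system M S (\<lambda>\<sigma> \<sigma>'. real N * (\<Sum>p\<in>D. (\<gamma> p)\<^sup>2 * (dot N \<sigma> \<sigma>' / real N) ^ p))
    (\<lambda>\<sigma> \<omega>. \<Sum>p\<in>D. degree_term \<gamma> N (\<lambda>l. J N l \<omega>) \<sigma> p)"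
proof (rule gaussian_system_linear[OF disorder_gaussian[OF J, of N]])
  let ?F = "\<Union>p\<in>D. indices N p"
  let ?b = "\<lambda>\<sigma> l. \<gamma> (length l) * real N powr (- (real (length l) - 1) / 2) * prod_list (map \<sigma> l)"
  show "finite ?F" using D finite_indices by auto
  have disj: "\<forall>p\<in>D. \<forall>q\<in>D. p \<noteq> q \<longrightarrow> indices N p \<inter> indices N q = {}"
    by (auto simp: indices_def)
  have sumF: "(\<Sum>l\<in>?F. g l) = (\<Sum>p\<in>D. \<Sum>l\<in>indices N p. g l)" for g :: "nat list \<Rightarrow> real"
    using D(1) disj finite_indices by (intro sum.UNION_disjoint) auto
  have len: "length l = p" if "l \<in> indices N p" for l p using that by (simp add: indices_def)
  show "l \<in> (\<Union>p\<in>{2..}. indices N p)" if "l \<in> ?F" for l using that D by auto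
  show "(\<Sum>p\<in>D. degree_term \<gamma> N (\<lambda>l. J N l \<omega>) \<sigma> p) = (\<Sum>l\<in>?F. ?b \<sigma> l * J N l \<omega>)" for \<sigma> \<omega>
    unfolding sumF using D by (intro sum.cong refl) (auto simp: degree_term_def sum_distrib_left len ac_simps intro!: sum.cong)
  show "real N * (\<Sum>p\<in>D. (\<gamma> p)\<^sup>2 * (dot N \<sigma> \<sigma>' / real N) ^ p) = (\<Sum>k\<in>?F. \<Sum>l\<in>?F. ?b \<sigma> k * ?b \<sigma>' l * (if k = l then 1 else 0))" for \<sigma> \<sigma>'
  proof -
    have "(\<Sum>k\<in>?F. \<Sum>l\<in>?F. ?b \<sigma> k * ?b \<sigma>' l * (if k = l then 1 else 0)) = (\<Sum>k\<in>?F. ?b \<sigma> k * ?b \<sigma>' k)"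
      using \<open>finite ?F\<close> by (intro sum.cong refl sum_mult_delta)
    also have "\<dots> = (\<Sum>p\<in>D. \<Sum>l\<in>indices N p. ((\<gamma> p)\<^sup>2 * (real N powr (- (real p - 1) / 2))\<^sup>2) * (prod_list (map \<sigma> l) * prod_list (map \<sigma>' l)))"
      unfolding sumF by (intro sum.cong refl) (simp add: len power2_eq_square ac_simps)
    also have "\<dots> = (\<Sum>p\<in>D. (\<gamma> p)\<^sup>2 * (real N powr (- (real p - 1) / 2))\<^sup>2 * dot N \<sigma> \<sigma>' ^ p)"
      unfolding sum_distrib_left[symmetric] sum_indices_prod ..
    also have "\<dots> = (\<Sum>p\<in>D. real N * ((\<gamma> p)\<^sup>2 * (dot N \<sigma> \<sigma>' / real N) ^ p))"
    proof (intro sum.cong refl)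
      fix p
      have "(real N powr (- (real p - 1) / 2))\<^sup>2 = real N powr (1 - real p)"
      proof -
        have "- (real p - 1) / 2 + - (real p - 1) / 2 = 1 - real p" by (simp add: field_simps)
        then show ?thesis by (simp only: power2_eq_square powr_add[symmetric])
      qed
      also have "\<dots> = real N / real N ^ p"
        using N by (simp add: powr_diff powr_realpow)
      finally show "(\<gamma> p)\<^sup>2 * (real N powr (- (real p - 1) / 2))\<^sup>2 * dot N \<sigma> \<sigma>' ^ p = real N * ((\<gamma> p)\<^sup>2 * (dot N \<sigma> \<sigma>' / real N) ^ p)"
        by (simp add: power_divide)
    qed
    finally show ?thesis by (simp add: sum_distrib_left)
  qed
qed

lemma gaussian_system_law:
  assumes G: "gaussian_system P S C X" and s: "s \<in> S"
  shows "distr P borel (X s) = distr normal01 borel (\<lambda>x. sqrt (C s s) * x)"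
proof (rule distr_eqI_cis[OF gaussian_system_prob_space[OF G] prob_space_normal01 gaussian_system_measurable[OF G s]])
  have C: "0 \<le> C s s" using gaussian_system_psd[OF G, of 1 "\<lambda>_. s" "\<lambda>_. 1"] s by simp
  show "(\<integral>\<omega>. cis (t * X s \<omega>) \<partial>P) = (\<integral>x. cis (t * (sqrt (C s s) * x)) \<partial>normal01)" for t
    using gaussian_system_cis_extend[OF G _ s, of 0 undefined t 0] C integral_cis_normal01[of "t * sqrt (C s s)"]
    by (simp add: power_mult_distrib mult.assoc)
qed simp

text \<open>
  The degree \<open>p\<close> part at a fixed point of the sphere is normal with standard deviation \<open>sqrt N * \<gamma> p\<close>, so
  the sum of the absolute values has finite expectation.
\<close>
lemma AE_hamiltonian_summable:
  assumes \<gamma>: "mixture_coeffs \<gamma>" and J: "disorder M J" and N: "0 < N" and \<sigma>: "\<sigma> \<in> spin_sphere N"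
  shows "AE \<omega> in M. summable (degree_term \<gamma> N (\<lambda>l. J N l \<omega>) \<sigma>)"
proof -
  let ?T = "\<lambda>p \<omega>. degree_term \<gamma> N (\<lambda>l. J N l \<omega>) \<sigma> p"
  let ?c = "\<integral>\<^sup>+x. ennreal \<bar>x\<bar> \<partial>normal01"
  have dd: "dot N \<sigma> \<sigma> = real N" using \<sigma> by (simp add: spin_sphere_def vnorm_def)
  have G: "gaussian_system M UNIV (\<lambda>\<sigma> \<sigma>'. real N * ((\<gamma> p)\<^sup>2 * (dot N \<sigma> \<sigma>' / real N) ^ p)) (\<lambda>\<sigma> \<omega>. degree_term \<gamma> N (\<lambda>l. J N l \<omega>) \<sigma> p)" if "2 \<le> p" for p
    using degree_terms_gaussian[OF J N, of "{p}" UNIV \<gamma>] that by simp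
  have T_meas[measurable]: "?T p \<in> borel_measurable M" for p
  proof (cases "2 \<le> p")
    case True then show ?thesis using gaussian_system_measurable[OF G[OF True], of \<sigma>] by simp
  qed (simp add: degree_term_def)
  have E: "(\<integral>\<^sup>+\<omega>. ennreal \<bar>?T p \<omega>\<bar> \<partial>M) = ennreal (if 2 \<le> p then sqrt (real N) * \<gamma> p else 0) * ?c" for p
  proof (cases "2 \<le> p")
    case True
    have g: "0 \<le> \<gamma> p" using \<gamma> True by (simp add: mixture_coeffs_def)
    have "sqrt (real N * ((\<gamma> p)\<^sup>2 * (dot N \<sigma> \<sigma> / real N) ^ p)) = sqrt (real N) * \<gamma> p"
      using N g by (simp add: dd real_sqrt_mult)
    then have law: "distr M borel (?T p) = distr normal01 borel (\<lambda>x. sqrt (real N) * \<gamma> p * x)"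
      using gaussian_system_law[OF G[OF True], of \<sigma>] by simp
    have "(\<integral>\<^sup>+\<omega>. ennreal \<bar>?T p \<omega>\<bar> \<partial>M) = (\<integral>\<^sup>+x. ennreal \<bar>sqrt (real N) * \<gamma> p * x\<bar> \<partial>normal01)"
      by (rule nn_integral_eq_of_distr_eq[OF law, of "\<lambda>x. ennreal \<bar>x\<bar>"]) auto
    also have "\<dots> = (\<integral>\<^sup>+x. ennreal (sqrt (real N) * \<gamma> p) * ennreal \<bar>x\<bar> \<partial>normal01)"
      using g by (intro nn_integral_cong) (simp add: ennreal_mult[symmetric] abs_mult)
    finally show ?thesis using True by (simp add: nn_integral_cmult)
  qed (simp add: degree_term_def)
  have c: "?c < \<infinity>"
  proof -
    have "integrable normal01 (\<lambda>x. \<bar>x\<bar>)"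
      using integrable_std_normal_moment_abs[of 1] by (subst integrable_density) auto
    then show ?thesis by (simp add: integrable_iff_bounded)
  qed
  have "(\<integral>\<^sup>+\<omega>. (\<Sum>p. ennreal \<bar>?T p \<omega>\<bar>) \<partial>M) = (\<Sum>p. ennreal (if 2 \<le> p then sqrt (real N) * \<gamma> p else 0) * ?c)"
    by (subst nn_integral_suminf) (auto simp: E)
  also have "\<dots> = (\<Sum>p. ennreal (if 2 \<le> p then sqrt (real N) * \<gamma> p else 0)) * ?c"
    by simp
  also have "\<dots> < \<infinity>"
  proof -
    have "summable (\<lambda>p. if 2 \<le> p then sqrt (real N) * \<gamma> p else 0)"
      using summable_mult[OF coeffs_summable[OF \<gamma>], of "sqrt (real N)"] by (simp add: if_distrib[of "\<lambda>x. _ * x"] cong: if_cong)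
    then have "(\<Sum>p. ennreal (if 2 \<le> p then sqrt (real N) * \<gamma> p else 0)) < \<infinity>"
      using \<gamma> by (subst suminf_ennreal2) (auto simp: mixture_coeffs_def)
    with c show ?thesis by (simp add: ennreal_mult_less_top)
  qed
  finally have "AE \<omega> in M. (\<Sum>p. ennreal \<bar>?T p \<omega>\<bar>) \<noteq> \<infinity>"
    by (intro nn_integral_PInf_AE) auto
  then show ?thesis
  proof eventually_elim
    case (elim \<omega>)
    then have "summable (\<lambda>p. \<bar>?T p \<omega>\<bar>)"
      by (intro summable_suminf_not_top) auto
    then show ?case by (rule summable_rabs_cancel)
  qed
qed

text \<open>
  The characteristic functions of the sums over finitely many degrees converge, by almost sure
  convergence on the one side and by convergence of the power series of the mixture on the other.
\<close>
lemma hamiltonian_gaussian: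
  assumes \<gamma>: "mixture_coeffs \<gamma>" and J: "disorder M J" and N: "0 < N"
  shows "gaussian_system M (spin_sphere N) (\<lambda>\<sigma> \<sigma>'. real N * mixture \<gamma> (dot N \<sigma> \<sigma>' / real N))
    (\<lambda>\<sigma> \<omega>. hamiltonian \<gamma> N (\<lambda>l. J N l \<omega>) \<sigma>)"
  unfolding gaussian_system_def
proof (intro conjI ballI allI impI)
  let ?S = "spin_sphere N"
  let ?H = "\<lambda>\<sigma> \<omega>. hamiltonian \<gamma> N (\<lambda>l. J N l \<omega>) \<sigma>"
  let ?Hm = "\<lambda>m \<sigma> \<omega>. \<Sum>p\<in>{2..<m}. degree_term \<gamma> N (\<lambda>l. J N l \<omega>) \<sigma> p"
  have G: "gaussian_system M ?S (\<lambda>\<sigma> \<sigma>'. real N * (\<Sum>p\<in>{2..<m}. (\<gamma> p)\<^sup>2 * (dot N \<sigma> \<sigma>' / real N) ^ p)) (?Hm m)" for m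
    by (rule degree_terms_gaussian[OF J N]) auto
  show "prob_space M" using J by (simp add: disorder_def)
  then interpret prob_space M .
  have T_meas[measurable]: "(\<lambda>\<omega>. degree_term \<gamma> N (\<lambda>l. J N l \<omega>) \<sigma> p) \<in> borel_measurable M" for \<sigma> p
  proof (cases "2 \<le> p")
    case True
    then show ?thesis
      using gaussian_system_measurable[OF degree_terms_gaussian[OF J N, of "{p}" UNIV \<gamma>], of \<sigma>] by simp
  qed (simp add: degree_term_def)
  show H_meas: "?H \<sigma> \<in> borel_measurable M" for \<sigma>
    unfolding hamiltonian_eq_suminf by measurable
  show "real N * mixture \<gamma> (dot N \<sigma> \<sigma>' / real N) = real N * mixture \<gamma> (dot N \<sigma>' \<sigma> / real N)" for \<sigma> \<sigma>'
    by (simp add: dot_commute)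
  fix n :: nat and a f assume f: "\<forall>i<n. f i \<in> ?S"
  have part: "(\<Sum>p<m. if 2 \<le> p then g p else 0) = (\<Sum>p\<in>{2..<m}. g p)" for g :: "nat \<Rightarrow> real" and m
    by (simp add: sum.inter_filter[symmetric]) (intro sum.cong, auto)
  have lim: "(\<lambda>m. ?Hm m \<sigma> \<omega>) \<longlonglongrightarrow> ?H \<sigma> \<omega>" if "summable (degree_term \<gamma> N (\<lambda>l. J N l \<omega>) \<sigma>)" for \<sigma> \<omega>
  proof -
    have "(\<Sum>p<m. degree_term \<gamma> N (\<lambda>l. J N l \<omega>) \<sigma> p) = (\<Sum>p\<in>{2..<m}. degree_term \<gamma> N (\<lambda>l. J N l \<omega>) \<sigma> p)" for m
      by (subst part[symmetric]) (intro sum.cong, auto simp: degree_term_def)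
    then show ?thesis using summable_LIMSEQ[OF that] by (simp only: hamiltonian_eq_suminf)
  qed
  have AE_lim: "AE \<omega> in M. \<forall>i<n. (\<lambda>m. ?Hm m (f i) \<omega>) \<longlonglongrightarrow> ?H (f i) \<omega>"
  proof -
    have "AE \<omega> in M. \<forall>i\<in>{..<n}. (\<lambda>m. ?Hm m (f i) \<omega>) \<longlonglongrightarrow> ?H (f i) \<omega>"
    proof (rule AE_finite_allI)
      fix i assume "i \<in> {..<n}"
      with f have "AE \<omega> in M. summable (degree_term \<gamma> N (\<lambda>l. J N l \<omega>) (f i))"
        by (intro AE_hamiltonian_summable[OF \<gamma> J N]) auto
      then show "AE \<omega> in M. (\<lambda>m. ?Hm m (f i) \<omega>) \<longlonglongrightarrow> ?H (f i) \<omega>"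
        by eventually_elim (rule lim)
    qed simp
    then show ?thesis by eventually_elim auto
  qed
  have "(\<lambda>m. \<integral>\<omega>. cis (\<Sum>i<n. a i * ?Hm m (f i) \<omega>) \<partial>M) \<longlonglongrightarrow> (\<integral>\<omega>. cis (\<Sum>i<n. a i * ?H (f i) \<omega>) \<partial>M)"
  proof (rule integral_dominated_convergence[where w="\<lambda>_. 1"])
    show "AE \<omega> in M. (\<lambda>m. cis (\<Sum>i<n. a i * ?Hm m (f i) \<omega>)) \<longlonglongrightarrow> cis (\<Sum>i<n. a i * ?H (f i) \<omega>)"
      using AE_lim by eventually_elim (intro isCont_tendsto_compose[OF isCont_cis] tendsto_intros, auto)
  qed (use H_meas in measurable)
  moreover have "(\<integral>\<omega>. cis (\<Sum>i<n. a i * ?Hm m (f i) \<omega>) \<partial>M) = complex_of_real (exp (- (\<Sum>i<n. \<Sum>j<n. a i * a j *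
      (real N * (\<Sum>p\<in>{2..<m}. (\<gamma> p)\<^sup>2 * (dot N (f i) (f j) / real N) ^ p))) / 2))" for m
    using f by (intro gaussian_system_cis[OF G]) auto
  moreover have "(\<lambda>m. complex_of_real (exp (- (\<Sum>i<n. \<Sum>j<n. a i * a j *
      (real N * (\<Sum>p\<in>{2..<m}. (\<gamma> p)\<^sup>2 * (dot N (f i) (f j) / real N) ^ p))) / 2)))
     \<longlonglongrightarrow> complex_of_real (exp (- (\<Sum>i<n. \<Sum>j<n. a i * a j * (real N * mixture \<gamma> (dot N (f i) (f j) / real N))) / 2))"
  proof (intro tendsto_of_real tendsto_exp tendsto_divide tendsto_minus tendsto_sum tendsto_mult tendsto_const)
    fix i j assume ij: "i \<in> {..<n}" "j \<in> {..<n}"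
    have "\<bar>dot N (f i) (f j) / real N\<bar> \<le> 1"
      using abs_dot_sphere_le[of "f i" N "f j"] f ij N by simp
    from summable_LIMSEQ[OF mixture_summable[OF \<gamma> this]]
    show "(\<lambda>m. \<Sum>p\<in>{2..<m}. (\<gamma> p)\<^sup>2 * (dot N (f i) (f j) / real N) ^ p) \<longlonglongrightarrow> mixture \<gamma> (dot N (f i) (f j) / real N)"
      unfolding part mixture_def .
  qed simp
  ultimately show "(\<integral>\<omega>. cis (\<Sum>i<n. a i * ?H (f i) \<omega>) \<partial>M) = complex_of_real (exp (- (\<Sum>i<n. \<Sum>j<n. a i * a j * (real N * mixture \<gamma> (dot N (f i) (f j) / real N))) / 2))"
    by (simp only: LIMSEQ_unique)
qed

lemma measurable_prod_list_coords [measurable (raw)]: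
  assumes "f \<in> measurable K (vec_space N)" "set l \<subseteq> {..<N}"
  shows "(\<lambda>x. prod_list (map (f x) l)) \<in> borel_measurable K"
  using assms(2)
proof (induction l)
  case (Cons i l)
  then have "(\<lambda>x. f x i) \<in> borel_measurable K"
    by (intro measurable_compose[OF assms(1) measurable_component_singleton]) auto
  then show ?case using Cons by simp
qed simp

lemma measurable_hamiltonian:
  assumes J: "disorder M J"
  shows "(\<lambda>(\<sigma>, \<omega>). hamiltonian \<gamma> N (\<lambda>l. J N l \<omega>) \<sigma>) \<in> borel_measurable (vec_space N \<Otimes>\<^sub>M M)"
proof -
  have [measurable]: "J N l \<in> borel_measurable M" if "l \<in> indices N p" "2 \<le> p" for l p
    using gaussian_system_measurable[OF disorder_gaussian[OF J, of N], of l] that by auto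
  have "(\<lambda>x. degree_term \<gamma> N (\<lambda>l. J N l (snd x)) (fst x) p) \<in> borel_measurable (vec_space N \<Otimes>\<^sub>M M)" for p
  proof (cases "2 \<le> p")
    case True
    have "(\<lambda>x. \<Sum>l\<in>indices N p. J N l (snd x) * prod_list (map (fst x) l)) \<in> borel_measurable (vec_space N \<Otimes>\<^sub>M M)"
      using True by (intro borel_measurable_sum borel_measurable_times measurable_prod_list_coords[OF measurable_fst] measurable_compose[OF measurable_snd])
        (auto simp: indices_def)
    then show ?thesis using True by (simp add: degree_term_def)
  qed (simp add: degree_term_def)
  then show ?thesis
    unfolding hamiltonian_eq_suminf case_prod_beta' by measurable
qed

section \<open>Orthonormal images of Gaussian vectors\<close>

text \<open>
  The uniqueness theorem in several variables.  The exponentials \<open>cis (t i * X i)\<close> are replaced by indicators of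
  Borel sets one coordinate at a time, each time by \<open>weighted_integral_eqI\<close>; the resulting measures agree on boxes.
\<close>
lemma distr_vec_eqI_cis:
  fixes X :: "nat \<Rightarrow> 'w \<Rightarrow> real" and Y :: "nat \<Rightarrow> 'v \<Rightarrow> real"
  assumes P: "prob_space P" and P': "prob_space P'"
    and X: "\<And>i. i < n \<Longrightarrow> X i \<in> borel_measurable P" and Y: "\<And>i. i < n \<Longrightarrow> Y i \<in> borel_measurable P'"
    and cf: "\<And>t. (\<integral>\<omega>. cis (\<Sum>i<n. t i * X i \<omega>) \<partial>P) = (\<integral>\<omega>. cis (\<Sum>i<n. t i * Y i \<omega>) \<partial>P')"
  shows "distr P (vec_space n) (\<lambda>\<omega>. \<lambda>i\<in>{..<n}. X i \<omega>) = distr P' (vec_space n) (\<lambda>\<omega>. \<lambda>i\<in>{..<n}. Y i \<omega>)"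
proof -
  interpret P: prob_space P by fact
  interpret P': prob_space P' by fact
  have boxes: "(\<integral>\<omega>. (\<Prod>i<k. indicator (B i) (X i \<omega>)) * cis (\<Sum>i\<in>{k..<n}. t i * X i \<omega>) \<partial>P)
      = (\<integral>\<omega>. (\<Prod>i<k. indicator (B i) (Y i \<omega>)) * cis (\<Sum>i\<in>{k..<n}. t i * Y i \<omega>) \<partial>P')"
    if "k \<le> n" "\<And>i. B i \<in> sets borel" for k t and B :: "nat \<Rightarrow> real set"
    using that(1)
  proof (induction k arbitrary: t)
    case 0
    then show ?case using cf[of t] by (simp add: atLeast0LessThan)
  next
    case (Suc k)
    note [measurable] = that(2)
    have Xm[measurable]: "X i \<in> borel_measurable P" if "i < Suc k" for i using X that Suc.prems by auto
    have Ym[measurable]: "Y i \<in> borel_measurable P'" if "i < Suc k" for i using Y that Suc.prems by auto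
    have Xm'[measurable]: "(\<lambda>\<omega>. \<Sum>i\<in>{Suc k..<n}. t i * X i \<omega>) \<in> borel_measurable P"
      by (intro borel_measurable_sum borel_measurable_times borel_measurable_const X) auto
    have Ym'[measurable]: "(\<lambda>\<omega>. \<Sum>i\<in>{Suc k..<n}. t i * Y i \<omega>) \<in> borel_measurable P'"
      by (intro borel_measurable_sum borel_measurable_times borel_measurable_const Y) auto
    define W where "W = (\<lambda>\<omega>. (\<Prod>i<k. indicator (B i) (X i \<omega>)) * cis (\<Sum>i\<in>{Suc k..<n}. t i * X i \<omega>))"
    define W' where "W' = (\<lambda>\<omega>. (\<Prod>i<k. indicator (B i) (Y i \<omega>)) * cis (\<Sum>i\<in>{Suc k..<n}. t i * Y i \<omega>))"
    have le1: "norm ((\<Prod>i<k. indicator (B i) (x i)) * cis a) \<le> 1" for x a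
      by (auto simp: norm_mult prod_norm[symmetric] intro!: prod_le_1 split: split_indicator)
    have int: "(\<integral>\<omega>. W \<omega> * indicator (B k) (X k \<omega>) \<partial>P) = (\<integral>\<omega>. W' \<omega> * indicator (B k) (Y k \<omega>) \<partial>P')"
    proof (rule weighted_integral_eqI[OF P P'])
      show "X k \<in> borel_measurable P" "Y k \<in> borel_measurable P'" by measurable
      show "W \<in> borel_measurable P" "W' \<in> borel_measurable P'" unfolding W_def W'_def by measurable
      show "norm (W \<omega>) \<le> 1" "norm (W' \<omega>') \<le> 1" for \<omega> \<omega>' unfolding W_def W'_def by (rule le1)+
      show "integrable P (\<lambda>\<omega>. indicator (B k) (X k \<omega>) :: complex)"
        by (rule P.integrable_const_bound[where B=1]) (auto split: split_indicator)
      have d: "(\<Sum>i<n. (if i = k then s else 0) * z i) = s * z k" for s and z :: "nat \<Rightarrow> real"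
        using Suc.prems by (simp add: if_distrib[of "\<lambda>x. x * _"] sum.delta cong: if_cong)
      show "(\<integral>\<omega>. cis (s * X k \<omega>) \<partial>P) = (\<integral>\<omega>. cis (s * Y k \<omega>) \<partial>P')" for s
        using cf[of "\<lambda>i. if i = k then s else 0"] by (simp only: d)
      have e: "(\<Sum>i\<in>{k..<n}. (t(k := s)) i * z i) = (\<Sum>i\<in>{Suc k..<n}. t i * z i) + s * z k" for s and z :: "nat \<Rightarrow> real"
        using Suc.prems by (subst sum.atLeast_Suc_lessThan) auto
      show "(\<integral>\<omega>. W \<omega> * cis (s * X k \<omega>) \<partial>P) = (\<integral>\<omega>. W' \<omega> * cis (s * Y k \<omega>) \<partial>P')" for s
        using Suc.IH[of "t(k := s)"] Suc.prems unfolding e by (simp add: W_def W'_def mult.assoc cis_mult)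
    qed measurable
    then show ?case unfolding W_def W'_def by (simp add: ac_simps)
  qed
  let ?X = "\<lambda>\<omega>. \<lambda>i\<in>{..<n}. X i \<omega>" and ?Y = "\<lambda>\<omega>. \<lambda>i\<in>{..<n}. Y i \<omega>"
  have Xv: "?X \<in> measurable P (vec_space n)" and Yv: "?Y \<in> measurable P' (vec_space n)"
    using X Y by (auto intro!: measurable_restrict)
  show ?thesis
  proof (rule measure_eqI_PiM_finite[where I="{..<n}" and M="\<lambda>_. borel" and A="\<lambda>_. space (vec_space n)"])
    fix A :: "nat \<Rightarrow> real set" assume A: "\<And>i. i \<in> {..<n} \<Longrightarrow> A i \<in> sets borel"
    \<comment> \<open>Extended by the empty set, so that every \<open>B i\<close> is a Borel set.\<close>
    define B where "B = (\<lambda>i. if i < n then A i else {})"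
    have B: "B i \<in> sets borel" for i using A by (auto simp: B_def)
    have S: "PiE {..<n} A \<in> sets (vec_space n)" using A by (intro sets_PiM_I_finite) auto
    have ind: "indicator (PiE {..<n} A) (\<lambda>i\<in>{..<n}. z i) = (\<Prod>i<n. indicator (B i) (z i) :: complex)" for z
      by (auto simp: B_def indicator_def PiE_iff prod_zero_iff)
    have m: "complex_of_real (measure (distr Q (vec_space n) (\<lambda>\<omega>. \<lambda>i\<in>{..<n}. Z i \<omega>)) (PiE {..<n} A)) = (\<integral>\<omega>. (\<Prod>i<n. indicator (B i) (Z i \<omega>)) \<partial>Q)"
      if "(\<lambda>\<omega>. \<lambda>i\<in>{..<n}. Z i \<omega>) \<in> measurable Q (vec_space n)" "prob_space Q" for Q :: "'q measure" and Z
    proof -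
      interpret D: prob_space "distr Q (vec_space n) (\<lambda>\<omega>. \<lambda>i\<in>{..<n}. Z i \<omega>)" by (rule prob_space.prob_space_distr[OF that(2,1)])
      have "complex_of_real (measure (distr Q (vec_space n) (\<lambda>\<omega>. \<lambda>i\<in>{..<n}. Z i \<omega>)) (PiE {..<n} A))
          = (\<integral>z. indicator (PiE {..<n} A) z \<partial>distr Q (vec_space n) (\<lambda>\<omega>. \<lambda>i\<in>{..<n}. Z i \<omega>))"
      proof -
        have "(\<integral>z. indicator (PiE {..<n} A) z \<partial>distr Q (vec_space n) (\<lambda>\<omega>. \<lambda>i\<in>{..<n}. Z i \<omega>)) = (\<integral>z. complex_of_real (indicator (PiE {..<n} A) z) \<partial>distr Q (vec_space n) (\<lambda>\<omega>. \<lambda>i\<in>{..<n}. Z i \<omega>))"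
          by (intro Bochner_Integration.integral_cong refl) (auto split: split_indicator)
        also have "\<dots> = complex_of_real (measure (distr Q (vec_space n) (\<lambda>\<omega>. \<lambda>i\<in>{..<n}. Z i \<omega>)) (PiE {..<n} A))"
          using S by (simp add: integral_complex_of_real)
        finally show ?thesis ..
      qed
      also have "\<dots> = (\<integral>\<omega>. indicator (PiE {..<n} A) (\<lambda>i\<in>{..<n}. Z i \<omega>) \<partial>Q)"
        using that(1) S by (intro integral_distr) auto
      finally show ?thesis unfolding ind .
    qed
    have "complex_of_real (measure (distr P (vec_space n) ?X) (PiE {..<n} A)) = complex_of_real (measure (distr P' (vec_space n) ?Y) (PiE {..<n} A))"
      unfolding m[OF Xv P] m[OF Yv P'] using boxes[of n B "\<lambda>_. 0"] B by simp
    then show "emeasure (distr P (vec_space n) ?X) (PiE {..<n} A) = emeasure (distr P' (vec_space n) ?Y) (PiE {..<n} A)"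
      using prob_space.prob_space_distr[OF P Xv] prob_space.prob_space_distr[OF P' Yv]
      by (simp add: prob_space.finite_measure finite_measure.emeasure_eq_measure prob_space_def)
  next
    show "range (\<lambda>_. space (vec_space n)) \<subseteq> prod_algebra {..<n} (\<lambda>_. borel)"
      by (auto simp: space_PiM intro!: prod_algebraI_finite)
    show "emeasure (distr P (vec_space n) ?X) (space (vec_space n)) \<noteq> \<infinity>" for i :: nat
      using prob_space.emeasure_space_1[OF P.prob_space_distr[OF Xv]] by simp
  qed auto
qed

lemma integral_cis_std_gaussian:
  "(\<integral>g. cis (\<Sum>i<n. t i * g i) \<partial>std_gaussian n) = complex_of_real (exp (- (\<Sum>i<n. (t i)\<^sup>2) / 2))"
proof -
  interpret N: prob_space normal01 by (rule prob_space_normal01)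
  interpret Q: product_prob_space "\<lambda>_::nat. normal01" "{..<n}" by standard
  have cis_sum: "cis (\<Sum>j\<in>A. f j) = (\<Prod>j\<in>A. cis (f j))" for f :: "nat \<Rightarrow> real" and A
    by (induction A rule: infinite_finite_induct) (auto simp: cis_mult[symmetric])
  have "(\<integral>g. cis (\<Sum>i<n. t i * g i) \<partial>std_gaussian n) = (\<Prod>i<n. \<integral>x. cis (t i * x) \<partial>normal01)"
    unfolding std_gaussian_def cis_sum by (rule Q.product_integral_prod) auto
  also have "\<dots> = complex_of_real (exp (- (\<Sum>i<n. (t i)\<^sup>2) / 2))"
    by (simp add: integral_cis_normal01 exp_sum[symmetric] sum_negf sum_divide_distrib flip: of_real_prod)
  finally show ?thesis .
qed

lemma measurable_coord_std_gaussian: "i < n \<Longrightarrow> (\<lambda>g. g i) \<in> borel_measurable (std_gaussian n)"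
  by (subst measurable_cong_sets[OF sets_std_gaussian refl]) (auto intro: measurable_component_singleton)

text \<open>
  The characteristic function of the image at \<open>t\<close> is the standard Gaussian one at the combination of the
  rows with coefficients \<open>t\<close>, and this vector has the norm of \<open>t\<close>.
\<close>
lemma std_gaussian_orthonormal_image:
  assumes R: "\<And>i i'. i < n \<Longrightarrow> i' < n \<Longrightarrow> (\<Sum>j<N. R i j * R i' j) = (if i = i' then 1 else 0 :: real)"
  shows "distr (std_gaussian N) (vec_space n) (\<lambda>g. \<lambda>i\<in>{..<n}. \<Sum>j<N. R i j * g j) = std_gaussian n"
proof -
  have "distr (std_gaussian N) (vec_space n) (\<lambda>g. \<lambda>i\<in>{..<n}. \<Sum>j<N. R i j * g j) = distr (std_gaussian n) (vec_space n) (\<lambda>g. \<lambda>i\<in>{..<n}. g i)"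
  proof (rule distr_vec_eqI_cis[OF prob_space_std_gaussian prob_space_std_gaussian])
    show "(\<lambda>g. \<Sum>j<N. R i j * g j) \<in> borel_measurable (std_gaussian N)" for i
      by (intro borel_measurable_sum borel_measurable_times borel_measurable_const measurable_coord_std_gaussian) auto
    fix t
    have "(\<integral>g. cis (\<Sum>i<n. t i * (\<Sum>j<N. R i j * g j)) \<partial>std_gaussian N) = (\<integral>g. cis (\<Sum>j<N. (\<Sum>i<n. t i * R i j) * g j) \<partial>std_gaussian N)"
      by (simp add: sum_distrib_left sum_distrib_right mult.assoc) (subst sum.swap, rule refl)
    also have "\<dots> = complex_of_real (exp (- (\<Sum>j<N. (\<Sum>i<n. t i * R i j)\<^sup>2) / 2))"
      by (rule integral_cis_std_gaussian)
    also have "(\<Sum>j<N. (\<Sum>i<n. t i * R i j)\<^sup>2) = (\<Sum>j<N. \<Sum>i<n. \<Sum>i'<n. t i * t i' * (R i j * R i' j))"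
      by (simp add: power2_eq_square sum_product ac_simps)
    also have "\<dots> = (\<Sum>i<n. \<Sum>i'<n. \<Sum>j<N. t i * t i' * (R i j * R i' j))"
      by (simp only: sum.swap[where A="{..<N}" and B="{..<n}"])
    also have "\<dots> = (\<Sum>i<n. \<Sum>i'<n. t i * t i' * (if i = i' then 1 else 0))"
      by (simp add: sum_distrib_left[symmetric] R)
    also have "\<dots> = (\<Sum>i<n. (t i)\<^sup>2)"
      by (intro sum.cong refl) (simp add: sum_mult_delta power2_eq_square)
    also have "complex_of_real (exp (- (\<Sum>i<n. (t i)\<^sup>2) / 2)) = (\<integral>g. cis (\<Sum>i<n. t i * g i) \<partial>std_gaussian n)"
      by (rule integral_cis_std_gaussian[symmetric])
    finally show "(\<integral>g. cis (\<Sum>i<n. t i * (\<Sum>j<N. R i j * g j)) \<partial>std_gaussian N) = (\<integral>g. cis (\<Sum>i<n. t i * g i) \<partial>std_gaussian n)" .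
  qed (auto intro: measurable_coord_std_gaussian)
  also have "\<dots> = distr (std_gaussian n) (vec_space n) (\<lambda>g. g)"
    by (intro distr_cong refl) (auto simp: std_gaussian_def space_PiM PiE_def extensional_def restrict_def fun_eq_iff)
  also have "\<dots> = std_gaussian n"
    by (rule distr_id2) (rule sets_std_gaussian[symmetric])
  finally show ?thesis .
qed

text \<open>
  An orthogonal matrix with a prescribed last row \<open>u\<close>: the reflection that exchanges \<open>u\<close> and the last
  basis vector.
\<close>
lemma householder_reflection:
  fixes u :: "nat \<Rightarrow> real"
  assumes u: "(\<Sum>i<Suc n. (u i)\<^sup>2) = 1"
  obtains R :: "nat \<Rightarrow> nat \<Rightarrow> real" where "\<And>i j. R i j = R j i"
    and "\<And>i j. i < Suc n \<Longrightarrow> j < Suc n \<Longrightarrow> (\<Sum>k<Suc n. R i k * R j k) = (if i = j then 1 else 0)"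
    and "\<And>j. j < Suc n \<Longrightarrow> R n j = u j"
proof -
  define w where "w = (\<lambda>i. u i - (if i = n then 1 else 0))"
  \<comment> \<open>For \<open>u n = 1\<close> the vector \<open>w\<close> vanishes and \<open>R\<close> is the identity.\<close>
  define c where "c = 1 / (1 - u n)"
  define R where "R = (\<lambda>i j. (if i = j then 1 else 0) - c * (w i * w j))"
  have delta: "(\<Sum>k<Suc n. (if i = k then 1 else 0) * f k) = f i" "(\<Sum>k<Suc n. f k * (if i = k then 1 else 0)) = f i"
    if "i < Suc n" for i and f :: "nat \<Rightarrow> real"
    using sum_mult_delta[of "{..<Suc n}" i f] that by (simp_all add: mult.commute)
  have ww: "(\<Sum>k<Suc n. w k * w k) = 2 * (1 - u n)"
  proof -
    have "(\<Sum>k<Suc n. w k * w k) = (\<Sum>k<n. (u k)\<^sup>2) + (u n - 1)\<^sup>2"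
      by (simp add: w_def power2_eq_square)
    also have "(\<Sum>k<n. (u k)\<^sup>2) = 1 - (u n)\<^sup>2" using u by simp
    finally show ?thesis by (simp add: power2_eq_square algebra_simps)
  qed
  have zero: "w i = 0" if "u n = 1" "i < Suc n" for i
  proof -
    have "(\<Sum>k<Suc n. w k * w k) = 0" using ww that by simp
    then have "w i * w i = 0"
      using sum_nonneg_eq_0_iff[of "{..<Suc n}" "\<lambda>k. w k * w k"] that(2) by auto
    then show ?thesis by simp
  qed
  show thesis
  proof (rule that[of R])
    show "R i j = R j i" for i j by (simp add: R_def mult.commute)
    show "(\<Sum>k<Suc n. R i k * R j k) = (if i = j then 1 else 0)" if ij: "i < Suc n" "j < Suc n" for i j
    proof -
      have "(\<Sum>k<Suc n. R i k * R j k) = (\<Sum>k<Suc n. (if i = k then 1 else 0) * (if j = k then 1 else 0)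
          - c * w i * (w k * (if j = k then 1 else 0)) - c * w j * (w k * (if i = k then 1 else 0)) + c\<^sup>2 * w i * w j * (w k * w k))"
        by (intro sum.cong refl) (simp add: R_def algebra_simps power2_eq_square)
      also have "\<dots> = (if j = i then 1 else 0) - c * w i * w j - c * w j * w i + c\<^sup>2 * w i * w j * (2 * (1 - u n))"
        by (simp only: sum.distrib sum_subtractf sum_distrib_left[symmetric] delta ij ww)
      also have "(c * (2 * (1 - u n))) * (c * w i * w j) = 2 * (c * w i * w j)"
      proof (cases "u n = 1")
        case True
        then show ?thesis using zero[OF _ ij(1)] by simp
      next
        case False
        then have "c * (2 * (1 - u n)) = 2" by (simp add: c_def field_simps)
        then show ?thesis by (simp only:)
      qed
      then have "c\<^sup>2 * w i * w j * (2 * (1 - u n)) = 2 * (c * w i * w j)"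
        by (simp add: power2_eq_square ac_simps)
      finally show ?thesis by (auto simp: ac_simps)
    qed
    show "R n j = u j" if j: "j < Suc n" for j
    proof (cases "u n = 1")
      case True
      then show ?thesis using zero[OF True j] by (auto simp: R_def w_def split: if_splits)
    next
      case False
      then have "c * (w n * w j) = - w j" by (simp add: c_def w_def field_simps)
      then show ?thesis by (auto simp: R_def w_def)
    qed
  qed
qed

lemma AE_std_gaussian_vnorm:
  assumes "0 < N"
  shows "AE g in std_gaussian N. vnorm N g \<noteq> 0"
proof -
  have "AE x in normal01. x \<noteq> 0"
    using AE_lborel_singleton[of 0] by (subst AE_density) auto
  then have "AE g in std_gaussian N. g 0 \<noteq> 0"
    unfolding std_gaussian_def using assms by (intro AE_PiM_component prob_space_normal01) auto
  then show ?thesis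
  proof eventually_elim
    case (elim g)
    have "0 < g 0 * g 0" using elim by (metis not_real_square_gt_zero)
    also have "\<dots> \<le> dot N g g" unfolding dot_def using assms
      by (intro member_le_sum) auto
    finally show ?case by (simp add: vnorm_def)
  qed
qed

section \<open>Expected log-partition functions at nearby scales\<close>

lemma gaussian_field_scale:
  assumes X: "gaussian_field \<mu> P C X v"
  shows "gaussian_field \<mu> P (\<lambda>s t. c\<^sup>2 * C s t) (\<lambda>s \<omega>. c * X s \<omega>) (c\<^sup>2 * v)"
proof -
  interpret gaussian_field \<mu> P C X v by fact
  show ?thesis
  proof
    show "gaussian_system P (space \<mu>) (\<lambda>s t. c\<^sup>2 * C s t) (\<lambda>s \<omega>. c * X s \<omega>)"
      by (rule gaussian_system_linear[OF gaussian, of "{()}" _ "\<lambda>t _. t" _ "\<lambda>_ _. c"]) (auto simp: power2_eq_square)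
    show "(\<lambda>(s, \<omega>). c * X s \<omega>) \<in> borel_measurable (\<mu> \<Otimes>\<^sub>M P)"
      using jointly_measurable by (simp add: case_prod_beta')
    show "c\<^sup>2 * C s s \<le> c\<^sup>2 * v" if "s \<in> space \<mu>" for s
      using variance_le[OF that] by (intro mult_left_mono) auto
  qed
qed

context gaussian_field
begin

text \<open>
  Jensen's inequality, in the form of the tangent line of \<open>ln\<close> at the bound \<open>exp (v / 2)\<close> for the mean of
  the partition function.
\<close>
lemma expected_log_partition_le: "(\<integral>\<omega>. log_partition \<omega> \<partial>P) \<le> v / 2"
proof -
  let ?Z = "\<lambda>\<omega>. \<integral>s. exp (X s \<omega>) \<partial>\<mu>"
  have EZ: "(\<integral>\<^sup>+\<omega>. ennreal (?Z \<omega>) \<partial>P) \<le> ennreal (exp (v / 2))"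
  proof -
    have "(\<integral>\<^sup>+\<omega>. ennreal (?Z \<omega>) \<partial>P) = (\<integral>\<^sup>+\<omega>. \<integral>\<^sup>+s. ennreal (exp (1 * X s \<omega>)) \<partial>\<mu> \<partial>P)"
      using AE_integrable_exp[of 1]
      by (intro nn_integral_cong_AE, eventually_elim) (subst nn_integral_eq_integral, auto)
    then show ?thesis using nn_integral_exp_le[of 1] by simp
  qed
  then have iZ: "integrable P ?Z"
    by (intro integrableI_nonneg) (auto intro: order_le_less_trans)
  have "ennreal (\<integral>\<omega>. ?Z \<omega> \<partial>P) \<le> ennreal (exp (v / 2))"
    using EZ iZ by (subst nn_integral_eq_integral[symmetric]) auto
  then have EZ': "(\<integral>\<omega>. ?Z \<omega> \<partial>P) \<le> exp (v / 2)" by simp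
  have "(\<integral>\<omega>. log_partition \<omega> \<partial>P) \<le> (\<integral>\<omega>. exp (- v / 2) * ?Z \<omega> + (v / 2 - 1) \<partial>P)"
  proof (rule integral_mono_AE[OF integrable_log_partition])
    show "integrable P (\<lambda>\<omega>. exp (- v / 2) * ?Z \<omega> + (v / 2 - 1))" using iZ by simp
    show "AE \<omega> in P. log_partition \<omega> \<le> exp (- v / 2) * ?Z \<omega> + (v / 2 - 1)"
      using AE_partition_pos
    proof eventually_elim
      case (elim \<omega>)
      have "ln (exp (- v / 2) * ?Z \<omega>) \<le> exp (- v / 2) * ?Z \<omega> - 1" using elim by (intro ln_le_minus_one) simp
      then show ?case using elim by (simp add: ln_mult log_partition_def)
    qed
  qed
  also have "\<dots> = exp (- v / 2) * (\<integral>\<omega>. ?Z \<omega> \<partial>P) + (v / 2 - 1)"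
    using iZ by (simp add: P.prob_space)
  also have "\<dots> \<le> exp (- v / 2) * exp (v / 2) + (v / 2 - 1)"
    using EZ' by (intro add_right_mono mult_left_mono) auto
  also have "\<dots> = v / 2" by (simp add: exp_add[symmetric])
  finally show ?thesis .
qed

text \<open>
  The log-partition function vanishes at scale \<open>0\<close> and is convex in the scale.  Convexity on
  \<open>[0, c]\<close> gives the lower bound; on \<open>[1, 2]\<close>, together with the annealed bound at scale \<open>2\<close>, it gives the upper
  bound.
\<close>
lemma expected_log_partition_scale:
  assumes c: "1 \<le> c" "c \<le> 2"
  defines "m \<equiv> \<lambda>c. \<integral>\<omega>. ln (\<integral>s. exp (c * X s \<omega>) \<partial>\<mu>) \<partial>P"
  shows "c * m 1 \<le> m c" and "m c \<le> (2 - c) * m 1 + (c - 1) * (2 * v)"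
proof -
  have fld: "gaussian_field \<mu> P (\<lambda>s t. b\<^sup>2 * C s t) (\<lambda>s \<omega>. b * X s \<omega>) (b\<^sup>2 * v)" for b
    by (rule gaussian_field_scale) (rule gaussian_field_axioms)
  have int: "integrable P (\<lambda>\<omega>. ln (\<integral>s. exp (b * X s \<omega>) \<partial>\<mu>))" for b
    using gaussian_field.integrable_log_partition[OF fld] unfolding gaussian_field.log_partition_def[OF fld] .
  have int1: "integrable P (\<lambda>\<omega>. ln (\<integral>s. exp (X s \<omega>) \<partial>\<mu>))" using int[of 1] by simp
  have pos: "AE \<omega> in P. 0 < (\<integral>s. exp (b * X s \<omega>) \<partial>\<mu>)" for b
    by (rule gaussian_field.AE_partition_pos[OF fld])
  have m2: "m 2 \<le> 2 * v"
    using gaussian_field.expected_log_partition_le[OF fld, of 2] unfolding gaussian_field.log_partition_def[OF fld] m_def by simp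
  let ?Z = "\<lambda>b \<omega>. \<integral>s. exp (b * X s \<omega>) \<partial>\<mu>"
  have lo: "AE \<omega> in P. c * ln (?Z 1 \<omega>) \<le> ln (?Z c \<omega>)"
    using pos[of 1] pos[of c] AE_integrable_exp[of 1] AE_integrable_exp[of c]
  proof eventually_elim
    case (elim \<omega>)
    define a where "a = ln (?Z 1 \<omega>)"
    have Z1: "?Z 1 \<omega> = exp a" using elim by (simp add: a_def)
    have "c * exp (u) - c + 1 \<le> exp (c * u)" for u
    proof -
      have "exp u \<le> 1 - 1 / c + 1 / c * exp (c * u)"
        using exp_mult_le_affine[of "1 / c" "c * u"] c by simp
      then have "c * exp u \<le> c * (1 - 1 / c + 1 / c * exp (c * u))" using c by (intro mult_left_mono) auto
      also have "\<dots> = c - 1 + exp (c * u)" using c by (simp add: algebra_simps)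
      finally show ?thesis by simp
    qed
    then have "exp (c * a) * (c * exp (1 * X s \<omega> - a) - c + 1) \<le> exp (c * a) * exp (c * (X s \<omega> - a))" for s
      by (intro mult_left_mono) auto
    then have le: "exp (c * a) * (c * (exp (- a) * exp (1 * X s \<omega>)) - c + 1) \<le> exp (c * X s \<omega>)" for s
      by (simp add: exp_add[symmetric] algebra_simps)
    have "exp (c * a) = exp (c * a) * (c * (exp (- a) * ?Z 1 \<omega>) - c + 1)"
      unfolding Z1 by (simp add: exp_add[symmetric])
    also have "\<dots> = (\<integral>s. exp (c * a) * (c * (exp (- a) * exp (1 * X s \<omega>)) - c + 1) \<partial>\<mu>)"
      using elim(3) by (simp add: index.prob_space)
    also have "\<dots> \<le> ?Z c \<omega>"
      using elim by (intro integral_mono le) auto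
    finally have "ln (exp (c * a)) \<le> ln (?Z c \<omega>)" using elim(2) by (subst ln_le_cancel_iff) auto
    then show ?case by (simp add: a_def)
  qed
  have "c * m 1 = (\<integral>\<omega>. c * ln (?Z 1 \<omega>) \<partial>P)" by (simp add: m_def)
  also have "\<dots> \<le> m c" unfolding m_def by (rule integral_mono_AE) (use int int1 lo in auto)
  finally show "c * m 1 \<le> m c" .
  have up: "AE \<omega> in P. ln (?Z c \<omega>) \<le> (2 - c) * ln (?Z 1 \<omega>) + (c - 1) * ln (?Z 2 \<omega>)"
    using pos[of 1] pos[of 2] pos[of c] AE_integrable_exp[of 1] AE_integrable_exp[of c] AE_integrable_exp[of 2]
  proof eventually_elim
    case (elim \<omega>)
    define a where "a = ln (?Z 1 \<omega>)"
    define b where "b = ln (?Z 2 \<omega>)"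
    define k where "k = (2 - c) * a + (c - 1) * b"
    have Z: "?Z 1 \<omega> = exp a" "?Z 2 \<omega> = exp b" using elim by (simp_all add: a_def b_def)
    have le: "exp (c * X s \<omega>) \<le> exp k * ((2 - c) * (exp (- a) * exp (1 * X s \<omega>)) + (c - 1) * (exp (- b) * exp (2 * X s \<omega>)))" for s
    proof -
      let ?x = "(2 * X s \<omega> - b) - (X s \<omega> - a)"
      have "exp (c * X s \<omega>) = exp k * (exp (X s \<omega> - a) * exp ((c - 1) * ?x))"
        by (simp add: k_def exp_add[symmetric] algebra_simps)
      also have "\<dots> \<le> exp k * (exp (X s \<omega> - a) * (1 - (c - 1) + (c - 1) * exp ?x))"
        using c by (intro mult_left_mono exp_mult_le_affine) auto
      also have "\<dots> = exp k * ((2 - c) * exp (X s \<omega> - a) + (c - 1) * (exp (X s \<omega> - a) * exp ?x))"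
        by (simp add: algebra_simps)
      also have "exp (X s \<omega> - a) * exp ?x = exp (- b) * exp (2 * X s \<omega>)"
        by (simp add: exp_add[symmetric] algebra_simps)
      finally show ?thesis by (simp add: exp_add[symmetric] algebra_simps)
    qed
    have "?Z c \<omega> \<le> (\<integral>s. exp k * ((2 - c) * (exp (- a) * exp (1 * X s \<omega>)) + (c - 1) * (exp (- b) * exp (2 * X s \<omega>))) \<partial>\<mu>)"
      using elim by (intro integral_mono le) auto
    also have "\<dots> = exp k * ((2 - c) * (exp (- a) * ?Z 1 \<omega>) + (c - 1) * (exp (- b) * ?Z 2 \<omega>))"
      using elim by (simp add: Bochner_Integration.integral_add)
    also have "\<dots> = exp k" unfolding Z by (simp add: exp_add[symmetric])
    finally have "ln (?Z c \<omega>) \<le> ln (exp k)" using elim(3) by (subst ln_le_cancel_iff) auto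
    then show ?case by (simp add: k_def a_def b_def)
  qed
  have "m c \<le> (\<integral>\<omega>. (2 - c) * ln (?Z 1 \<omega>) + (c - 1) * ln (?Z 2 \<omega>) \<partial>P)"
    unfolding m_def by (rule integral_mono_AE) (use int int1 up in auto)
  also have "\<dots> = (2 - c) * m 1 + (c - 1) * m 2" by (simp add: int int1 m_def)
  also have "\<dots> \<le> (2 - c) * m 1 + (c - 1) * (2 * v)"
    using m2 c by (intro add_left_mono mult_left_mono) auto
  finally show "m c \<le> (2 - c) * m 1 + (c - 1) * (2 * v)" .
qed

end

lemma centered_normal_eq_distr:
  assumes "0 \<le> s"
  shows "centered_normal s = distr normal01 borel (\<lambda>x. s * x)"
proof (cases "s = 0")
  case True
  interpret prob_space normal01 by (rule prob_space_normal01)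
  show ?thesis using True by (simp add: centered_normal_def distr_const)
next
  case False
  then have s: "0 < s" using assms by simp
  let ?M = "density lborel (normal_density 0 s)"
  interpret M: prob_space ?M using s by (rule prob_space_normal_density)
  have "distributed ?M lborel (\<lambda>x. x) (normal_density 0 s)"
    unfolding distributed_def by (auto simp: distr_id2)
  then have "distributed ?M lborel (\<lambda>x. (x - 0) / s) std_normal_density"
    using M.normal_standard_normal_convert[OF s, of "\<lambda>x. x" 0] by simp
  then have "distr ?M lborel (\<lambda>x. x / s) = normal01" by (simp add: distributed_distr_eq_density)
  then have "distr normal01 borel (\<lambda>x. s * x) = distr (distr ?M lborel (\<lambda>x. x / s)) borel (\<lambda>x. s * x)" by simp
  also have "\<dots> = distr ?M borel (\<lambda>x. x)"
    using s by (subst distr_distr) (auto simp: comp_def)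
  also have "\<dots> = ?M" by (rule distr_id2) simp
  finally show ?thesis using False by (simp add: centered_normal_def)
qed

lemma integral_square_normal01: "integrable normal01 (\<lambda>x. x\<^sup>2)" "(\<integral>x. x\<^sup>2 \<partial>normal01) = 1"
proof -
  have h: "has_bochner_integral lborel (\<lambda>x. std_normal_density x * x ^ (2 * 1)) (fact (2 * 1) / (2 ^ 1 * fact 1))"
    by (rule std_normal_moment_even)
  then have "integrable lborel (\<lambda>x. std_normal_density x * x\<^sup>2)" "(\<integral>x. std_normal_density x * x\<^sup>2 \<partial>lborel) = 1"
    by (auto simp: has_bochner_integral_iff)
  then show "integrable normal01 (\<lambda>x. x\<^sup>2)" "(\<integral>x. x\<^sup>2 \<partial>normal01) = 1"
    by (simp_all add: integrable_density integral_density)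
qed

text \<open>
  The law of a linear combination is a centred normal law by assumption, so its characteristic
  function is determined by its variance.
\<close>
lemma centered_gaussian_field_system:
  assumes F: "centered_gaussian_field M S C X" and sym: "\<And>s t. s \<in> S \<Longrightarrow> t \<in> S \<Longrightarrow> C s t = C t s"
  shows "gaussian_system M S C X"
proof (rule gaussian_systemI)
  show ps: "prob_space M" using F by (simp add: centered_gaussian_field_def)
  interpret prob_space M by (rule ps)
  show meas: "X s \<in> borel_measurable M" if "s \<in> S" for s using F that by (simp add: centered_gaussian_field_def)
  have law: "\<exists>w\<ge>0. distr M borel (\<lambda>\<omega>. \<Sum>x\<in>A. a x * X x \<omega>) = distr normal01 borel (\<lambda>x. w * x)" if "finite A" "A \<subseteq> S" for A a
    using F that centered_normal_eq_distr unfolding centered_gaussian_field_def by metis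
  have sq: "integrable M (\<lambda>\<omega>. (X x \<omega>)\<^sup>2)" if x: "x \<in> S" for x
  proof -
    obtain w where "distr M borel (\<lambda>\<omega>. \<Sum>x\<in>{x}. 1 * X x \<omega>) = distr normal01 borel (\<lambda>x. w * x)"
      using law[of "{x}" "\<lambda>_. 1"] x by auto
    then have d: "distr M borel (X x) = distr normal01 borel (\<lambda>x. w * x)" by simp
    have "integrable normal01 (\<lambda>x. (w * x)\<^sup>2)" using integral_square_normal01 by (simp add: power_mult_distrib)
    then show ?thesis
      using integrable_eq_of_distr_eq[OF d meas[OF x], of "\<lambda>x. x\<^sup>2"] by simp
  qed
  have prod: "integrable M (\<lambda>\<omega>. X x \<omega> * X y \<omega>)" if xy: "x \<in> S" "y \<in> S" for x y
  proof (rule Bochner_Integration.integrable_bound)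
    show "integrable M (\<lambda>\<omega>. (X x \<omega>)\<^sup>2 + (X y \<omega>)\<^sup>2)" using sq xy by simp
    show "(\<lambda>\<omega>. X x \<omega> * X y \<omega>) \<in> borel_measurable M" using meas xy by simp
    have "\<bar>p * q\<bar> \<le> p\<^sup>2 + q\<^sup>2" for p q :: real
    proof -
      have "0 \<le> (\<bar>p\<bar> - \<bar>q\<bar>)\<^sup>2" by simp
      then have "2 * \<bar>p * q\<bar> \<le> p\<^sup>2 + q\<^sup>2" by (simp add: power2_eq_square abs_mult algebra_simps)
      then show ?thesis by simp
    qed
    then show "AE \<omega> in M. norm (X x \<omega> * X y \<omega>) \<le> norm ((X x \<omega>)\<^sup>2 + (X y \<omega>)\<^sup>2)" by simp
  qed
  fix A a assume A: "finite A" "A \<subseteq> S"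
  let ?T = "\<lambda>\<omega>. \<Sum>x\<in>A. a x * X x \<omega>"
  have T: "?T \<in> borel_measurable M" using meas A by (intro borel_measurable_sum borel_measurable_times) auto
  obtain w where w: "0 \<le> w" "distr M borel ?T = distr normal01 borel (\<lambda>x. w * x)"
    using law[OF A, of a] by auto
  have "(\<integral>\<omega>. (?T \<omega>)\<^sup>2 \<partial>M) = (\<integral>x. (w * x)\<^sup>2 \<partial>normal01)"
    by (rule integral_eq_of_distr_eq[OF w(2) T, of "\<lambda>x. x\<^sup>2"]) auto
  then have "w\<^sup>2 = (\<integral>\<omega>. (?T \<omega>)\<^sup>2 \<partial>M)"
    using integral_square_normal01 by (simp add: power_mult_distrib)
  also have "\<dots> = (\<integral>\<omega>. (\<Sum>x\<in>A. \<Sum>y\<in>A. a x * a y * (X x \<omega> * X y \<omega>)) \<partial>M)"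
    by (simp add: power2_eq_square sum_product ac_simps)
  also have "\<dots> = (\<Sum>x\<in>A. \<Sum>y\<in>A. a x * a y * (\<integral>\<omega>. X x \<omega> * X y \<omega> \<partial>M))"
    using prod A by (subst Bochner_Integration.integral_sum, fastforce intro!: Bochner_Integration.integrable_sum integrable_mult_right,
      intro sum.cong refl, subst Bochner_Integration.integral_sum) (auto intro!: integrable_mult_right)
  also have "\<dots> = (\<Sum>x\<in>A. \<Sum>y\<in>A. a x * a y * C x y)"
    using F A by (intro sum.cong refl) (auto simp: centered_gaussian_field_def subset_iff)
  finally have w2: "w\<^sup>2 = (\<Sum>x\<in>A. \<Sum>y\<in>A. a x * a y * C x y)" .
  have "(\<integral>\<omega>. cis (?T \<omega>) \<partial>M) = (\<integral>x. cis (w * x) \<partial>normal01)"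
    by (rule integral_eq_of_distr_eq[OF w(2) T, of cis]) auto
  then show "(\<integral>\<omega>. cis (?T \<omega>) \<partial>M) = complex_of_real (exp (- (\<Sum>x\<in>A. \<Sum>y\<in>A. a x * a y * C x y) / 2))"
    by (simp add: integral_cis_normal01 w2)
qed (use sym in auto)

section \<open>Spheres and bands parametrised by Gaussian vectors\<close>

lemma prob_space_restrict_AE:
  assumes "prob_space \<mu>" "A \<in> sets \<mu>" "AE x in \<mu>. x \<in> A"
  shows "prob_space (restrict_space \<mu> A)"
proof (rule prob_spaceI)
  interpret prob_space \<mu> by fact
  have "emeasure \<mu> A = 1" using assms by (intro emeasure_eq_1_AE)
  then show "emeasure (restrict_space \<mu> A) (space (restrict_space \<mu> A)) = 1"
    using assms(2) sets.sets_into_space[OF assms(2)]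
    by (simp add: emeasure_restrict_space space_restrict_space Int_absorb2)
qed

lemma integral_restrict_AE:
  fixes f :: "'s \<Rightarrow> real"
  assumes A: "A \<in> sets \<mu>" "AE x in \<mu>. x \<in> A" and f: "f \<in> borel_measurable \<mu>"
  shows "(\<integral>x. f x \<partial>restrict_space \<mu> A) = (\<integral>x. f x \<partial>\<mu>)"
proof -
  have "(\<integral>x. f x \<partial>restrict_space \<mu> A) = (\<integral>x. indicator A x *\<^sub>R f x \<partial>\<mu>)"
    using A by (intro integral_restrict_space) auto
  also have "\<dots> = (\<integral>x. f x \<partial>\<mu>)"
    using A f by (intro integral_cong_AE) (auto elim: eventually_mono)
  finally show ?thesis .
qed

definition sphere_point :: "nat \<Rightarrow> (nat \<Rightarrow> real) \<Rightarrow> nat \<Rightarrow> real" where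
  "sphere_point N = on_sphere N (\<lambda>x. x) (\<lambda>_. 0) (sqrt (real N))"

definition band_point :: "nat \<Rightarrow> (nat \<Rightarrow> real) \<Rightarrow> real \<Rightarrow> (nat \<Rightarrow> real) \<Rightarrow> nat \<Rightarrow> real" where
  "band_point N \<sigma> r = on_sphere N (orth_proj N \<sigma>) (\<lambda>i. r * \<sigma> i) (sqrt (real N * (1 - r\<^sup>2)))"

lemma measurable_sphere_point [measurable]: "sphere_point N \<in> measurable (std_gaussian N) (vec_space N)"
  unfolding sphere_point_def by (rule measurable_on_sphere) simp

lemma measurable_band_point [measurable]: "band_point N \<sigma> r \<in> measurable (std_gaussian N) (vec_space N)"
  unfolding band_point_def by (rule measurable_on_sphere) (rule measurable_orth_proj)

definition cosine :: "nat \<Rightarrow> (nat \<Rightarrow> real) \<Rightarrow> (nat \<Rightarrow> real) \<Rightarrow> real" where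
  "cosine N x y = dot N x y / (vnorm N x * vnorm N y)"

lemma dot_sphere_point:
  assumes "0 < N"
  shows "dot N (sphere_point N g) (sphere_point N g') / real N = cosine N g g'"
proof -
  have "dot N (sphere_point N g) (sphere_point N g') = (\<Sum>i<N. real N * (g i * g' i) / (vnorm N g * vnorm N g'))"
    unfolding dot_def by (intro sum.cong refl) (simp add: sphere_point_def on_sphere_def)
  also have "\<dots> = real N * cosine N g g'"
    by (simp add: cosine_def dot_def sum_distrib_left sum_divide_distrib)
  finally show ?thesis using assms by simp
qed

lemma dot_band_point:
  assumes \<sigma>: "\<sigma> \<in> spin_sphere N" and N: "0 < N" and r: "\<bar>r\<bar> < 1"
  shows "dot N (band_point N \<sigma> r g) (band_point N \<sigma> r g') / real N
    = r\<^sup>2 + (1 - r\<^sup>2) * cosine N (orth_proj N \<sigma> g) (orth_proj N \<sigma> g')"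
proof -
  define p where "p = orth_proj N \<sigma> g"
  define p' where "p' = orth_proj N \<sigma> g'"
  define \<rho> where "\<rho> = sqrt (real N * (1 - r\<^sup>2))"
  define c where "c = \<rho> / vnorm N p"
  define c' where "c' = \<rho> / vnorm N p'"
  have ss: "dot N \<sigma> \<sigma> = real N" using \<sigma> by (simp add: spin_sphere_def vnorm_def)
  then have ss0: "dot N \<sigma> \<sigma> \<noteq> 0" using N by simp
  have sp: "dot N \<sigma> p = 0" "dot N \<sigma> p' = 0"
    unfolding p_def p'_def by (rule dot_orth_proj[OF ss0])+
  have \<rho>2: "\<rho> * \<rho> = real N * (1 - r\<^sup>2)"
    using r by (simp add: \<rho>_def abs_square_le_1)
  have "dot N (band_point N \<sigma> r g) (band_point N \<sigma> r g') = (\<Sum>i<N. (r * \<sigma> i + c * p i) * (r * \<sigma> i + c' * p' i))"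
    unfolding dot_def by (intro sum.cong refl) (simp add: band_point_def on_sphere_def c_def c'_def p_def p'_def \<rho>_def)
  also have "\<dots> = (\<Sum>i<N. r\<^sup>2 * (\<sigma> i * \<sigma> i) + r * c' * (\<sigma> i * p' i) + r * c * (\<sigma> i * p i) + c * c' * (p i * p' i))"
    by (intro sum.cong refl) (simp add: algebra_simps power2_eq_square)
  also have "\<dots> = r\<^sup>2 * dot N \<sigma> \<sigma> + r * c' * dot N \<sigma> p' + r * c * dot N \<sigma> p + c * c' * dot N p p'"
    unfolding dot_def by (simp only: sum.distrib sum_distrib_left)
  also have "c * c' * dot N p p' = \<rho> * \<rho> * cosine N p p'"
    by (simp add: c_def c'_def cosine_def)
  finally have "dot N (band_point N \<sigma> r g) (band_point N \<sigma> r g') = real N * (r\<^sup>2 + (1 - r\<^sup>2) * cosine N p p')"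
    unfolding \<rho>2 by (simp add: ss sp algebra_simps)
  then show ?thesis using N by (simp add: p_def p'_def)
qed

lemma dot_band_point_center:
  assumes \<sigma>: "\<sigma> \<in> spin_sphere N" and N: "0 < N" and r: "\<bar>r\<bar> < 1" and g: "vnorm N (orth_proj N \<sigma> g) \<noteq> 0"
  shows "dot N \<sigma> (band_point N \<sigma> r g) / real N = r"
  using on_sphere_in_band[OF \<sigma> N r g] by (simp add: band_point_def band_def dot_commute)

lemma dot_orth_proj_orth_proj:
  assumes \<sigma>: "\<sigma> \<in> spin_sphere N" and N: "0 < N"
  shows "dot N (orth_proj N \<sigma> g) (orth_proj N \<sigma> g') = dot N g g' - dot N g \<sigma> * dot N g' \<sigma> / real N"
proof -
  have ss: "dot N \<sigma> \<sigma> = real N" using \<sigma> by (simp add: spin_sphere_def vnorm_def)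
  define a where "a = dot N g \<sigma> / real N"
  define b where "b = dot N g' \<sigma> / real N"
  have "dot N (orth_proj N \<sigma> g) (orth_proj N \<sigma> g') = (\<Sum>i<N. g i * g' i - b * (g i * \<sigma> i) - a * (g' i * \<sigma> i) + a * b * (\<sigma> i * \<sigma> i))"
    unfolding dot_def[of N "orth_proj N \<sigma> g"] by (intro sum.cong refl) (simp add: orth_proj_def ss a_def b_def algebra_simps)
  also have "\<dots> = dot N g g' - b * dot N g \<sigma> - a * dot N g' \<sigma> + a * b * dot N \<sigma> \<sigma>"
    unfolding dot_def by (simp only: sum.distrib sum_subtractf sum_distrib_left)
  finally show ?thesis using N by (simp add: ss a_def b_def)
qed

text \<open>
  Coordinates of the hyperplane orthogonal to \<open>\<sigma>\<close>, from an orthogonal matrix whose last row is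
  \<open>\<sigma> / sqrt N\<close>.  They preserve the inner products of the projections and turn a standard Gaussian vector of
  dimension \<open>n + 1\<close> into one of dimension \<open>n\<close>, so bands can be compared with spheres of one dimension less.
\<close>
lemma orth_complement_coordinates:
  assumes \<sigma>: "\<sigma> \<in> spin_sphere (Suc n)"
  obtains y where "y \<in> measurable (std_gaussian (Suc n)) (vec_space n)"
    and "distr (std_gaussian (Suc n)) (vec_space n) y = std_gaussian n"
    and "\<And>g g'. dot n (y g) (y g') = dot (Suc n) (orth_proj (Suc n) \<sigma> g) (orth_proj (Suc n) \<sigma> g')"
proof -
  let ?N = "Suc n"
  have ss: "dot ?N \<sigma> \<sigma> = real ?N" using \<sigma> by (simp add: spin_sphere_def vnorm_def)
  define u where "u = (\<lambda>i. \<sigma> i / sqrt (real ?N))"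
  have "(\<Sum>i<?N. (u i)\<^sup>2) = dot ?N \<sigma> \<sigma> / real ?N"
    unfolding dot_def sum_divide_distrib by (intro sum.cong refl) (simp add: u_def power_divide power2_eq_square)
  then have "(\<Sum>i<?N. (u i)\<^sup>2) = 1" using ss by simp
  then obtain R :: "nat \<Rightarrow> nat \<Rightarrow> real" where sym: "\<And>i j. R i j = R j i"
    and orth: "\<And>i j. i < ?N \<Longrightarrow> j < ?N \<Longrightarrow> (\<Sum>k<?N. R i k * R j k) = (if i = j then 1 else 0)"
    and last: "\<And>j. j < ?N \<Longrightarrow> R n j = u j"
    by (rule householder_reflection) blast
  have orth': "(\<Sum>k<?N. R k i * R k j) = (if i = j then 1 else 0)" if "i < ?N" "j < ?N" for i j
  proof -
    have "(\<Sum>k<?N. R k i * R k j) = (\<Sum>k<?N. R i k * R j k)" by (intro sum.cong refl) (metis sym)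
    then show ?thesis using orth[OF that] by simp
  qed
  define y where "y = (\<lambda>g. \<lambda>i\<in>{..<n}. \<Sum>j<?N. R i j * g j)"
  show thesis
  proof (rule that[of y])
    show "y \<in> measurable (std_gaussian ?N) (vec_space n)"
      unfolding y_def by (intro measurable_restrict borel_measurable_sum borel_measurable_times borel_measurable_const measurable_coord_std_gaussian) auto
    show "distr (std_gaussian ?N) (vec_space n) y = std_gaussian n"
      unfolding y_def by (rule std_gaussian_orthonormal_image) (use orth in auto)
    fix g g'
    let ?c = "\<lambda>g i. \<Sum>j<?N. R i j * g j"
    have "(\<Sum>i<?N. ?c g i * ?c g' i) = (\<Sum>i<?N. \<Sum>j<?N. \<Sum>j'<?N. g j * g' j' * (R i j * R i j'))"
      unfolding sum_product by (intro sum.cong refl) (simp only: ac_simps)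
    also have "\<dots> = (\<Sum>j<?N. \<Sum>i<?N. \<Sum>j'<?N. g j * g' j' * (R i j * R i j'))"
      by (rule sum.swap)
    also have "\<dots> = (\<Sum>j<?N. \<Sum>j'<?N. \<Sum>i<?N. g j * g' j' * (R i j * R i j'))"
      by (rule sum.cong[OF refl sum.swap])
    also have "\<dots> = (\<Sum>j<?N. \<Sum>j'<?N. g j * g' j' * (if j = j' then 1 else 0))"
      unfolding sum_distrib_left[symmetric] by (intro sum.cong refl arg_cong2[where f="(*)"] orth') auto
    also have "\<dots> = dot ?N g g'"
      unfolding dot_def by (intro sum.cong refl sum_mult_delta) auto
    finally have full: "(\<Sum>i<?N. ?c g i * ?c g' i) = dot ?N g g'" .
    have cn: "?c h n = dot ?N h \<sigma> / sqrt (real ?N)" for h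
      unfolding dot_def sum_divide_distrib using last by (intro sum.cong refl) (simp add: u_def)
    have "dot n (y g) (y g') = (\<Sum>i<n. ?c g i * ?c g' i)"
      unfolding dot_def by (intro sum.cong refl) (simp add: y_def)
    also have "\<dots> = dot ?N g g' - ?c g n * ?c g' n" using full by (simp only: sum.lessThan_Suc)
    also have "\<dots> = dot ?N g g' - dot ?N g \<sigma> * dot ?N g' \<sigma> / real ?N"
      unfolding cn by (simp only: times_divide_times_eq real_sqrt_mult_self abs_of_nat)
    finally show "dot n (y g) (y g') = dot ?N (orth_proj ?N \<sigma> g) (orth_proj ?N \<sigma> g')"
      by (simp add: dot_orth_proj_orth_proj[OF \<sigma>])
  qed
qed

lemma measurable_vnorm_std_gaussian:
  assumes "\<And>i. i < N \<Longrightarrow> (\<lambda>g. f g i) \<in> borel_measurable K"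
  shows "(\<lambda>g. vnorm N (f g)) \<in> borel_measurable K"
  unfolding vnorm_def using assms by (intro measurable_compose[OF _ borel_measurable_sqrt] measurable_dot) auto

lemma measurable_orth_proj_std_gaussian:
  "i < N \<Longrightarrow> (\<lambda>g. orth_proj N \<sigma> g i) \<in> borel_measurable (std_gaussian N)"
  using measurable_orth_proj[of i N \<sigma>] by (subst measurable_cong_sets[OF sets_std_gaussian refl])

text \<open>
  The sphere and the band are images of Gaussian vectors, so fields on them are regarded as fields
  indexed by Gaussian vectors.  The null set on which the normalisation divides by zero, and on which the image would lie off
  the sphere, is removed.
\<close>
definition sphere_index :: "nat \<Rightarrow> (nat \<Rightarrow> real) measure" where
  "sphere_index N = restrict_space (std_gaussian N) {g \<in> space (std_gaussian N). vnorm N g \<noteq> 0}"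

definition band_index :: "nat \<Rightarrow> (nat \<Rightarrow> real) \<Rightarrow> (nat \<Rightarrow> real) measure" where
  "band_index N \<sigma> = restrict_space (std_gaussian N) {g \<in> space (std_gaussian N). vnorm N (orth_proj N \<sigma> g) \<noteq> 0}"

lemma sphere_index_set:
  "{g \<in> space (std_gaussian N). vnorm N g \<noteq> 0} \<in> sets (std_gaussian N)"
proof -
  have [measurable]: "(\<lambda>g. vnorm N g) \<in> borel_measurable (std_gaussian N)"
    by (intro measurable_vnorm_std_gaussian measurable_coord_std_gaussian)
  show ?thesis by measurable
qed

lemma band_index_set:
  "{g \<in> space (std_gaussian N). vnorm N (orth_proj N \<sigma> g) \<noteq> 0} \<in> sets (std_gaussian N)"
proof -
  have [measurable]: "(\<lambda>g. vnorm N (orth_proj N \<sigma> g)) \<in> borel_measurable (std_gaussian N)"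
    by (intro measurable_vnorm_std_gaussian measurable_orth_proj_std_gaussian)
  show ?thesis by measurable
qed

lemma sphere_index_AE:
  assumes "0 < N"
  shows "AE g in std_gaussian N. g \<in> {g \<in> space (std_gaussian N). vnorm N g \<noteq> 0}"
  using AE_std_gaussian_vnorm[OF assms] AE_space by eventually_elim simp

lemma band_index_AE:
  assumes \<sigma>: "\<sigma> \<in> spin_sphere (Suc n)" and n: "0 < n"
  shows "AE g in std_gaussian (Suc n). g \<in> {g \<in> space (std_gaussian (Suc n)). vnorm (Suc n) (orth_proj (Suc n) \<sigma> g) \<noteq> 0}"
proof -
  obtain y where y: "y \<in> measurable (std_gaussian (Suc n)) (vec_space n)"
     "distr (std_gaussian (Suc n)) (vec_space n) y = std_gaussian n"
     "\<And>g g'. dot n (y g) (y g') = dot (Suc n) (orth_proj (Suc n) \<sigma> g) (orth_proj (Suc n) \<sigma> g')"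
    using orth_complement_coordinates[OF \<sigma>] by metis
  have "AE g in distr (std_gaussian (Suc n)) (vec_space n) y. vnorm n g \<noteq> 0"
    unfolding y(2) by (rule AE_std_gaussian_vnorm[OF n])
  then have "AE g in std_gaussian (Suc n). vnorm n (y g) \<noteq> 0" by (rule AE_distrD[OF y(1)])
  then show ?thesis using AE_space by eventually_elim (simp add: vnorm_def y(3))
qed

lemma prob_space_sphere_index: "0 < N \<Longrightarrow> prob_space (sphere_index N)"
  unfolding sphere_index_def
  by (intro prob_space_restrict_AE prob_space_std_gaussian sphere_index_set sphere_index_AE)

lemma prob_space_band_index: "\<sigma> \<in> spin_sphere (Suc n) \<Longrightarrow> 0 < n \<Longrightarrow> prob_space (band_index (Suc n) \<sigma>)"
  unfolding band_index_def
  by (intro prob_space_restrict_AE prob_space_std_gaussian band_index_set band_index_AE)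

lemma measurable_sphere_point_index: "sphere_point N \<in> measurable (sphere_index N) (vec_space N)"
  unfolding sphere_index_def by (intro measurable_restrict_space1) measurable

lemma measurable_band_point_index: "band_point N \<sigma> r \<in> measurable (band_index N \<sigma>) (vec_space N)"
  unfolding band_index_def by (intro measurable_restrict_space1) measurable

lemma sphere_point_in_sphere: "g \<in> space (sphere_index N) \<Longrightarrow> sphere_point N g \<in> spin_sphere N"
  unfolding sphere_point_def sphere_index_def by (intro on_sphere_in_spin_sphere) (auto simp: space_restrict_space)

lemma band_point_in_band:
  "\<sigma> \<in> spin_sphere N \<Longrightarrow> 0 < N \<Longrightarrow> \<bar>r\<bar> < 1 \<Longrightarrow> g \<in> space (band_index N \<sigma>) \<Longrightarrow> band_point N \<sigma> r g \<in> band N \<sigma> r"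
  unfolding band_point_def band_index_def by (intro on_sphere_in_band) (auto simp: space_restrict_space)

lemma band_point_in_sphere:
  "\<sigma> \<in> spin_sphere N \<Longrightarrow> 0 < N \<Longrightarrow> \<bar>r\<bar> < 1 \<Longrightarrow> g \<in> space (band_index N \<sigma>) \<Longrightarrow> band_point N \<sigma> r g \<in> spin_sphere N"
  using band_point_in_band[of \<sigma> N r g] by (simp add: band_def)

lemma integral_sphere_measure:
  fixes f :: "(nat \<Rightarrow> real) \<Rightarrow> real"
  assumes N: "0 < N" and f[measurable]: "f \<in> borel_measurable (vec_space N)"
  shows "(\<integral>\<sigma>. f \<sigma> \<partial>sphere_measure N) = (\<integral>g. f (sphere_point N g) \<partial>sphere_index N)"
proof -
  have "(\<integral>\<sigma>. f \<sigma> \<partial>sphere_measure N) = (\<integral>g. f (sphere_point N g) \<partial>std_gaussian N)"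
    unfolding sphere_measure_def uniform_sphere_def sphere_point_def[symmetric]
    by (rule integral_distr) measurable
  also have "\<dots> = (\<integral>g. f (sphere_point N g) \<partial>sphere_index N)"
    unfolding sphere_index_def
    by (rule integral_restrict_AE[symmetric, OF sphere_index_set sphere_index_AE[OF N]]) measurable
  finally show ?thesis .
qed

lemma integral_band_measure:
  fixes f :: "(nat \<Rightarrow> real) \<Rightarrow> real"
  assumes \<sigma>: "\<sigma> \<in> spin_sphere (Suc n)" and n: "0 < n" and f[measurable]: "f \<in> borel_measurable (vec_space (Suc n))"
  shows "(\<integral>\<sigma>'. f \<sigma>' \<partial>band_measure (Suc n) \<sigma> r) = (\<integral>g. f (band_point (Suc n) \<sigma> r g) \<partial>band_index (Suc n) \<sigma>)"
proof -
  have "(\<integral>\<sigma>'. f \<sigma>' \<partial>band_measure (Suc n) \<sigma> r) = (\<integral>g. f (band_point (Suc n) \<sigma> r g) \<partial>std_gaussian (Suc n))"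
    unfolding band_measure_def uniform_sphere_def band_point_def[symmetric]
    by (rule integral_distr) measurable
  also have "\<dots> = (\<integral>g. f (band_point (Suc n) \<sigma> r g) \<partial>band_index (Suc n) \<sigma>)"
    unfolding band_index_def
    by (rule integral_restrict_AE[symmetric, OF band_index_set band_index_AE[OF \<sigma> n]]) measurable
  finally show ?thesis .
qed

lemma measurable_random_function_at_point:
  assumes F: "(\<lambda>(\<sigma>, \<omega>). F \<sigma> \<omega>) \<in> borel_measurable (vec_space N \<Otimes>\<^sub>M M)" and pt: "pt \<in> measurable \<mu> (vec_space N)"
  shows "(\<lambda>(g, \<omega>). F (pt g) \<omega> :: real) \<in> borel_measurable (\<mu> \<Otimes>\<^sub>M M)"
proof -
  have "(\<lambda>z. (pt (fst z), snd z)) \<in> measurable (\<mu> \<Otimes>\<^sub>M M) (vec_space N \<Otimes>\<^sub>M M)"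
    by (intro measurable_Pair measurable_compose[OF measurable_fst pt] measurable_snd)
  from measurable_compose[OF this F] show ?thesis by (simp add: case_prod_beta')
qed

lemma hamiltonian_field:
  assumes \<gamma>: "mixture_coeffs \<gamma>" "mixture \<gamma> 1 = 1" and J: "disorder M J" and N: "0 < N"
    and \<mu>: "prob_space \<mu>" and pt: "pt \<in> measurable \<mu> (vec_space N)" "\<And>g. g \<in> space \<mu> \<Longrightarrow> pt g \<in> spin_sphere N"
    and v: "c\<^sup>2 * real N \<le> v"
  shows "gaussian_field \<mu> M (\<lambda>g g'. c\<^sup>2 * (real N * mixture \<gamma> (dot N (pt g) (pt g') / real N)))
    (\<lambda>g \<omega>. c * hamiltonian \<gamma> N (\<lambda>l. J N l \<omega>) (pt g)) v"
proof -
  interpret \<mu>: prob_space \<mu> by fact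
  have "gaussian_field \<mu> M (\<lambda>g g'. real N * mixture \<gamma> (dot N (pt g) (pt g') / real N))
    (\<lambda>g \<omega>. hamiltonian \<gamma> N (\<lambda>l. J N l \<omega>) (pt g)) (real N)"
  proof
    show "gaussian_system M (space \<mu>) (\<lambda>g g'. real N * mixture \<gamma> (dot N (pt g) (pt g') / real N)) (\<lambda>g \<omega>. hamiltonian \<gamma> N (\<lambda>l. J N l \<omega>) (pt g))"
      by (rule gaussian_system_reindex[OF hamiltonian_gaussian[OF \<gamma>(1) J N] pt(2)]) auto
    show "(\<lambda>(g, \<omega>). hamiltonian \<gamma> N (\<lambda>l. J N l \<omega>) (pt g)) \<in> borel_measurable (\<mu> \<Otimes>\<^sub>M M)"
      by (rule measurable_random_function_at_point[OF measurable_hamiltonian[OF J] pt(1)])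
    show "real N * mixture \<gamma> (dot N (pt g) (pt g) / real N) \<le> real N" if "g \<in> space \<mu>" for g
      using pt(2)[OF that] N \<gamma>(2) by (simp add: spin_sphere_def vnorm_def)
  qed
  from gaussian_field_scale[OF this, of c] interpret F: gaussian_field \<mu> M
    "\<lambda>g g'. c\<^sup>2 * (real N * mixture \<gamma> (dot N (pt g) (pt g') / real N))" "\<lambda>g \<omega>. c * hamiltonian \<gamma> N (\<lambda>l. J N l \<omega>) (pt g)" "c\<^sup>2 * real N" .
  show ?thesis
    by standard (use F.gaussian F.jointly_measurable F.variance_le v in \<open>auto intro: order_trans\<close>)
qed

lemma shifted_field:
  assumes X: "shifted_model \<gamma> q M' H'" and N: "0 < N"
  shows "gaussian_field (sphere_index N) M'
    (\<lambda>g g'. real N * shifted_mixture \<gamma> q (cosine N g g')) (\<lambda>g \<omega>. H' N (sphere_point N g) \<omega>) (real N * shifted_mixture \<gamma> q 1)"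
proof -
  interpret prob_space "sphere_index N" by (rule prob_space_sphere_index[OF N])
  have F: "centered_gaussian_field M' (spin_sphere N) (\<lambda>\<sigma> \<sigma>'. real N * shifted_mixture \<gamma> q (dot N \<sigma> \<sigma>' / real N)) (H' N)"
    and m: "(\<lambda>(\<sigma>, \<omega>). H' N \<sigma> \<omega>) \<in> borel_measurable (vec_space N \<Otimes>\<^sub>M M')"
    using X N unfolding shifted_model_def by (auto simp: Suc_le_eq)
  have G: "gaussian_system M' (spin_sphere N) (\<lambda>\<sigma> \<sigma>'. real N * shifted_mixture \<gamma> q (dot N \<sigma> \<sigma>' / real N)) (H' N)"
    by (rule centered_gaussian_field_system[OF F]) (simp add: dot_commute)
  show ?thesis
  proof
    show "gaussian_system M' (space (sphere_index N)) (\<lambda>g g'. real N * shifted_mixture \<gamma> q (cosine N g g')) (\<lambda>g \<omega>. H' N (sphere_point N g) \<omega>)"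
      by (rule gaussian_system_reindex[OF G sphere_point_in_sphere]) (auto simp: dot_sphere_point[OF N])
    show "(\<lambda>(g, \<omega>). H' N (sphere_point N g) \<omega>) \<in> borel_measurable (sphere_index N \<Otimes>\<^sub>M M')"
      by (rule measurable_random_function_at_point[OF m measurable_sphere_point_index])
    show "real N * shifted_mixture \<gamma> q (cosine N g g) \<le> real N * shifted_mixture \<gamma> q 1" if "g \<in> space (sphere_index N)" for g
      using sphere_point_in_sphere[OF that] N unfolding dot_sphere_point[OF N, symmetric]
      by (simp add: spin_sphere_def vnorm_def)
  qed
qed

lemma normal_gaussian_system:
  "gaussian_system normal01 S (\<lambda>_ _. 1) (\<lambda>_ z. z)"
proof (rule gaussian_systemI)
  fix A :: "'a set" and a
  have "(\<integral>z. cis (\<Sum>x\<in>A. a x * z) \<partial>normal01) = complex_of_real (exp (- (\<Sum>x\<in>A. a x)\<^sup>2 / 2))"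
    unfolding sum_distrib_right[symmetric] by (rule integral_cis_normal01)
  then show "(\<integral>z. cis (\<Sum>x\<in>A. a x * z) \<partial>normal01) = complex_of_real (exp (- (\<Sum>x\<in>A. \<Sum>y\<in>A. a x * a y * 1) / 2))"
    by (simp add: power2_eq_square sum_product)
qed (auto simp: prob_space_normal01)

text \<open>
  Adding the same independent normal variable of variance \<open>b\<close> to all values adds the constant \<open>b\<close> to the
  covariance.
\<close>
lemma gaussian_field_add_common_normal:
  assumes X: "gaussian_field \<mu> P C X v" and b: "0 \<le> b"
  shows "gaussian_field \<mu> (P \<Otimes>\<^sub>M normal01) (\<lambda>s t. C s t + b) (\<lambda>s \<omega>. X s (fst \<omega>) + sqrt b * snd \<omega>) (v + b)"
proof -
  interpret X: gaussian_field \<mu> P C X v by fact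
  show ?thesis
  proof
    show "gaussian_system (P \<Otimes>\<^sub>M normal01) (space \<mu>) (\<lambda>s t. C s t + b) (\<lambda>s \<omega>. X s (fst \<omega>) + sqrt b * snd \<omega>)"
      by (rule gaussian_system_linear[OF gaussian_system_product[OF X.gaussian normal_gaussian_system], of "UNIV :: bool set" _ "\<lambda>t k. (k, t)" _ "\<lambda>_ k. if k then 1 else sqrt b"])
        (use b in \<open>auto simp: UNIV_bool\<close>)
    have "(\<lambda>z. X (fst z) (fst (snd z)) + sqrt b * snd (snd z)) \<in> borel_measurable (\<mu> \<Otimes>\<^sub>M (P \<Otimes>\<^sub>M normal01))"
      by measurable
    then show "(\<lambda>(s, \<omega>). X s (fst \<omega>) + sqrt b * snd \<omega>) \<in> borel_measurable (\<mu> \<Otimes>\<^sub>M (P \<Otimes>\<^sub>M normal01))"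
      by (simp add: case_prod_beta')
    show "C s s + b \<le> v + b" if "s \<in> space \<mu>" for s using X.variance_le[OF that] by simp
  qed
qed

text \<open>
  The common variable factors out of the partition function and has mean \<open>0\<close>.
\<close>
lemma expected_log_partition_common_normal:
  assumes X: "gaussian_field \<mu> P C X v" and b: "0 \<le> b"
  shows "(\<integral>\<omega>. ln (\<integral>s. exp (X s (fst \<omega>) + sqrt b * snd \<omega>) \<partial>\<mu>) \<partial>(P \<Otimes>\<^sub>M normal01)) = (\<integral>\<omega>. ln (\<integral>s. exp (X s \<omega>) \<partial>\<mu>) \<partial>P)"
proof -
  interpret X: gaussian_field \<mu> P C X v by fact
  interpret Y: gaussian_field \<mu> "P \<Otimes>\<^sub>M normal01" "\<lambda>s t. C s t + b" "\<lambda>s \<omega>. X s (fst \<omega>) + sqrt b * snd \<omega>" "v + b"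
    by (rule gaussian_field_add_common_normal[OF X b])
  interpret N: prob_space normal01 by (rule prob_space_normal01)
  interpret PN: pair_prob_space P normal01 ..
  have i1: "integrable normal01 (\<lambda>x. x)"
  proof (rule Bochner_Integration.integrable_bound)
    show "integrable normal01 (\<lambda>x. 1 + x\<^sup>2)" using integral_square_normal01 by simp
    have "\<bar>x\<bar> \<le> 1 + x\<^sup>2" for x :: real
      using sum_squares_ge_zero[of "\<bar>x\<bar> - 1" 0] zero_le_power2[of x] by (simp add: power2_eq_square algebra_simps abs_mult[symmetric])
    then show "AE x in normal01. norm x \<le> norm (1 + x\<^sup>2)" by (simp add: add_nonneg_nonneg)
  qed simp
  have i2: "(\<integral>x. x \<partial>normal01) = 0"
    using integral_std_normal_distribution_moment_odd[of 1] by simp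
  have "(\<integral>\<omega>. ln (\<integral>s. exp (X s (fst \<omega>) + sqrt b * snd \<omega>) \<partial>\<mu>) \<partial>(P \<Otimes>\<^sub>M normal01))
     = (\<integral>x. \<integral>z. ln (\<integral>s. exp (X s x + sqrt b * z) \<partial>\<mu>) \<partial>normal01 \<partial>P)"
  proof -
    have "Y.log_partition = (\<lambda>\<omega>. ln (\<integral>s. exp (X s (fst \<omega>) + sqrt b * snd \<omega>) \<partial>\<mu>))"
      by (rule ext) (rule Y.log_partition_def)
    then show ?thesis using PN.integral_fst'[OF Y.integrable_log_partition] by simp
  qed
  also have "\<dots> = (\<integral>x. ln (\<integral>s. exp (X s x) \<partial>\<mu>) \<partial>P)"
  proof (rule integral_cong_AE)
    show "(\<lambda>x. \<integral>z. ln (\<integral>s. exp (X s x + sqrt b * z) \<partial>\<mu>) \<partial>normal01) \<in> borel_measurable P" by measurable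
    show "(\<lambda>x. ln (\<integral>s. exp (X s x) \<partial>\<mu>)) \<in> borel_measurable P" by measurable
    show "AE x in P. (\<integral>z. ln (\<integral>s. exp (X s x + sqrt b * z) \<partial>\<mu>) \<partial>normal01) = ln (\<integral>s. exp (X s x) \<partial>\<mu>)"
      using X.AE_partition_pos
    proof eventually_elim
      case (elim x)
      have "ln (\<integral>s. exp (X s x + sqrt b * z) \<partial>\<mu>) = ln (\<integral>s. exp (X s x) \<partial>\<mu>) + sqrt b * z" for z
        using elim by (simp add: exp_add ln_mult)
      then show ?case using i1 i2 N.prob_space by simp
    qed
  qed
  finally show ?thesis .
qed

section \<open>The mean free energy of a band\<close>

lemma mixture_nonneg: "mixture_coeffs \<gamma> \<Longrightarrow> 0 \<le> t \<Longrightarrow> t \<le> 1 \<Longrightarrow> 0 \<le> mixture \<gamma> t"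
  unfolding mixture_def by (intro suminf_nonneg mixture_summable) auto

lemma shifted_model_section:
  assumes X: "shifted_model \<gamma> q M' H'" and n: "0 < n" and \<omega>: "\<omega> \<in> space M'"
  shows "(\<lambda>\<sigma>. H' n \<sigma> \<omega>) \<in> borel_measurable (vec_space n)"
proof -
  have "(\<lambda>(\<sigma>, \<omega>). H' n \<sigma> \<omega>) \<in> borel_measurable (vec_space n \<Otimes>\<^sub>M M')"
    using X n by (auto simp: shifted_model_def Suc_le_eq)
  from measurable_compose[OF measurable_Pair2'[OF \<omega>] this] show ?thesis by simp
qed

text \<open>
  At overlap \<open>q\<close> of the normalised projections the covariance of \<open>H\<close> on the band is
  \<open>N \<xi>(r\<^sup>2 + (1 - r\<^sup>2) q)\<close>.  This is \<open>N / n\<close> times the covariance \<open>n (\<xi>(r\<^sup>2 + (1 - r\<^sup>2) q) - \<xi>(r\<^sup>2))\<close> of the shifted field in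
  dimension \<open>n = N - 1\<close>, plus the constant \<open>N \<xi>(r\<^sup>2)\<close>.
\<close>
lemma expected_band_log_partition:
  assumes \<gamma>: "mixture_coeffs \<gamma>" "mixture \<gamma> 1 = 1" and J: "disorder M J" and r: "\<bar>r\<bar> < 1"
    and X: "shifted_model \<gamma> (r\<^sup>2) M' H'" and n: "0 < n" and \<sigma>: "\<sigma> \<in> spin_sphere (Suc n)"
  shows "(\<integral>\<omega>. ln (\<integral>g. exp (\<beta>' * hamiltonian \<gamma> (Suc n) (\<lambda>l. J (Suc n) l \<omega>) (band_point (Suc n) \<sigma> r g)) \<partial>band_index (Suc n) \<sigma>) \<partial>M)
    = (\<integral>\<omega>. ln (\<integral>g. exp (sqrt (real (Suc n) / real n) * (\<beta>' * H' n (sphere_point n g) \<omega>)) \<partial>sphere_index n) \<partial>M')"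
proof -
  let ?N = "Suc n"
  let ?\<mu> = "band_index ?N \<sigma>"
  let ?s = "sqrt (real ?N / real n)"
  interpret \<mu>: prob_space ?\<mu> by (rule prob_space_band_index[OF \<sigma> n])
  obtain y where y: "y \<in> measurable (std_gaussian ?N) (vec_space n)"
     "distr (std_gaussian ?N) (vec_space n) y = std_gaussian n"
     "\<And>g g'. dot n (y g) (y g') = dot ?N (orth_proj ?N \<sigma> g) (orth_proj ?N \<sigma> g')"
    using orth_complement_coordinates[OF \<sigma>] by metis
  have vn: "vnorm n (y g) = vnorm ?N (orth_proj ?N \<sigma> g)" for g by (simp add: vnorm_def y(3))
  have cos: "cosine n (y g) (y g') = cosine ?N (orth_proj ?N \<sigma> g) (orth_proj ?N \<sigma> g')" for g g'
    by (simp add: cosine_def vn y(3))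
  have ysp: "y g \<in> space (sphere_index n)" if "g \<in> space ?\<mu>" for g
    using that measurable_space[OF y(1), of g]
    by (simp add: band_index_def sphere_index_def space_restrict_space vn) (simp add: std_gaussian_def space_PiM)
  \<comment> \<open>The variance of the Gaussian common to all points of the band.\<close>
  define b where "b = \<beta>'\<^sup>2 * (real ?N * mixture \<gamma> (r\<^sup>2))"
  have b: "0 \<le> b"
    using mixture_nonneg[OF \<gamma>(1), of "r\<^sup>2"] r by (simp add: b_def abs_square_le_1)
  let ?X = "\<lambda>g \<omega>. \<beta>' * hamiltonian \<gamma> ?N (\<lambda>l. J ?N l \<omega>) (band_point ?N \<sigma> r g)"
  let ?Y = "\<lambda>g \<omega>. ?s * (\<beta>' * H' n (sphere_point n (y g)) \<omega>)"
  let ?C = "\<lambda>g g'. \<beta>'\<^sup>2 * (real ?N * mixture \<gamma> (dot ?N (band_point ?N \<sigma> r g) (band_point ?N \<sigma> r g') / real ?N))"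
  define v where "v = max (\<beta>'\<^sup>2 * real ?N) ((?s * \<beta>')\<^sup>2 * (real n * shifted_mixture \<gamma> (r\<^sup>2) 1) + b)"
  have FX: "gaussian_field ?\<mu> M ?C ?X v"
    by (rule hamiltonian_field[OF \<gamma> J _ \<mu>.prob_space_axioms measurable_band_point_index])
      (use band_point_in_sphere[OF \<sigma> _ r] in \<open>auto simp: v_def\<close>)
  interpret S: gaussian_field "sphere_index n" M' "\<lambda>g g'. (?s * \<beta>')\<^sup>2 * (real n * shifted_mixture \<gamma> (r\<^sup>2) (cosine n g g'))"
    "\<lambda>g \<omega>. (?s * \<beta>') * H' n (sphere_point n g) \<omega>" "(?s * \<beta>')\<^sup>2 * (real n * shifted_mixture \<gamma> (r\<^sup>2) 1)"
    by (rule gaussian_field_scale[OF shifted_field[OF X n]])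
  have ym: "y \<in> measurable ?\<mu> (sphere_index n)"
    unfolding sphere_index_def
  proof (rule measurable_restrict_space2)
    show "y \<in> space ?\<mu> \<rightarrow> {g \<in> space (std_gaussian n). vnorm n g \<noteq> 0}"
      using ysp by (auto simp: sphere_index_def space_restrict_space)
    show "y \<in> measurable ?\<mu> (std_gaussian n)"
      unfolding band_index_def
      by (intro measurable_restrict_space1, subst measurable_cong_sets[OF refl sets_std_gaussian]) (rule y(1))
  qed
  have FY0: "gaussian_field ?\<mu> M' (\<lambda>g g'. (?s * \<beta>')\<^sup>2 * (real n * shifted_mixture \<gamma> (r\<^sup>2) (cosine n (y g) (y g')))) ?Y
      ((?s * \<beta>')\<^sup>2 * (real n * shifted_mixture \<gamma> (r\<^sup>2) 1))"
  proof
    show "gaussian_system M' (space ?\<mu>) (\<lambda>g g'. (?s * \<beta>')\<^sup>2 * (real n * shifted_mixture \<gamma> (r\<^sup>2) (cosine n (y g) (y g')))) ?Y"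
      by (rule gaussian_system_reindex[OF S.gaussian ysp]) auto
    have "(\<lambda>z. (?s * \<beta>') * H' n (sphere_point n (y (fst z))) (snd z)) \<in> borel_measurable (?\<mu> \<Otimes>\<^sub>M M')"
      by (rule S.measurable_field[OF measurable_compose[OF measurable_fst ym] measurable_snd])
    then show "(\<lambda>(g, \<omega>). ?Y g \<omega>) \<in> borel_measurable (?\<mu> \<Otimes>\<^sub>M M')" by (simp add: case_prod_beta' mult.assoc)
  qed (use S.variance_le ysp in auto)
  have C: "?C g g' = (?s * \<beta>')\<^sup>2 * (real n * shifted_mixture \<gamma> (r\<^sup>2) (cosine n (y g) (y g'))) + b" for g g'
  proof -
    have "(?s * \<beta>')\<^sup>2 * real n = \<beta>'\<^sup>2 * real ?N" using n by (simp add: power_mult_distrib)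
    then show ?thesis
      unfolding dot_band_point[OF \<sigma> zero_less_Suc r] cos[symmetric] mult.assoc[symmetric] shifted_mixture_def b_def
      by (simp add: algebra_simps)
  qed
  interpret Y: gaussian_field ?\<mu> "M' \<Otimes>\<^sub>M normal01" ?C "\<lambda>g \<omega>. ?Y g (fst \<omega>) + sqrt b * snd \<omega>" "(?s * \<beta>')\<^sup>2 * (real n * shifted_mixture \<gamma> (r\<^sup>2) 1) + b"
    unfolding C by (rule gaussian_field_add_common_normal[OF FY0 b])
  have FY: "gaussian_field ?\<mu> (M' \<Otimes>\<^sub>M normal01) ?C (\<lambda>g \<omega>. ?Y g (fst \<omega>) + sqrt b * snd \<omega>) v"
    by standard (use Y.gaussian Y.jointly_measurable Y.variance_le in \<open>auto simp: v_def le_max_iff_disj\<close>)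
  interpret FX: gaussian_field ?\<mu> M ?C ?X v by (rule FX)
  have law: "distr M borel (\<lambda>\<omega>. \<integral>g. exp (?X g \<omega>) \<partial>?\<mu>) = distr (M' \<Otimes>\<^sub>M normal01) borel (\<lambda>\<omega>. \<integral>g. exp (?Y g (fst \<omega>) + sqrt b * snd \<omega>) \<partial>?\<mu>)"
    using gaussian_field_partition_law[OF FX FY, of "\<lambda>_. 1" 1] by simp
  have "(\<integral>\<omega>. ln (\<integral>g. exp (?X g \<omega>) \<partial>?\<mu>) \<partial>M) = (\<integral>\<omega>. ln (\<integral>g. exp (?Y g (fst \<omega>) + sqrt b * snd \<omega>) \<partial>?\<mu>) \<partial>(M' \<Otimes>\<^sub>M normal01))"
    by (rule integral_eq_of_distr_eq[OF law, of ln]) measurable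
  also have "\<dots> = (\<integral>\<omega>. ln (\<integral>g. exp (?Y g \<omega>) \<partial>?\<mu>) \<partial>M')"
    by (rule expected_log_partition_common_normal[OF FY0 b])
  also have "\<dots> = (\<integral>\<omega>. ln (\<integral>g. exp (?s * (\<beta>' * H' n (sphere_point n g) \<omega>)) \<partial>sphere_index n) \<partial>M')"
  proof (rule Bochner_Integration.integral_cong[OF refl], rule arg_cong[where f=ln])
    fix \<omega> assume \<omega>: "\<omega> \<in> space M'"
    have [measurable]: "(\<lambda>\<sigma>. H' n \<sigma> \<omega>) \<in> borel_measurable (vec_space n)"
      by (rule shifted_model_section[OF X n \<omega>])
    let ?f = "\<lambda>g. exp (?s * (\<beta>' * H' n (sphere_point n g) \<omega>))"
    have [measurable]: "?f \<in> borel_measurable (std_gaussian n)" by measurable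
    have [measurable]: "?f \<in> borel_measurable (vec_space n)"
      by (subst measurable_cong_sets[OF sets_std_gaussian[symmetric] refl]) measurable
    have yN: "y \<in> measurable (std_gaussian ?N) (vec_space n)" by (rule y(1))
    have "(\<integral>g. exp (?Y g \<omega>) \<partial>?\<mu>) = (\<integral>g. ?f (y g) \<partial>std_gaussian ?N)"
      unfolding band_index_def
      by (rule integral_restrict_AE[OF band_index_set band_index_AE[OF \<sigma> n]]) (rule measurable_compose[OF yN], measurable)
    also have "\<dots> = (\<integral>g. ?f g \<partial>distr (std_gaussian ?N) (vec_space n) y)"
      by (rule integral_distr[symmetric, OF yN]) measurable
    also have "\<dots> = (\<integral>g. ?f g \<partial>sphere_index n)"
      unfolding y(2) sphere_index_def
      by (rule integral_restrict_AE[symmetric, OF sphere_index_set sphere_index_AE[OF n]]) measurable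
    finally show "(\<integral>g. exp (?Y g \<omega>) \<partial>?\<mu>) = (\<integral>g. ?f g \<partial>sphere_index n)" .
  qed
  finally show ?thesis .
qed

text \<open>
  The scale \<open>sqrt ((n + 1) / n)\<close> lies between \<open>1\<close> and \<open>2\<close> and tends to \<open>1\<close>, so the two bounds of
  \<open>expected_log_partition_scale\<close> have the same limit.
\<close>
lemma expected_band_free_energy_tendsto:
  assumes X: "shifted_model \<gamma> q M' H'" and F: "limit_free_energy M' H' \<beta>' F'"
  shows "(\<lambda>n. 1 / real (Suc n) * (\<integral>\<omega>. ln (\<integral>g. exp (sqrt (real (Suc n) / real n) * (\<beta>' * H' n (sphere_point n g) \<omega>)) \<partial>sphere_index n) \<partial>M')) \<longlonglongrightarrow> F'"
proof -
  define s where "s = (\<lambda>n. sqrt (real (Suc n) / real n))"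
  define m where "m = (\<lambda>c n. \<integral>\<omega>. ln (\<integral>g. exp (c * (\<beta>' * H' n (sphere_point n g) \<omega>)) \<partial>sphere_index n) \<partial>M')"
  define K where "K = \<beta>'\<^sup>2 * shifted_mixture \<gamma> q 1"
  have fe: "(\<integral>\<omega>. free_energy n \<beta>' (\<lambda>\<sigma>. H' n \<sigma> \<omega>) \<partial>M') = m 1 n / real n" if n: "0 < n" for n
  proof -
    have "partition_function n \<beta>' (\<lambda>\<sigma>. H' n \<sigma> \<omega>) = (\<integral>g. exp (1 * (\<beta>' * H' n (sphere_point n g) \<omega>)) \<partial>sphere_index n)" if "\<omega> \<in> space M'" for \<omega>
    proof -
      have [measurable]: "(\<lambda>\<sigma>. H' n \<sigma> \<omega>) \<in> borel_measurable (vec_space n)" by (rule shifted_model_section[OF X n that])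
      show ?thesis unfolding partition_function_def by (subst integral_sphere_measure[OF n]) auto
    qed
    then have "(\<integral>\<omega>. free_energy n \<beta>' (\<lambda>\<sigma>. H' n \<sigma> \<omega>) \<partial>M') = (\<integral>\<omega>. 1 / real n * ln (\<integral>g. exp (1 * (\<beta>' * H' n (sphere_point n g) \<omega>)) \<partial>sphere_index n) \<partial>M')"
      unfolding free_energy_def by (intro Bochner_Integration.integral_cong) auto
    then show ?thesis by (simp add: m_def)
  qed
  have mF: "(\<lambda>n. m 1 n / real n) \<longlonglongrightarrow> F'"
  proof (rule Lim_transform_eventually)
    show "(\<lambda>n. \<integral>\<omega>. free_energy n \<beta>' (\<lambda>\<sigma>. H' n \<sigma> \<omega>) \<partial>M') \<longlonglongrightarrow> F'" using F by (simp add: limit_free_energy_def)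
    show "\<forall>\<^sub>F n in sequentially. (\<integral>\<omega>. free_energy n \<beta>' (\<lambda>\<sigma>. H' n \<sigma> \<omega>) \<partial>M') = m 1 n / real n"
      using eventually_gt_at_top[of 0] by eventually_elim (rule fe)
  qed
  have nN: "(\<lambda>n. real n / real (Suc n)) \<longlonglongrightarrow> 1" by (rule LIMSEQ_n_over_Suc_n)
  have s: "s \<longlonglongrightarrow> 1"
  proof -
    have "(\<lambda>n. sqrt (real (Suc n) / real n)) \<longlonglongrightarrow> sqrt 1"
      by (intro tendsto_intros LIMSEQ_Suc_n_over_n)
    then show ?thesis by (simp add: s_def)
  qed
  have "(\<lambda>n. real n / real (Suc n) * (s n * (m 1 n / real n))) \<longlonglongrightarrow> 1 * (1 * F')"
    by (intro tendsto_mult nN s mF)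
  then have lo: "(\<lambda>n. real n / real (Suc n) * (s n * (m 1 n / real n))) \<longlonglongrightarrow> F'" by (simp only: mult_1)
  have "(\<lambda>n. real n / real (Suc n) * ((2 - s n) * (m 1 n / real n) + (s n - 1) * (2 * K))) \<longlonglongrightarrow> 1 * ((2 - 1) * F' + (1 - 1) * (2 * K))"
    by (intro tendsto_mult tendsto_add tendsto_diff tendsto_const nN s mF)
  then have up: "(\<lambda>n. real n / real (Suc n) * ((2 - s n) * (m 1 n / real n) + (s n - 1) * (2 * K))) \<longlonglongrightarrow> F'"
    by (rule back_subst) simp
  have bounds: "real n / real (Suc n) * (s n * (m 1 n / real n)) \<le> 1 / real (Suc n) * m (s n) n"
     "1 / real (Suc n) * m (s n) n \<le> real n / real (Suc n) * ((2 - s n) * (m 1 n / real n) + (s n - 1) * (2 * K))" if n: "0 < n" for n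
  proof -
    interpret S: gaussian_field "sphere_index n" M' "\<lambda>g g'. \<beta>'\<^sup>2 * (real n * shifted_mixture \<gamma> q (cosine n g g'))"
      "\<lambda>g \<omega>. \<beta>' * H' n (sphere_point n g) \<omega>" "\<beta>'\<^sup>2 * (real n * shifted_mixture \<gamma> q 1)"
      by (rule gaussian_field_scale[OF shifted_field[OF X n]])
    have s: "1 \<le> s n" "s n \<le> 2"
    proof -
      show "1 \<le> s n" unfolding s_def using n by (intro real_le_rsqrt) (simp add: field_simps)
      have "sqrt (real (Suc n) / real n) \<le> sqrt (2\<^sup>2)" using n by (subst real_sqrt_le_iff) (simp add: field_simps)
      then show "s n \<le> 2" by (simp add: s_def)
    qed
    have "s n * m 1 n \<le> m (s n) n"
      unfolding m_def using S.expected_log_partition_scale(1)[OF s] by simp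
    then have "1 / real (Suc n) * (s n * m 1 n) \<le> 1 / real (Suc n) * m (s n) n" by (intro mult_left_mono) auto
    moreover have "real n / real (Suc n) * (s n * (m 1 n / real n)) = 1 / real (Suc n) * (s n * m 1 n)" using n by simp
    ultimately show "real n / real (Suc n) * (s n * (m 1 n / real n)) \<le> 1 / real (Suc n) * m (s n) n" by linarith
    have "m (s n) n \<le> (2 - s n) * m 1 n + (s n - 1) * (2 * (\<beta>'\<^sup>2 * (real n * shifted_mixture \<gamma> q 1)))"
      unfolding m_def using S.expected_log_partition_scale(2)[OF s] by simp
    then have "1 / real (Suc n) * m (s n) n \<le> 1 / real (Suc n) * ((2 - s n) * m 1 n + (s n - 1) * (2 * (\<beta>'\<^sup>2 * (real n * shifted_mixture \<gamma> q 1))))"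
      by (intro mult_left_mono) auto
    also have "\<dots> = real n / real (Suc n) * ((2 - s n) * (m 1 n / real n) + (s n - 1) * (2 * K))"
    proof -
      have "(2 - s n) * m 1 n + (s n - 1) * (2 * (\<beta>'\<^sup>2 * (real n * shifted_mixture \<gamma> q 1))) = real n * ((2 - s n) * (m 1 n / real n) + (s n - 1) * (2 * K))"
        using n by (simp add: K_def distrib_left)
      then show ?thesis by simp
    qed
    finally show "1 / real (Suc n) * m (s n) n \<le> real n / real (Suc n) * ((2 - s n) * (m 1 n / real n) + (s n - 1) * (2 * K))" .
  qed
  have "(\<lambda>n. 1 / real (Suc n) * m (s n) n) \<longlonglongrightarrow> F'"
    by (rule tendsto_sandwich[OF eventually_mono[OF eventually_gt_at_top[of 0] bounds(1)]
          eventually_mono[OF eventually_gt_at_top[of 0] bounds(2)] lo up])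
  then show ?thesis by (simp add: m_def s_def)
qed

section \<open>Gibbs averages\<close>

abbreviation "random_hamiltonian \<gamma> J N \<equiv> \<lambda>\<sigma> \<omega>. hamiltonian \<gamma> N (\<lambda>l. J N l \<omega>) \<sigma>"

definition band_partition :: "nat \<Rightarrow> real \<Rightarrow> real \<Rightarrow> ((nat \<Rightarrow> real) \<Rightarrow> real) \<Rightarrow> (nat \<Rightarrow> real) \<Rightarrow> real" where
  "band_partition N r \<beta> h \<sigma> = (\<integral>\<sigma>'. exp (\<beta> * h \<sigma>') \<partial>band_measure N \<sigma> r)"

lemma band_free_energy_eq: "band_free_energy N r \<beta> h \<sigma> = 1 / real N * ln (band_partition N r \<beta> h \<sigma>)"
  by (simp add: band_free_energy_def band_partition_def)

lemma hamiltonian_section: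
  assumes "disorder M J" "\<omega> \<in> space M"
  shows "(\<lambda>\<sigma>. random_hamiltonian \<gamma> J N \<sigma> \<omega>) \<in> borel_measurable (vec_space N)"
  using measurable_compose[OF measurable_Pair2'[OF assms(2)] measurable_hamiltonian[OF assms(1)]] by simp

text \<open>
  The variance bound \<open>\<beta>\<^sup>2 + 1\<close> per site, instead of \<open>\<beta>\<^sup>2\<close>, is positive also for \<open>\<beta> = 0\<close>.
\<close>
lemma sphere_partition_concentration:
  fixes \<beta> u :: real
  assumes \<gamma>: "mixture_coeffs \<gamma>" "mixture \<gamma> 1 = 1" and J: "disorder M J" and N: "0 < N" and u: "0 < u"
  defines "Z \<equiv> \<lambda>\<omega>. partition_function N \<beta> (\<lambda>\<sigma>. random_hamiltonian \<gamma> J N \<sigma> \<omega>)"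
  shows "measure M {\<omega> \<in> space M. u \<le> \<bar>ln (Z \<omega>) - (\<integral>\<omega>. ln (Z \<omega>) \<partial>M)\<bar>} \<le> 2 * exp (- u\<^sup>2 / (8 * ((\<beta>\<^sup>2 + 1) * real N)))"
    and "AE \<omega> in M. 0 < Z \<omega>" and "Z \<in> borel_measurable M"
proof -
  interpret F: gaussian_field "sphere_index N" M
    "\<lambda>g g'. \<beta>\<^sup>2 * (real N * mixture \<gamma> (dot N (sphere_point N g) (sphere_point N g') / real N))"
    "\<lambda>g \<omega>. \<beta> * random_hamiltonian \<gamma> J N (sphere_point N g) \<omega>" "(\<beta>\<^sup>2 + 1) * real N"
    by (rule hamiltonian_field[OF \<gamma> J N prob_space_sphere_index[OF N] measurable_sphere_point_index sphere_point_in_sphere])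
      (auto simp: distrib_right)
  have eq: "Z \<omega> = (\<integral>g. exp (\<beta> * random_hamiltonian \<gamma> J N (sphere_point N g) \<omega>) \<partial>sphere_index N)" if "\<omega> \<in> space M" for \<omega>
  proof -
    have [measurable]: "(\<lambda>\<sigma>. random_hamiltonian \<gamma> J N \<sigma> \<omega>) \<in> borel_measurable (vec_space N)" by (rule hamiltonian_section[OF J that])
    show ?thesis unfolding Z_def partition_function_def by (rule integral_sphere_measure[OF N]) measurable
  qed
  have lp: "F.log_partition \<omega> = ln (Z \<omega>)" if "\<omega> \<in> space M" for \<omega>
    by (simp add: F.log_partition_def eq[OF that])
  have m: "(\<integral>\<omega>. F.log_partition \<omega> \<partial>M) = (\<integral>\<omega>. ln (Z \<omega>) \<partial>M)"
    by (intro Bochner_Integration.integral_cong refl lp)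
  have set: "{\<omega> \<in> space M. u \<le> \<bar>F.log_partition \<omega> - (\<integral>\<omega>. F.log_partition \<omega> \<partial>M)\<bar>} = {\<omega> \<in> space M. u \<le> \<bar>ln (Z \<omega>) - (\<integral>\<omega>. ln (Z \<omega>) \<partial>M)\<bar>}"
    unfolding m using lp by auto
  show "measure M {\<omega> \<in> space M. u \<le> \<bar>ln (Z \<omega>) - (\<integral>\<omega>. ln (Z \<omega>) \<partial>M)\<bar>} \<le> 2 * exp (- u\<^sup>2 / (8 * ((\<beta>\<^sup>2 + 1) * real N)))"
    unfolding set[symmetric] using N by (intro F.log_partition_concentration u) (simp add: add_nonneg_pos)
  show "AE \<omega> in M. 0 < Z \<omega>"
    using F.AE_partition_pos AE_space by eventually_elim (simp add: eq)
  show "Z \<in> borel_measurable M"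
    by (subst measurable_cong[OF eq]) measurable
qed

context
  fixes \<gamma> :: "nat \<Rightarrow> real" and M :: "'w measure" and J n \<sigma> and r :: real
  assumes \<gamma>: "mixture_coeffs \<gamma>" "mixture \<gamma> 1 = 1" and J: "disorder M J"
    and n: "0 < n" and \<sigma>: "\<sigma> \<in> spin_sphere (Suc n)" and r: "\<bar>r\<bar> < 1"
begin

lemma band_field:
  "gaussian_field (band_index (Suc n) \<sigma>) M
    (\<lambda>g g'. \<beta>\<^sup>2 * (real (Suc n) * mixture \<gamma> (dot (Suc n) (band_point (Suc n) \<sigma> r g) (band_point (Suc n) \<sigma> r g') / real (Suc n))))
    (\<lambda>g \<omega>. \<beta> * random_hamiltonian \<gamma> J (Suc n) (band_point (Suc n) \<sigma> r g) \<omega>) ((\<beta>\<^sup>2 + 1) * real (Suc n))"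
  by (rule hamiltonian_field[OF \<gamma> J zero_less_Suc prob_space_band_index[OF \<sigma> n] measurable_band_point_index band_point_in_sphere[OF \<sigma> zero_less_Suc r]])
    (auto simp: distrib_right)

lemma band_partition_eq:
  assumes "\<omega> \<in> space M"
  shows "band_partition (Suc n) r \<beta> (\<lambda>\<sigma>. random_hamiltonian \<gamma> J (Suc n) \<sigma> \<omega>) \<sigma>
    = (\<integral>g. exp (\<beta> * random_hamiltonian \<gamma> J (Suc n) (band_point (Suc n) \<sigma> r g) \<omega>) \<partial>band_index (Suc n) \<sigma>)"
proof -
  have [measurable]: "(\<lambda>\<sigma>. random_hamiltonian \<gamma> J (Suc n) \<sigma> \<omega>) \<in> borel_measurable (vec_space (Suc n))"
    by (rule hamiltonian_section[OF J assms])
  show ?thesis unfolding band_partition_def by (rule integral_band_measure[OF \<sigma> n]) measurable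
qed

lemma band_partition_concentration:
  fixes \<beta> u :: real
  assumes u: "0 < u"
  defines "B \<equiv> \<lambda>\<omega>. band_partition (Suc n) r \<beta> (\<lambda>\<sigma>. random_hamiltonian \<gamma> J (Suc n) \<sigma> \<omega>) \<sigma>"
  shows "measure M {\<omega> \<in> space M. u \<le> \<bar>ln (B \<omega>) - (\<integral>\<omega>. ln (B \<omega>) \<partial>M)\<bar>} \<le> 2 * exp (- u\<^sup>2 / (8 * ((\<beta>\<^sup>2 + 1) * real (Suc n))))"
    and "AE \<omega> in M. 0 < B \<omega>" and "B \<in> borel_measurable M"
proof -
  interpret F: gaussian_field "band_index (Suc n) \<sigma>" M
    "\<lambda>g g'. \<beta>\<^sup>2 * (real (Suc n) * mixture \<gamma> (dot (Suc n) (band_point (Suc n) \<sigma> r g) (band_point (Suc n) \<sigma> r g') / real (Suc n)))"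
    "\<lambda>g \<omega>. \<beta> * random_hamiltonian \<gamma> J (Suc n) (band_point (Suc n) \<sigma> r g) \<omega>" "(\<beta>\<^sup>2 + 1) * real (Suc n)"
    by (rule band_field)
  have lp: "F.log_partition \<omega> = ln (B \<omega>)" if "\<omega> \<in> space M" for \<omega>
    by (simp only: F.log_partition_def B_def band_partition_eq[OF that])
  have m: "(\<integral>\<omega>. F.log_partition \<omega> \<partial>M) = (\<integral>\<omega>. ln (B \<omega>) \<partial>M)"
    by (intro Bochner_Integration.integral_cong refl lp)
  have set: "{\<omega> \<in> space M. u \<le> \<bar>F.log_partition \<omega> - (\<integral>\<omega>. F.log_partition \<omega> \<partial>M)\<bar>} = {\<omega> \<in> space M. u \<le> \<bar>ln (B \<omega>) - (\<integral>\<omega>. ln (B \<omega>) \<partial>M)\<bar>}"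
    unfolding m using lp by auto
  show "measure M {\<omega> \<in> space M. u \<le> \<bar>ln (B \<omega>) - (\<integral>\<omega>. ln (B \<omega>) \<partial>M)\<bar>} \<le> 2 * exp (- u\<^sup>2 / (8 * ((\<beta>\<^sup>2 + 1) * real (Suc n))))"
    unfolding set[symmetric] by (intro F.log_partition_concentration u mult_pos_pos add_nonneg_pos) auto
  show "AE \<omega> in M. 0 < B \<omega>"
    using F.AE_partition_pos AE_space by eventually_elim (simp only: B_def band_partition_eq)
  show "B \<in> borel_measurable M"
    unfolding B_def by (subst measurable_cong[OF band_partition_eq]) (assumption, measurable)
qed

text \<open>
  The covariance of \<open>H(\<sigma>)\<close> with \<open>H\<close> is \<open>N \<xi>(r)\<close> at every point of the band, so the tilt multiplies the
  partition function of the band by a constant.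
\<close>
lemma band_partition_tilt:
  fixes \<beta> \<beta>' :: real
  assumes \<Phi>: "\<Phi> \<in> borel_measurable borel"
  defines "B \<equiv> \<lambda>\<omega>. band_partition (Suc n) r \<beta>' (\<lambda>\<sigma>. random_hamiltonian \<gamma> J (Suc n) \<sigma> \<omega>) \<sigma>"
  shows "(\<integral>\<^sup>+\<omega>. ennreal (exp (\<beta> * random_hamiltonian \<gamma> J (Suc n) \<sigma> \<omega>)) * \<Phi> (B \<omega>) \<partial>M)
    = ennreal (exp (\<beta>\<^sup>2 * real (Suc n) / 2)) * (\<integral>\<^sup>+\<omega>. \<Phi> (exp (\<beta> * \<beta>' * real (Suc n) * mixture \<gamma> r) * B \<omega>) \<partial>M)"
proof -
  let ?N = "Suc n"
  let ?\<mu> = "band_index ?N \<sigma>"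
  let ?p = "\<lambda>t. case t of None \<Rightarrow> \<sigma> | Some g \<Rightarrow> band_point ?N \<sigma> r g"
  let ?b = "\<lambda>t. case t of None \<Rightarrow> \<beta> | Some (g :: nat \<Rightarrow> real) \<Rightarrow> \<beta>'"
  let ?K = "\<lambda>t t'. ?b t * ?b t' * (real ?N * mixture \<gamma> (dot ?N (?p t) (?p t') / real ?N))"
  let ?X = "\<lambda>t \<omega>. ?b t * random_hamiltonian \<gamma> J ?N (?p t) \<omega>"
  let ?S = "insert None (Some ` space ?\<mu>)"
  interpret F: gaussian_field ?\<mu> M
    "\<lambda>g g'. \<beta>'\<^sup>2 * (real ?N * mixture \<gamma> (dot ?N (band_point ?N \<sigma> r g) (band_point ?N \<sigma> r g') / real ?N))"
    "\<lambda>g \<omega>. \<beta>' * random_hamiltonian \<gamma> J ?N (band_point ?N \<sigma> r g) \<omega>" "(\<beta>'\<^sup>2 + 1) * real ?N"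
    by (rule band_field)
  have G: "gaussian_system M ?S ?K ?X"
    by (rule gaussian_system_linear[OF hamiltonian_gaussian[OF \<gamma>(1) J zero_less_Suc, of n], of "{()}" ?S "\<lambda>t _. ?p t" ?X "\<lambda>t _. ?b t"])
      (use \<sigma> band_point_in_sphere[OF \<sigma> zero_less_Suc r] in \<open>auto simp del: of_nat_Suc\<close>)
  have c: "?K None (Some g) = \<beta> * \<beta>' * real ?N * mixture \<gamma> r" if "g \<in> space ?\<mu>" for g
    using dot_band_point_center[OF \<sigma> zero_less_Suc r, of g] that
    by (simp add: band_index_def space_restrict_space del: of_nat_Suc)
  have v: "?K None None = \<beta>\<^sup>2 * real ?N"
    using \<sigma> \<gamma>(2) by (simp add: spin_sphere_def vnorm_def power2_eq_square del: of_nat_Suc)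
  have "(\<integral>\<^sup>+\<omega>. ennreal (exp (?X None \<omega>)) * \<Phi> (\<integral>g. exp (?X (Some g) \<omega>) \<partial>?\<mu>) \<partial>M)
    = ennreal (exp (?K None None / 2)) * (\<integral>\<^sup>+\<omega>. \<Phi> (\<integral>g. exp (?K None (Some g)) * exp (\<beta>' * random_hamiltonian \<gamma> J ?N (band_point ?N \<sigma> r g) \<omega>) \<partial>?\<mu>) \<partial>M)"
  proof (rule gaussian_change_of_measure[OF G, where \<iota>=Some, OF _ _ _ F.gaussian_field_axioms _ _ \<Phi>])
    show "(\<lambda>(s, \<omega>). ?X (Some s) \<omega>) \<in> borel_measurable (?\<mu> \<Otimes>\<^sub>M M)"
      using F.jointly_measurable by simp
    have "(\<lambda>g. \<beta> * \<beta>' * real ?N * mixture \<gamma> r) \<in> borel_measurable ?\<mu>" by simp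
    then show "(\<lambda>s. ?K None (Some s)) \<in> borel_measurable ?\<mu>" by (subst measurable_cong[OF c])
  qed (auto simp: power2_eq_square)
  also have "(\<integral>\<^sup>+\<omega>. ennreal (exp (?X None \<omega>)) * \<Phi> (\<integral>g. exp (?X (Some g) \<omega>) \<partial>?\<mu>) \<partial>M)
    = (\<integral>\<^sup>+\<omega>. ennreal (exp (\<beta> * random_hamiltonian \<gamma> J ?N \<sigma> \<omega>)) * \<Phi> (B \<omega>) \<partial>M)"
    by (intro nn_integral_cong) (simp only: option.case B_def band_partition_eq)
  also have "(\<integral>\<^sup>+\<omega>. \<Phi> (\<integral>g. exp (?K None (Some g)) * exp (\<beta>' * random_hamiltonian \<gamma> J ?N (band_point ?N \<sigma> r g) \<omega>) \<partial>?\<mu>) \<partial>M)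
    = (\<integral>\<^sup>+\<omega>. \<Phi> (exp (\<beta> * \<beta>' * real ?N * mixture \<gamma> r) * B \<omega>) \<partial>M)"
  proof (intro nn_integral_cong arg_cong[where f=\<Phi>])
    fix \<omega> assume \<omega>: "\<omega> \<in> space M"
    have "(\<integral>g. exp (?K None (Some g)) * exp (\<beta>' * random_hamiltonian \<gamma> J ?N (band_point ?N \<sigma> r g) \<omega>) \<partial>?\<mu>)
       = (\<integral>g. exp (\<beta> * \<beta>' * real ?N * mixture \<gamma> r) * exp (\<beta>' * random_hamiltonian \<gamma> J ?N (band_point ?N \<sigma> r g) \<omega>) \<partial>?\<mu>)"
      by (intro Bochner_Integration.integral_cong refl) (simp only: c)
    also have "\<dots> = exp (\<beta> * \<beta>' * real ?N * mixture \<gamma> r) * B \<omega>"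
      unfolding B_def band_partition_eq[OF \<omega>] by (rule integral_mult_right_zero)
    finally show "(\<integral>g. exp (?K None (Some g)) * exp (\<beta>' * random_hamiltonian \<gamma> J ?N (band_point ?N \<sigma> r g) \<omega>) \<partial>?\<mu>)
       = exp (\<beta> * \<beta>' * real ?N * mixture \<gamma> r) * B \<omega>" .
  qed
  finally show ?thesis unfolding v .
qed

end

lemma sets_sphere_measure [simp]: "sets (sphere_measure N) = sets (vec_space N)"
  by (simp add: sphere_measure_def uniform_sphere_def)

lemma spin_sphere_sets: "spin_sphere N \<in> sets (vec_space N)"
proof -
  have [measurable]: "(\<lambda>g. vnorm N g) \<in> borel_measurable (vec_space N)"
    by (intro measurable_vnorm_std_gaussian measurable_component_singleton) auto
  show ?thesis unfolding spin_sphere_def by measurable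
qed

lemma measurable_band_point_joint:
  "(\<lambda>z. band_point N (fst z) r (snd z)) \<in> measurable (vec_space N \<Otimes>\<^sub>M vec_space N) (vec_space N)"
proof -
  have 1[measurable]: "(\<lambda>z. fst z i) \<in> borel_measurable (vec_space N \<Otimes>\<^sub>M vec_space N)" "(\<lambda>z. snd z i) \<in> borel_measurable (vec_space N \<Otimes>\<^sub>M vec_space N)" if "i < N" for i
    using that by (auto intro: measurable_compose[OF measurable_fst measurable_component_singleton] measurable_compose[OF measurable_snd measurable_component_singleton])
  have P[measurable]: "(\<lambda>z. orth_proj N (fst z) (snd z) i) \<in> borel_measurable (vec_space N \<Otimes>\<^sub>M vec_space N)" if "i < N" for i
    unfolding orth_proj_def using that
    by (intro borel_measurable_diff borel_measurable_times borel_measurable_divide measurable_dot 1)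
  show ?thesis
    unfolding band_point_def on_sphere_def
    by (intro measurable_restrict borel_measurable_add borel_measurable_times borel_measurable_divide borel_measurable_const
       measurable_vnorm_std_gaussian P 1) auto
qed

lemma measurable_band_partition:
  assumes J: "disorder M J"
  shows "(\<lambda>z. band_partition N r \<beta> (\<lambda>\<sigma>. random_hamiltonian \<gamma> J N \<sigma> (snd z)) (fst z)) \<in> borel_measurable (vec_space N \<Otimes>\<^sub>M M)"
proof -
  interpret G: prob_space "std_gaussian N" by (rule prob_space_std_gaussian)
  have eq: "band_partition N r \<beta> (\<lambda>\<sigma>. random_hamiltonian \<gamma> J N \<sigma> (snd z)) (fst z)
     = (\<integral>g. exp (\<beta> * random_hamiltonian \<gamma> J N (band_point N (fst z) r g) (snd z)) \<partial>std_gaussian N)"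
    if "z \<in> space (vec_space N \<Otimes>\<^sub>M M)" for z
  proof -
    have [measurable]: "(\<lambda>\<sigma>. random_hamiltonian \<gamma> J N \<sigma> (snd z)) \<in> borel_measurable (vec_space N)"
      by (rule hamiltonian_section[OF J]) (use that in \<open>auto simp: space_pair_measure\<close>)
    show ?thesis
      unfolding band_partition_def band_measure_def uniform_sphere_def band_point_def[symmetric]
      by (rule integral_distr) measurable
  qed
  have sg: "sets (vec_space N \<Otimes>\<^sub>M std_gaussian N) = sets (vec_space N \<Otimes>\<^sub>M vec_space N)"
    by (intro sets_pair_measure_cong refl sets_std_gaussian)
  have bp: "(\<lambda>z. band_point N (fst z) r (snd z)) \<in> measurable (vec_space N \<Otimes>\<^sub>M std_gaussian N) (vec_space N)"
    by (subst measurable_cong_sets[OF sg refl]) (rule measurable_band_point_joint)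
  have "(\<lambda>w. (fst (fst w), snd w)) \<in> measurable ((vec_space N \<Otimes>\<^sub>M M) \<Otimes>\<^sub>M std_gaussian N) (vec_space N \<Otimes>\<^sub>M std_gaussian N)"
    by (intro measurable_Pair measurable_compose[OF measurable_fst measurable_fst] measurable_snd)
  from measurable_compose[OF this bp]
  have "(\<lambda>w. (band_point N (fst (fst w)) r (snd w), snd (fst w))) \<in> measurable ((vec_space N \<Otimes>\<^sub>M M) \<Otimes>\<^sub>M std_gaussian N) (vec_space N \<Otimes>\<^sub>M M)"
    by (intro measurable_Pair measurable_compose[OF measurable_fst measurable_snd]) simp_all
  from measurable_compose[OF this measurable_hamiltonian[OF J]]
  have [measurable]: "(\<lambda>w. random_hamiltonian \<gamma> J N (band_point N (fst (fst w)) r (snd w)) (snd (fst w))) \<in> borel_measurable ((vec_space N \<Otimes>\<^sub>M M) \<Otimes>\<^sub>M std_gaussian N)"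
    by simp
  have "(\<lambda>z. \<integral>g. exp (\<beta> * random_hamiltonian \<gamma> J N (band_point N (fst z) r g) (snd z)) \<partial>std_gaussian N) \<in> borel_measurable (vec_space N \<Otimes>\<^sub>M M)"
    by (rule G.borel_measurable_lebesgue_integral) (simp add: case_prod_beta')
  then show ?thesis by (subst measurable_cong[OF eq])
qed

lemma integral_le_of_nn_integral_le:
  fixes f :: "'w \<Rightarrow> real"
  assumes "\<And>x. 0 \<le> f x" "(\<integral>\<^sup>+x. ennreal (f x) \<partial>M) \<le> ennreal c" "0 \<le> c"
  shows "(\<integral>x. f x \<partial>M) \<le> c"
proof (cases "integrable M f")
  case True
  then have "ennreal (\<integral>x. f x \<partial>M) \<le> ennreal c" using assms by (simp add: nn_integral_eq_integral)
  then show ?thesis using assms(3) by simp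
qed (use assms(3) in \<open>simp add: not_integrable_integral_eq\<close>)

text \<open>
  If \<open>partition_function N \<beta> h\<close> is positive then \<open>exp (\<beta> h)\<close> is integrable, since the integral of a function that
  is not integrable is \<open>0\<close>.
\<close>
lemma gibbs_measure_le:
  assumes h: "h \<in> borel_measurable (vec_space N)" and Z: "0 < partition_function N \<beta> h" and A: "A \<in> sets (vec_space N)"
  shows "ennreal (measure (gibbs N \<beta> h) A) \<le> 1"
    and "k \<le> partition_function N \<beta> h \<Longrightarrow> 0 < k \<Longrightarrow>
      ennreal (measure (gibbs N \<beta> h) A) \<le> ennreal (1 / k) * (\<integral>\<^sup>+\<sigma>. ennreal (exp (\<beta> * h \<sigma>)) * indicator A \<sigma> \<partial>sphere_measure N)"
proof -
  let ?Z = "partition_function N \<beta> h"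
  have m[measurable]: "h \<in> borel_measurable (sphere_measure N)" using h by (simp cong: measurable_cong_sets)
  have i: "integrable (sphere_measure N) (\<lambda>\<sigma>. exp (\<beta> * h \<sigma>))"
  proof (rule ccontr)
    assume "\<not> ?thesis"
    then have "?Z = 0" unfolding partition_function_def by (rule not_integrable_integral_eq)
    with Z show False by simp
  qed
  have "(\<integral>\<^sup>+\<sigma>. ennreal (exp (\<beta> * h \<sigma>) / ?Z) \<partial>sphere_measure N) = ennreal (\<integral>\<sigma>. exp (\<beta> * h \<sigma>) / ?Z \<partial>sphere_measure N)"
    using i Z by (intro nn_integral_eq_integral) auto
  also have "\<dots> = 1" using Z i by (simp add: partition_function_def)
  finally have tot: "(\<integral>\<^sup>+\<sigma>. ennreal (exp (\<beta> * h \<sigma>) / ?Z) \<partial>sphere_measure N) = 1" .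
  have em: "emeasure (gibbs N \<beta> h) A = (\<integral>\<^sup>+\<sigma>. ennreal (exp (\<beta> * h \<sigma>) / ?Z) * indicator A \<sigma> \<partial>sphere_measure N)"
    unfolding gibbs_def using A by (intro emeasure_density) auto
  also have "\<dots> \<le> (\<integral>\<^sup>+\<sigma>. ennreal (exp (\<beta> * h \<sigma>) / ?Z) \<partial>sphere_measure N)"
    by (intro nn_integral_mono) (auto split: split_indicator)
  finally have le1: "emeasure (gibbs N \<beta> h) A \<le> 1" unfolding tot .
  then have me: "ennreal (measure (gibbs N \<beta> h) A) = emeasure (gibbs N \<beta> h) A"
    by (simp add: measure_def) (metis ennreal_enn2real_if ennreal_one_neq_top top_unique)
  show "ennreal (measure (gibbs N \<beta> h) A) \<le> 1" using me le1 by simp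
  assume k: "k \<le> ?Z" "0 < k"
  have "emeasure (gibbs N \<beta> h) A \<le> (\<integral>\<^sup>+\<sigma>. ennreal (1 / k) * (ennreal (exp (\<beta> * h \<sigma>)) * indicator A \<sigma>) \<partial>sphere_measure N)"
    unfolding em
  proof (intro nn_integral_mono)
    fix \<sigma>
    have "exp (\<beta> * h \<sigma>) / ?Z \<le> 1 / k * exp (\<beta> * h \<sigma>)" using k by (simp add: frac_le)
    then have "ennreal (exp (\<beta> * h \<sigma>) / ?Z) \<le> ennreal (1 / k) * ennreal (exp (\<beta> * h \<sigma>))"
      using k by (simp add: ennreal_mult[symmetric] ennreal_leI)
    then show "ennreal (exp (\<beta> * h \<sigma>) / ?Z) * indicator A \<sigma> \<le> ennreal (1 / k) * (ennreal (exp (\<beta> * h \<sigma>)) * indicator A \<sigma>)"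
      by (auto split: split_indicator)
  qed
  also have "\<dots> = ennreal (1 / k) * (\<integral>\<^sup>+\<sigma>. ennreal (exp (\<beta> * h \<sigma>)) * indicator A \<sigma> \<partial>sphere_measure N)"
  proof (rule nn_integral_cmult)
    have [measurable]: "A \<in> sets (sphere_measure N)" using A by simp
    show "(\<lambda>\<sigma>. ennreal (exp (\<beta> * h \<sigma>)) * indicator A \<sigma>) \<in> borel_measurable (sphere_measure N)" by measurable
  qed
  finally show "ennreal (measure (gibbs N \<beta> h) A) \<le> ennreal (1 / k) * (\<integral>\<^sup>+\<sigma>. ennreal (exp (\<beta> * h \<sigma>)) * indicator A \<sigma> \<partial>sphere_measure N)"
    unfolding me .
qed

text \<open>
  Where the partition function is below \<open>k\<close> the Gibbs probability is bounded by \<open>1\<close>.  Elsewhere the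
  normalisation is replaced by \<open>k\<close>, and for each \<open>\<sigma>\<close> the tilt centres the free energy of the band.
\<close>
lemma expected_gibbs_bound:
  fixes \<beta> \<beta>' r F' \<delta> k q :: real
  assumes \<gamma>: "mixture_coeffs \<gamma>" "mixture \<gamma> 1 = 1" and J: "disorder M J" and r: "\<bar>r\<bar> < 1" and n: "0 < n"
    and k: "0 < k" and q: "0 \<le> q"
    and conc: "\<And>\<sigma>. \<sigma> \<in> spin_sphere (Suc n) \<Longrightarrow>
      measure M {\<omega> \<in> space M. \<delta> < \<bar>1 / real (Suc n) * ln (band_partition (Suc n) r \<beta>' (\<lambda>\<sigma>. random_hamiltonian \<gamma> J (Suc n) \<sigma> \<omega>) \<sigma>) - F'\<bar>} \<le> q"
  shows "(\<integral>\<omega>. measure (gibbs (Suc n) \<beta> (\<lambda>\<sigma>. random_hamiltonian \<gamma> J (Suc n) \<sigma> \<omega>))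
      {\<sigma> \<in> spin_sphere (Suc n). \<delta> < \<bar>band_free_energy (Suc n) r \<beta>' (\<lambda>\<sigma>. random_hamiltonian \<gamma> J (Suc n) \<sigma> \<omega>) \<sigma> - \<beta> * \<beta>' * mixture \<gamma> r - F'\<bar>} \<partial>M)
    \<le> measure M {\<omega> \<in> space M. partition_function (Suc n) \<beta> (\<lambda>\<sigma>. random_hamiltonian \<gamma> J (Suc n) \<sigma> \<omega>) < k}
      + 1 / k * (exp (\<beta>\<^sup>2 * real (Suc n) / 2) * q)"
proof -
  let ?N = "Suc n"
  let ?h = "\<lambda>\<omega> \<sigma>. random_hamiltonian \<gamma> J ?N \<sigma> \<omega>"
  let ?Z = "\<lambda>\<omega>. partition_function ?N \<beta> (?h \<omega>)"
  let ?B = "\<lambda>\<sigma> \<omega>. band_partition ?N r \<beta>' (?h \<omega>) \<sigma>"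
  let ?A = "\<lambda>\<omega>. {\<sigma> \<in> spin_sphere ?N. \<delta> < \<bar>band_free_energy ?N r \<beta>' (?h \<omega>) \<sigma> - \<beta> * \<beta>' * mixture \<gamma> r - F'\<bar>}"
  let ?bad = "{\<omega> \<in> space M. ?Z \<omega> < k}"
  \<comment> \<open>The deviation event as a function of the partition function of the band; the drift of the tilt is still subtracted here.\<close>
  define \<Phi> where "\<Phi> = (\<lambda>z. indicator {z. \<delta> < \<bar>1 / real ?N * ln z - \<beta> * \<beta>' * mixture \<gamma> r - F'\<bar>} z :: ennreal)"
  define W where "W = (\<lambda>\<sigma> \<omega>. ennreal (exp (\<beta> * ?h \<omega> \<sigma>)) * (indicator (spin_sphere ?N) \<sigma> * \<Phi> (?B \<sigma> \<omega>)))"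
  interpret M: prob_space M using J by (simp add: disorder_def)
  interpret S: prob_space "sphere_measure ?N" by (rule prob_space_sphere_measure)
  interpret SM: pair_prob_space "sphere_measure ?N" M ..
  have \<Phi>m[measurable]: "\<Phi> \<in> borel_measurable borel" unfolding \<Phi>_def by measurable
  have pm: "sets (sphere_measure ?N \<Otimes>\<^sub>M M) = sets (vec_space ?N \<Otimes>\<^sub>M M)" by (intro sets_pair_measure_cong) auto
  note [measurable] = spin_sphere_sets[of ?N]
  have Bm[measurable]: "(\<lambda>z. ?B (fst z) (snd z)) \<in> borel_measurable (vec_space ?N \<Otimes>\<^sub>M M)"
    by (rule measurable_band_partition[OF J])
  have Hm[measurable]: "(\<lambda>z. ?h (snd z) (fst z)) \<in> borel_measurable (vec_space ?N \<Otimes>\<^sub>M M)"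
    using measurable_hamiltonian[OF J, of \<gamma> ?N] by (simp add: case_prod_beta')
  have Wm: "(\<lambda>(\<sigma>, \<omega>). W \<sigma> \<omega>) \<in> borel_measurable (sphere_measure ?N \<Otimes>\<^sub>M M)"
    unfolding W_def case_prod_beta' by (subst measurable_cong_sets[OF pm refl]) measurable
  have hs: "?h \<omega> \<in> borel_measurable (vec_space ?N)" if "\<omega> \<in> space M" for \<omega>
    by (rule hamiltonian_section[OF J that])
  have Bs: "(\<lambda>\<sigma>. ?B \<sigma> \<omega>) \<in> borel_measurable (vec_space ?N)" if "\<omega> \<in> space M" for \<omega>
    using measurable_compose[OF measurable_Pair2'[OF that] Bm] by simp
  have As: "?A \<omega> \<in> sets (vec_space ?N)" if "\<omega> \<in> space M" for \<omega>
  proof -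
    note [measurable] = Bs[OF that]
    have "?A \<omega> = spin_sphere ?N \<inter> {\<sigma> \<in> space (vec_space ?N). \<delta> < \<bar>1 / real ?N * ln (?B \<sigma> \<omega>) - \<beta> * \<beta>' * mixture \<gamma> r - F'\<bar>}"
      by (auto simp: band_free_energy_eq spin_sphere_def)
    also have "\<dots> \<in> sets (vec_space ?N)" by measurable
    finally show ?thesis .
  qed
  have ind: "ennreal (exp (\<beta> * ?h \<omega> \<sigma>)) * indicator (?A \<omega>) \<sigma> = W \<sigma> \<omega>" for \<sigma> \<omega>
    by (auto simp: W_def \<Phi>_def band_free_energy_eq split: split_indicator)
  have Z: "AE \<omega> in M. 0 < ?Z \<omega>" and Zm[measurable]: "?Z \<in> borel_measurable M"
    using sphere_partition_concentration(2,3)[OF \<gamma> J, of ?N 1] by auto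
  have "AE \<omega> in M. ennreal (measure (gibbs ?N \<beta> (?h \<omega>)) (?A \<omega>)) \<le> indicator ?bad \<omega> + ennreal (1 / k) * (\<integral>\<^sup>+\<sigma>. W \<sigma> \<omega> \<partial>sphere_measure ?N)"
    using Z AE_space
  proof eventually_elim
    case (elim \<omega>)
    show ?case
    proof (cases "?Z \<omega> < k")
      case True
      have "ennreal (measure (gibbs ?N \<beta> (?h \<omega>)) (?A \<omega>)) \<le> 1"
        by (rule gibbs_measure_le(1)[OF hs[OF elim(2)] elim(1) As[OF elim(2)]])
      also have "\<dots> = indicator ?bad \<omega>" using True elim(2) by simp
      finally show ?thesis by (rule add_increasing2[OF zero_le])
    next
      case False
      then have "ennreal (measure (gibbs ?N \<beta> (?h \<omega>)) (?A \<omega>)) \<le> ennreal (1 / k) * (\<integral>\<^sup>+\<sigma>. W \<sigma> \<omega> \<partial>sphere_measure ?N)"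
        using gibbs_measure_le(2)[OF hs[OF elim(2)] elim(1) As[OF elim(2)], of k] k unfolding ind by simp
      then show ?thesis by (rule add_increasing[OF zero_le])
    qed
  qed
  then have "(\<integral>\<^sup>+\<omega>. ennreal (measure (gibbs ?N \<beta> (?h \<omega>)) (?A \<omega>)) \<partial>M) \<le> (\<integral>\<^sup>+\<omega>. indicator ?bad \<omega> + ennreal (1 / k) * (\<integral>\<^sup>+\<sigma>. W \<sigma> \<omega> \<partial>sphere_measure ?N) \<partial>M)"
    by (rule nn_integral_mono_AE)
  also have "\<dots> = emeasure M ?bad + ennreal (1 / k) * (\<integral>\<^sup>+\<omega>. \<integral>\<^sup>+\<sigma>. W \<sigma> \<omega> \<partial>sphere_measure ?N \<partial>M)"
  proof -
    have [measurable]: "(\<lambda>\<omega>. \<integral>\<^sup>+\<sigma>. W \<sigma> \<omega> \<partial>sphere_measure ?N) \<in> borel_measurable M"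
      using measurable_pair_swap[OF Wm] by (intro S.borel_measurable_nn_integral) simp
    show ?thesis by (subst nn_integral_add) (auto simp: nn_integral_cmult)
  qed
  also have "(\<integral>\<^sup>+\<omega>. \<integral>\<^sup>+\<sigma>. W \<sigma> \<omega> \<partial>sphere_measure ?N \<partial>M) = (\<integral>\<^sup>+\<sigma>. \<integral>\<^sup>+\<omega>. W \<sigma> \<omega> \<partial>M \<partial>sphere_measure ?N)"
    by (rule SM.Fubini'[OF Wm])
  also have "\<dots> \<le> (\<integral>\<^sup>+\<sigma>. ennreal (exp (\<beta>\<^sup>2 * real ?N / 2) * q) \<partial>sphere_measure ?N)"
  proof (rule nn_integral_mono)
    fix \<sigma>
    show "(\<integral>\<^sup>+\<omega>. W \<sigma> \<omega> \<partial>M) \<le> ennreal (exp (\<beta>\<^sup>2 * real ?N / 2) * q)"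
    proof (cases "\<sigma> \<in> spin_sphere ?N")
      case \<sigma>: True
      let ?C = "exp (\<beta> * \<beta>' * real ?N * mixture \<gamma> r)"
      have Bpos: "AE \<omega> in M. 0 < ?B \<sigma> \<omega>" and Bm': "?B \<sigma> \<in> borel_measurable M"
        using band_partition_concentration(2,3)[OF \<gamma> J n \<sigma> r, of 1 \<beta>'] by auto
      note [measurable] = Bm'
      let ?E = "{\<omega> \<in> space M. \<delta> < \<bar>1 / real ?N * ln (?B \<sigma> \<omega>) - F'\<bar>}"
      have "(\<integral>\<^sup>+\<omega>. W \<sigma> \<omega> \<partial>M) = ennreal (exp (\<beta>\<^sup>2 * real ?N / 2)) * (\<integral>\<^sup>+\<omega>. \<Phi> (?C * ?B \<sigma> \<omega>) \<partial>M)"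
        using band_partition_tilt[OF \<gamma> J n \<sigma> r \<Phi>m, of \<beta> \<beta>'] \<sigma> by (simp add: W_def)
      also have "(\<integral>\<^sup>+\<omega>. \<Phi> (?C * ?B \<sigma> \<omega>) \<partial>M) = (\<integral>\<^sup>+\<omega>. indicator ?E \<omega> \<partial>M)"
      proof (rule nn_integral_cong_AE)
        show "AE \<omega> in M. \<Phi> (?C * ?B \<sigma> \<omega>) = indicator ?E \<omega>"
          using Bpos AE_space
        proof eventually_elim
          case (elim \<omega>)
          have "1 / real ?N * ln (?C * ?B \<sigma> \<omega>) - \<beta> * \<beta>' * mixture \<gamma> r - F' = 1 / real ?N * ln (?B \<sigma> \<omega>) - F'"
            using elim(1) by (simp add: ln_mult distrib_left add_divide_distrib del: of_nat_Suc)
          then show ?case using elim(2) by (simp add: \<Phi>_def indicator_def del: of_nat_Suc)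
        qed
      qed
      also have "\<dots> = ennreal (measure M ?E)" by (simp add: M.emeasure_eq_measure)
      also have "\<dots> \<le> ennreal q" by (intro ennreal_leI conc \<sigma>)
      finally show ?thesis using q by (simp add: ennreal_mult mult_left_mono)
    qed (simp add: W_def)
  qed
  also have "\<dots> = ennreal (exp (\<beta>\<^sup>2 * real ?N / 2) * q)" by (simp add: S.emeasure_space_1)
  finally have "(\<integral>\<^sup>+\<omega>. ennreal (measure (gibbs ?N \<beta> (?h \<omega>)) (?A \<omega>)) \<partial>M)
      \<le> emeasure M ?bad + ennreal (1 / k) * ennreal (exp (\<beta>\<^sup>2 * real ?N / 2) * q)"
    by (simp add: mult_left_mono)
  also have "\<dots> = ennreal (measure M ?bad + 1 / k * (exp (\<beta>\<^sup>2 * real ?N / 2) * q))"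
  proof -
    let ?Q = "exp (\<beta>\<^sup>2 * real ?N / 2) * q"
    have eq: "ennreal (1 / k) * ennreal ?Q = ennreal (1 / k * ?Q)"
      by (rule ennreal_mult[symmetric]) (use k q in auto)
    have pos: "0 \<le> 1 / k * ?Q" using k q by simp
    show ?thesis by (simp only: M.emeasure_eq_measure eq ennreal_plus[OF measure_nonneg pos])
  qed
  finally show ?thesis
    using k q by (intro integral_le_of_nn_integral_le) auto
qed

lemma eventually_exponential_bound:
  fixes e :: "nat \<Rightarrow> real"
  assumes \<kappa>: "0 < \<kappa>" and e: "\<forall>\<^sub>F N in sequentially. e N \<le> 4 * exp (- \<kappa> * real N)"
  shows "limsup (\<lambda>N. ereal (1 / real N) * eln (e N)) < 0"
proof -
  have "(\<lambda>N. ln 4 * (1 / real N)) \<longlonglongrightarrow> ln 4 * 0" by (intro tendsto_intros lim_1_over_n)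
  then have "\<forall>\<^sub>F N in sequentially. ln 4 * (1 / real N) < \<kappa> / 2" using \<kappa> by (intro order_tendstoD) auto
  then have "\<forall>\<^sub>F N in sequentially. ereal (1 / real N) * eln (e N) \<le> ereal (- \<kappa> / 2)"
    using e eventually_gt_at_top[of 0]
  proof eventually_elim
    case (elim N)
    show ?case
    proof (cases "0 < e N")
      case True
      have "ln (e N) \<le> ln (4 * exp (- \<kappa> * real N))" using True elim(2) by (subst ln_le_cancel_iff) auto
      also have "\<dots> = ln 4 - \<kappa> * real N" by (simp add: ln_mult)
      finally have "1 / real N * ln (e N) \<le> 1 / real N * (ln 4 - \<kappa> * real N)" by (intro mult_left_mono) auto
      also have "\<dots> = ln 4 * (1 / real N) - \<kappa>" using elim(3) by (simp add: field_simps)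
      finally have "1 / real N * ln (e N) \<le> - \<kappa> / 2" using elim(1) by linarith
      then show ?thesis using True by (simp add: eln_def)
    next
      case False
      then show ?thesis using elim(3) by (simp add: eln_def)
    qed
  qed
  then have "limsup (\<lambda>N. ereal (1 / real N) * eln (e N)) \<le> ereal (- \<kappa> / 2)"
    by (rule Limsup_bounded)
  also have "\<dots> < 0" using \<kappa> by simp
  finally show ?thesis .
qed

lemma concentration_exponent:
  fixes x b d :: real
  assumes "0 < x" "0 < b"
  shows "- (x * (d / 2))\<^sup>2 / (8 * (b * x)) = - (d\<^sup>2 / (32 * b)) * x"
  using assms by (simp add: power2_eq_square field_simps)

theorem corollary2p1:
  fixes \<gamma> :: "nat \<Rightarrow> real"
    and M :: "'a measure" and J :: "nat \<Rightarrow> nat list \<Rightarrow> 'a \<Rightarrow> real"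
    and M' :: "'b measure" and H' :: "nat \<Rightarrow> (nat \<Rightarrow> real) \<Rightarrow> 'b \<Rightarrow> real"
    and \<beta> \<beta>\<^sub>c \<beta>' r \<delta> F' :: real
  assumes "mixture_coeffs \<gamma>"
    and "mixture \<gamma> 1 = 1"
    and "disorder M J"
    and "critical_beta \<gamma> M J \<beta>\<^sub>c"
    and "0 \<le> \<beta>" and "\<beta> \<le> \<beta>\<^sub>c"
    and "\<bar>r\<bar> < 1"
    and "0 < \<beta>'" and "0 < \<delta>"
    and "shifted_model \<gamma> (r\<^sup>2) M' H'"
    and "limit_free_energy M' H' \<beta>' F'"
  shows "limsup (\<lambda>N. ereal (1 / real N) * eln (\<integral>\<omega>.
      (let h = hamiltonian \<gamma> N (\<lambda>l. J N l \<omega>) in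
        measure (gibbs N \<beta> h)
          {\<sigma> \<in> spin_sphere N.
            \<bar>band_free_energy N r \<beta>' h \<sigma> - \<beta> * \<beta>' * (mixture \<gamma> r / mixture \<gamma> 1) - F'\<bar> > \<delta>})
      \<partial>M)) < 0"
proof -
  \<comment> \<open>\<open>c\<close> and \<open>c'\<close> are the rates in the deviation bounds for the free energy of the band and for the partition function; half of \<open>\<delta>\<close> and of \<open>\<epsilon>\<close> is spent on the distance from the mean to its limit.\<close>
  define c where "c = \<delta>\<^sup>2 / (32 * (\<beta>'\<^sup>2 + 1))"
  define \<epsilon> where "\<epsilon> = c / 2"
  define c' where "c' = \<epsilon>\<^sup>2 / (32 * (\<beta>\<^sup>2 + 1))"
  define \<kappa> where "\<kappa> = min c' (c / 2)"
  have bpos: "0 < \<beta>\<^sup>2 + 1" "0 < \<beta>'\<^sup>2 + 1" by (auto intro: add_nonneg_pos)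
  have c: "0 < c" using \<open>0 < \<delta>\<close> bpos by (simp add: c_def)
  then have \<epsilon>: "0 < \<epsilon>" by (simp add: \<epsilon>_def)
  then have c': "0 < c'" using bpos by (simp add: c'_def)
  have \<kappa>: "0 < \<kappa>" using c c' by (simp add: \<kappa>_def)
  let ?h = "\<lambda>N \<omega> \<sigma>. random_hamiltonian \<gamma> J N \<sigma> \<omega>"
  let ?Z = "\<lambda>N \<omega>. partition_function N \<beta> (?h N \<omega>)"
  let ?B = "\<lambda>N \<sigma> \<omega>. band_partition N r \<beta>' (?h N \<omega>) \<sigma>"
  let ?e = "\<lambda>N. \<integral>\<omega>. measure (gibbs N \<beta> (?h N \<omega>))
     {\<sigma> \<in> spin_sphere N. \<delta> < \<bar>band_free_energy N r \<beta>' (?h N \<omega>) \<sigma> - \<beta> * \<beta>' * mixture \<gamma> r - F'\<bar>} \<partial>M"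
  interpret M: prob_space M using \<open>disorder M J\<close> by (simp add: disorder_def)
  have Z_lim: "(\<lambda>N. 1 / real N * (\<integral>\<omega>. ln (?Z N \<omega>) \<partial>M)) \<longlonglongrightarrow> \<beta>\<^sup>2 / 2"
    using assms(4-6) by (simp add: critical_beta_def free_energy_def)
  let ?m = "\<lambda>n. \<integral>\<omega>. ln (\<integral>g. exp (sqrt (real (Suc n) / real n) * (\<beta>' * H' n (sphere_point n g) \<omega>)) \<partial>sphere_index n) \<partial>M'"
  have B_lim: "(\<lambda>n. 1 / real (Suc n) * ?m n) \<longlonglongrightarrow> F'"
    by (rule expected_band_free_energy_tendsto[OF assms(10,11)])
  have "\<forall>\<^sub>F n in sequentially. \<bar>1 / real (Suc n) * ?m n - F'\<bar> < \<delta> / 2"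
    using tendstoD[OF B_lim, of "\<delta> / 2"] \<open>0 < \<delta>\<close> by (simp add: dist_real_def)
  moreover have "\<forall>\<^sub>F n in sequentially. \<bar>1 / real (Suc n) * (\<integral>\<omega>. ln (?Z (Suc n) \<omega>) \<partial>M) - \<beta>\<^sup>2 / 2\<bar> < \<epsilon> / 2"
    using tendstoD[OF LIMSEQ_Suc[OF Z_lim], of "\<epsilon> / 2"] \<epsilon> by (simp add: dist_real_def)
  ultimately have "\<forall>\<^sub>F n in sequentially. ?e (Suc n) \<le> 4 * exp (- \<kappa> * real (Suc n))"
    using eventually_gt_at_top[of 0]
  proof eventually_elim
    case (elim n)
    let ?N = "Suc n"
    have N: "0 < real ?N" by simp
    define k where "k = exp (real ?N * (\<beta>\<^sup>2 / 2 - \<epsilon>))"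
    have band: "measure M {\<omega> \<in> space M. \<delta> < \<bar>1 / real ?N * ln (?B ?N \<sigma> \<omega>) - F'\<bar>} \<le> 2 * exp (- c * real ?N)"
      if \<sigma>: "\<sigma> \<in> spin_sphere ?N" for \<sigma>
    proof -
      let ?u = "real ?N * (\<delta> / 2)"
      have u: "0 < ?u" using \<open>0 < \<delta>\<close> by simp
      note conc = band_partition_concentration[OF assms(1,2,3) elim(3) \<sigma> assms(7) u, of \<beta>']
      note [measurable] = conc(3)
      have mean: "(\<integral>\<omega>. ln (?B ?N \<sigma> \<omega>) \<partial>M) = ?m n"
      proof -
        have "(\<integral>\<omega>. ln (?B ?N \<sigma> \<omega>) \<partial>M) = (\<integral>\<omega>. ln (\<integral>g. exp (\<beta>' * ?h ?N \<omega> (band_point ?N \<sigma> r g)) \<partial>band_index ?N \<sigma>) \<partial>M)"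
          by (intro Bochner_Integration.integral_cong refl) (simp only: band_partition_eq[OF assms(1,2,3) elim(3) \<sigma> assms(7)])
        then show ?thesis
          using expected_band_log_partition[OF assms(1,2,3,7,10) elim(3) \<sigma>, of \<beta>'] by simp
      qed
      have "?u \<le> \<bar>ln b - ?m n\<bar>" if "\<delta> < \<bar>1 / real ?N * ln b - F'\<bar>" for b
      proof -
        have "\<delta> / 2 \<le> \<bar>1 / real ?N * ln b - 1 / real ?N * ?m n\<bar>" using that elim(1) by linarith
        also have "\<dots> = \<bar>ln b - ?m n\<bar> / real ?N"
          unfolding right_diff_distrib[symmetric] abs_mult by (simp del: of_nat_Suc)
        finally show ?thesis using N by (simp add: field_simps del: of_nat_Suc)
      qed
      then have "measure M {\<omega> \<in> space M. \<delta> < \<bar>1 / real ?N * ln (?B ?N \<sigma> \<omega>) - F'\<bar>} \<le> measure M {\<omega> \<in> space M. ?u \<le> \<bar>ln (?B ?N \<sigma> \<omega>) - (\<integral>\<omega>. ln (?B ?N \<sigma> \<omega>) \<partial>M)\<bar>}"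
        unfolding mean by (intro M.finite_measure_mono) (auto simp del: of_nat_Suc)
      also have "\<dots> \<le> 2 * exp (- ?u\<^sup>2 / (8 * ((\<beta>'\<^sup>2 + 1) * real ?N)))" by (rule conc(1))
      also have "- ?u\<^sup>2 / (8 * ((\<beta>'\<^sup>2 + 1) * real ?N)) = - c * real ?N"
        unfolding c_def by (rule concentration_exponent[OF N bpos(2)])
      finally show ?thesis .
    qed
    have bad: "measure M {\<omega> \<in> space M. ?Z ?N \<omega> < k} \<le> 2 * exp (- c' * real ?N)"
    proof -
      let ?u = "real ?N * (\<epsilon> / 2)"
      have u: "0 < ?u" using \<epsilon> by simp
      note conc = sphere_partition_concentration[OF assms(1,2,3) zero_less_Suc u, of n \<beta>]
      note [measurable] = conc(3)
      have "measure M {\<omega> \<in> space M. ?Z ?N \<omega> < k} \<le> measure M {\<omega> \<in> space M. ?u \<le> \<bar>ln (?Z ?N \<omega>) - (\<integral>\<omega>. ln (?Z ?N \<omega>) \<partial>M)\<bar>}"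
      proof (rule M.finite_measure_mono_AE)
        show "AE \<omega> in M. \<omega> \<in> {\<omega> \<in> space M. ?Z ?N \<omega> < k} \<longrightarrow> \<omega> \<in> {\<omega> \<in> space M. ?u \<le> \<bar>ln (?Z ?N \<omega>) - (\<integral>\<omega>. ln (?Z ?N \<omega>) \<partial>M)\<bar>}"
          using conc(2)
        proof eventually_elim
          case e: (elim \<omega>)
          have "?u \<le> \<bar>ln (?Z ?N \<omega>) - (\<integral>\<omega>. ln (?Z ?N \<omega>) \<partial>M)\<bar>" if "?Z ?N \<omega> < k"
          proof -
            have "ln (?Z ?N \<omega>) < ln k" using that e by (subst ln_less_cancel_iff) (auto simp: k_def)
            then have a: "ln (?Z ?N \<omega>) < real ?N * (\<beta>\<^sup>2 / 2 - \<epsilon>)" by (simp add: k_def)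
            have "\<beta>\<^sup>2 / 2 - \<epsilon> / 2 < 1 / real ?N * (\<integral>\<omega>. ln (?Z ?N \<omega>) \<partial>M)" using elim(2) by linarith
            then have "real ?N * (\<beta>\<^sup>2 / 2 - \<epsilon> / 2) < real ?N * (1 / real ?N * (\<integral>\<omega>. ln (?Z ?N \<omega>) \<partial>M))"
              by (rule mult_strict_left_mono[OF _ N])
            also have "\<dots> = (\<integral>\<omega>. ln (?Z ?N \<omega>) \<partial>M)" using N by simp
            finally have "real ?N * (\<beta>\<^sup>2 / 2) - real ?N * (\<epsilon> / 2) < (\<integral>\<omega>. ln (?Z ?N \<omega>) \<partial>M)" by (simp only: right_diff_distrib)
            moreover have "real ?N * \<epsilon> = 2 * (real ?N * (\<epsilon> / 2))" by simp
            ultimately show ?thesis using a unfolding right_diff_distrib by linarith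
          qed
          then show ?case by blast
        qed
      qed measurable
      also have "\<dots> \<le> 2 * exp (- ?u\<^sup>2 / (8 * ((\<beta>\<^sup>2 + 1) * real ?N)))" by (rule conc(1))
      also have "- ?u\<^sup>2 / (8 * ((\<beta>\<^sup>2 + 1) * real ?N)) = - c' * real ?N"
        unfolding c'_def by (rule concentration_exponent[OF N bpos(1)])
      finally show ?thesis .
    qed
    have "?e ?N \<le> measure M {\<omega> \<in> space M. ?Z ?N \<omega> < k} + 1 / k * (exp (\<beta>\<^sup>2 * real ?N / 2) * (2 * exp (- c * real ?N)))"
      by (rule expected_gibbs_bound[OF assms(1,2,3,7) elim(3) _ _ band]) (auto simp: k_def)
    also have "1 / k * (exp (\<beta>\<^sup>2 * real ?N / 2) * (2 * exp (- c * real ?N))) = 2 * exp (- (c / 2) * real ?N)"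
    proof -
      have "1 / k * (exp (\<beta>\<^sup>2 * real ?N / 2) * (2 * exp (- c * real ?N))) = 2 * exp (- (real ?N * (\<beta>\<^sup>2 / 2 - \<epsilon>)) + \<beta>\<^sup>2 * real ?N / 2 + - c * real ?N)"
      proof -
        have "1 / exp a * (exp b * (2 * exp d)) = 2 * exp (- a + b + d)" for a b d :: real
          unfolding exp_add exp_minus by (simp add: divide_inverse)
        then show ?thesis unfolding k_def by blast
      qed
      also have "- (real ?N * (\<beta>\<^sup>2 / 2 - \<epsilon>)) + \<beta>\<^sup>2 * real ?N / 2 + - c * real ?N = - (c / 2) * real ?N"
      proof -
        have "- (x * (b / 2 - c / 2)) + b * x / 2 + - c * x = - (c / 2) * x" for b x :: real
          by (simp add: field_simps)
        then show ?thesis unfolding \<epsilon>_def by blast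
      qed
      finally show ?thesis .
    qed
    also have "measure M {\<omega> \<in> space M. ?Z ?N \<omega> < k} + 2 * exp (- (c / 2) * real ?N) \<le> 2 * exp (- \<kappa> * real ?N) + 2 * exp (- \<kappa> * real ?N)"
    proof (rule add_mono)
      have "exp (- c' * real ?N) \<le> exp (- \<kappa> * real ?N)" "exp (- (c / 2) * real ?N) \<le> exp (- \<kappa> * real ?N)"
        unfolding \<kappa>_def exp_le_cancel_iff by (intro mult_right_mono; simp)+
      then show "measure M {\<omega> \<in> space M. ?Z ?N \<omega> < k} \<le> 2 * exp (- \<kappa> * real ?N)" "2 * exp (- (c / 2) * real ?N) \<le> 2 * exp (- \<kappa> * real ?N)"
        using bad by linarith+
    qed
    finally show ?case by simp
  qed
  then have "\<forall>\<^sub>F N in sequentially. ?e N \<le> 4 * exp (- \<kappa> * real N)"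
    by (subst (asm) eventually_sequentially_Suc)
  from eventually_exponential_bound[OF \<kappa> this] show ?thesis
    using assms(2) by (simp add: Let_def)
qed

end
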